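(* Let $q$ be a prime power, $V,W$ finite-dimensional vector spaces over $\mathbb{F}_q$, $d\ge0$ an integer, $\epsilon>0$, and let $f:\mathcal{L}(V,W)\to\{0,1\}$ be $(d,\epsilon)$-global. Let $\ell\ge2$ be a power of $2$. Then $$\|f^{=d}\|_2^2\le q^{460d^2\ell}\,\mathbb{E}[f]\,\epsilon^{1-2/\ell}.$$
   Context: $\mathcal{L}(V,W)$ is the space of linear maps $V\to W$. For a finite set $X$, $L^2(X)$ is the space of functions $X\to\mathbb{C}$ with $\langle f,g\rangle=\mathbb{E}_{x\in X}[f(x)\overline{g(x)}]$ (uniform $x$), $\|f\|_2^2=\langle f,f\rangle$, $\mathbb{E}[f]=\mathbb{E}_{x\in X}f(x)$. Pure degree parts: write $q=p^m$, $p$ prime, and $\varphi:\mathbb{F}_q\to\mathbb{C}^\times$, $\varphi(x)=e^{\frac{2\pi i}{p}\sum_{i=0}^{m-1}x^{p^i}}$. For $X\in\mathcal{L}(W,V)$ put $u_X(A)=\varphi(\mathrm{tr}(XA))$; these form an orthonormal basis of $L^2(\mathcal{L}(V,W))$. With $\hat f(X)=\langle f,u_X\rangle$, set $f^{=d}=\sum_{\mathrm{rank}(X)=d}\hat f(X)u_X$. Globalness: for $V'\le V$, $W'\le W$, identify $\mathcal{L}(V/V',W')$ with $\{S\in\mathcal{L}(V,W): V'\le\ker S,\ \mathrm{im}\,S\le W'\}$. For $T\in\mathcal{L}(V,W)$ the restriction $f_{(V',W')\to T}\in L^2(\mathcal{L}(V/V',W'))$ is $f_{(V',W')\to T}(S)=f(S+T)$;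 it is a $d$-restriction if $d=\dim V'+\mathrm{codim}\,W'$. $f$ is $(d,\epsilon)$-global if $\|f_{(V',W')\to T}\|_2^2\le\epsilon$ for every $d$-restriction. *)

theory Defs
  imports Complex_Main "HOL-Library.Cardinality" "HOL-Computational_Algebra.Primes"
begin

text \<open>
  A vector space over a field \<open>'k\<close> is a type together with a scalar multiplication satisfying
  the library locale \<^locale>\<open>vector_space\<close>; since that type may be a singleton, the zero space
  is included. Below, \<open>sV\<close> and \<open>sW\<close> are the scalar multiplications of \<open>V\<close> and \<open>W\<close>.
\<close>

definition lin_maps :: "('k::field \<Rightarrow> 'v::ab_group_add \<Rightarrow> 'v) \<Rightarrow> ('k \<Rightarrow> 'w::ab_group_add \<Rightarrow> 'w) \<Rightarrow> ('v \<Rightarrow> 'w) set"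
  where "lin_maps sV sW = {A. Vector_Spaces.linear sV sW A}"

definition lin_rank :: "('k::field \<Rightarrow> 'w::ab_group_add \<Rightarrow> 'w) \<Rightarrow> ('v \<Rightarrow> 'w) \<Rightarrow> nat"
  where "lin_rank sW A = vector_space.dim sW (range A)"

text \<open>The sum of the diagonal matrix entries in a chosen basis; the choice is immaterial.\<close>

definition lin_trace :: "('k::field \<Rightarrow> 'v::ab_group_add \<Rightarrow> 'v) \<Rightarrow> ('v \<Rightarrow> 'v) \<Rightarrow> 'k"
  where "lin_trace sV A =
    (let B = (SOME B. \<not> module.dependent sV B \<and> module.span sV B = UNIV)
     in \<Sum>b\<in>B. module.representation sV B (A b) b)"


subsection \<open>The space \<open>L\<^sup>2(X)\<close> for a finite set \<open>X\<close>, with uniform measure\<close>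

definition avg :: "'x set \<Rightarrow> ('x \<Rightarrow> complex) \<Rightarrow> complex"
  where "avg X f = (\<Sum>x\<in>X. f x) / of_nat (card X)"

definition L2_inner :: "'x set \<Rightarrow> ('x \<Rightarrow> complex) \<Rightarrow> ('x \<Rightarrow> complex) \<Rightarrow> complex"
  where "L2_inner X f g = avg X (\<lambda>x. f x * cnj (g x))"

definition L2_norm :: "'x set \<Rightarrow> ('x \<Rightarrow> complex) \<Rightarrow> real"
  where "L2_norm X f = sqrt (Re (L2_inner X f f))"


subsection \<open>Pure degree parts\<close>

text \<open>
  For a field \<open>'k\<close> with \<open>p ^ m\<close> elements, the sum of the \<open>x ^ p ^ i\<close> lies in the prime field,
  so it is the image of some natural number, unique modulo \<open>p\<close>; the exponential does not depend on
  which one is used.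
\<close>

definition char_phi :: "nat \<Rightarrow> nat \<Rightarrow> 'k::field \<Rightarrow> complex"
  where "char_phi p m x =
    exp (2 * of_real pi * \<i> / of_nat p * of_nat (LEAST n. of_nat n = (\<Sum>i<m. x ^ p ^ i)))"

definition char_u ::
  "nat \<Rightarrow> nat \<Rightarrow> ('k::field \<Rightarrow> 'v::ab_group_add \<Rightarrow> 'v) \<Rightarrow> ('w \<Rightarrow> 'v) \<Rightarrow> ('v \<Rightarrow> 'w) \<Rightarrow> complex"
  where "char_u p m sV X A = char_phi p m (lin_trace sV (X \<circ> A))"

definition fourier_coeff ::
  "nat \<Rightarrow> nat \<Rightarrow> ('k::field \<Rightarrow> 'v::ab_group_add \<Rightarrow> 'v) \<Rightarrow> ('k \<Rightarrow> 'w::ab_group_add \<Rightarrow> 'w) \<Rightarrow>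
   (('v \<Rightarrow> 'w) \<Rightarrow> complex) \<Rightarrow> ('w \<Rightarrow> 'v) \<Rightarrow> complex"
  where "fourier_coeff p m sV sW f X = L2_inner (lin_maps sV sW) f (char_u p m sV X)"

definition degree_part ::
  "nat \<Rightarrow> nat \<Rightarrow> ('k::field \<Rightarrow> 'v::ab_group_add \<Rightarrow> 'v) \<Rightarrow> ('k \<Rightarrow> 'w::ab_group_add \<Rightarrow> 'w) \<Rightarrow>
   nat \<Rightarrow> (('v \<Rightarrow> 'w) \<Rightarrow> complex) \<Rightarrow> (('v \<Rightarrow> 'w) \<Rightarrow> complex)"
  where "degree_part p m sV sW d f A =
    (\<Sum>X\<in>{X \<in> lin_maps sW sV. lin_rank sV X = d}. fourier_coeff p m sV sW f X * char_u p m sV X A)"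


subsection \<open>Globalness\<close>

text \<open>\<open>\<L>(V/V', W')\<close>, identified with a set of linear maps \<open>V \<rightarrow> W\<close>.\<close>

definition sub_lin_maps ::
  "('k::field \<Rightarrow> 'v::ab_group_add \<Rightarrow> 'v) \<Rightarrow> ('k \<Rightarrow> 'w::ab_group_add \<Rightarrow> 'w) \<Rightarrow> 'v set \<Rightarrow> 'w set \<Rightarrow> ('v \<Rightarrow> 'w) set"
  where "sub_lin_maps sV sW V' W' = {S \<in> lin_maps sV sW. V' \<subseteq> {v. S v = 0} \<and> range S \<subseteq> W'}"

definition restr :: "(('v \<Rightarrow> 'w::ab_group_add) \<Rightarrow> complex) \<Rightarrow> ('v \<Rightarrow> 'w) \<Rightarrow> (('v \<Rightarrow> 'w) \<Rightarrow> complex)"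
  where "restr f T S = f (\<lambda>v. S v + T v)"

definition is_global ::
  "('k::field \<Rightarrow> 'v::ab_group_add \<Rightarrow> 'v) \<Rightarrow> ('k \<Rightarrow> 'w::ab_group_add \<Rightarrow> 'w) \<Rightarrow>
   nat \<Rightarrow> real \<Rightarrow> (('v \<Rightarrow> 'w) \<Rightarrow> complex) \<Rightarrow> bool"
  where "is_global sV sW d \<epsilon> f \<longleftrightarrow>
    (\<forall>V' W' T. module.subspace sV V' \<longrightarrow> module.subspace sW W' \<longrightarrow> T \<in> lin_maps sV sW \<longrightarrow>
       d = vector_space.dim sV V' + (vector_space.dim sW UNIV - vector_space.dim sW W') \<longrightarrow>
       (L2_norm (sub_lin_maps sV sW V' W') (restr f T))\<^sup>2 \<le> \<epsilon>)"

end

theory Submission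
  imports Defs "HOL-Library.Function_Algebras" "HOL-Analysis.Convex"
    "HOL-Computational_Algebra.Polynomial" "HOL-Number_Theory.Cong"
    "HOL-Analysis.Complex_Transcendental"
begin

text \<open>
  Let \<open>g\<close> be the level-\<open>d\<close> part of \<open>f\<close>. Its weight is the correlation of \<open>f\<close> with \<open>g\<close>, and since
  \<open>f\<close> is Boolean, iterated Cauchy--Schwarz bounds the \<open>l\<close>-th power of the weight by
  \<open>E[f]\<^bsup>l-1\<^esup> E|g|\<^bsup>l\<^esup>\<close>. The moment is estimated by repeated squaring: if \<open>h\<close> has Fourier
  support on rank at most \<open>D\<close>, then \<open>E|h|\<^sup>4\<close> is at most \<open>q\<^bsup>O(D\<^sup>2)\<^esup> E|h|\<^sup>2\<close> times the largest \<open>E|h'|\<^sup>2\<close>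
  over restrictions \<open>h'\<close> of \<open>h\<close>. For this, the pairs \<open>(X, X + Y)\<close> in the Fourier expansion of \<open>h\<^sup>2\<close>
  are sorted by the part \<open>U\<close> of their images and the part \<open>K\<close> of their kernels which they share; on
  \<open>K\<close> and modulo \<open>U\<close> the two maps are transversal, so \<open>Y\<close> determines them up to few choices, and
  Cauchy--Schwarz applies. Finally, Moebius inversion over the pairs \<open>(U, K)\<close> bounds restrictions of
  \<open>g\<close> of every order by levels \<open>r\<close> of \<open>i\<close>-restrictions of \<open>f\<close> with \<open>i + r \<le> d\<close>. Apart from \<open>g\<close> itself
  these have \<open>r < d\<close>, and induction gives them weight at most \<open>\<epsilon> \<epsilon>\<^bsup>1-2/l\<^esup>\<close> up to powers of \<open>q\<close>,
  which is where the exponent of \<open>\<epsilon>\<close> comes from.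
\<close>

section \<open>Fourier analysis of a pairing of finite abelian groups\<close>

text \<open>The obstacle is that levels and restrictions do not commute. Under a further restriction
  the rank of a frequency may drop by any amount up to the added order, so globalness of
  \<open>f\<close> does not pass to \<open>g\<close>. Moreover the moments of \<open>g\<close>
  involve its restrictions of order up to \<open>l * d\<close>, while globalness controls no order
  beyond \<open>d\<close>. The estimate refers to itself: restrictions of \<open>g\<close> are
  bounded by a maximum \<open>\<Delta>\<close> with the weight of \<open>g\<close> as one entry.
  With \<open>t = l / 2\<close>, that weight occurs to the power \<open>2 * t\<close> on the left
  and at most to the power \<open>t\<close> on the right. If it is the maximum, the surplus is
  cancelled. Otherwise the bound \<open>\<epsilon> * e\<close> of the lower levels, with
  \<open>e ^ t = \<epsilon> ^ (t - 1)\<close>, reproduces itself, because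
  \<open>(\<epsilon> * e) ^ (t - 1) = e ^ (2 * t - 1)\<close>. In the exponent,
  \<open>460 * l\<close> is \<open>920 * t\<close>. One step of the induction consumes
  \<open>26 * t\<^sup>2 * d\<^sup>2\<close> before a root is taken: \<open>10\<close> from the
  moment and \<open>16\<close> from the reduction of the order.\<close>

locale char_pairing =
  fixes GX :: "'x::ab_group_add set" and GT :: "'t::ab_group_add set"
    and e :: "'x \<Rightarrow> 't \<Rightarrow> complex"
    and N :: "'p \<Rightarrow> 'x set" and S :: "'p \<Rightarrow> 't set" and PP :: "'p set"
  assumes finite_GX: "finite GX" and GX_0: "0 \<in> GX"
    and GX_diff: "\<lbrakk>X \<in> GX; Y \<in> GX\<rbrakk> \<Longrightarrow> X - Y \<in> GX"
    and finite_GT: "finite GT" and GT_0: "0 \<in> GT"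
    and GT_diff: "\<lbrakk>T \<in> GT; T' \<in> GT\<rbrakk> \<Longrightarrow> T - T' \<in> GT"
    and e_add_left: "\<lbrakk>X \<in> GX; Y \<in> GX; T \<in> GT\<rbrakk> \<Longrightarrow> e (X + Y) T = e X T * e Y T"
    and e_add_right: "\<lbrakk>X \<in> GX; T \<in> GT; T' \<in> GT\<rbrakk> \<Longrightarrow> e X (T + T') = e X T * e X T'"
    and norm_e: "\<lbrakk>X \<in> GX; T \<in> GT\<rbrakk> \<Longrightarrow> cmod (e X T) = 1"
    and N_sub: "p \<in> PP \<Longrightarrow> N p \<subseteq> GX" and N_0: "p \<in> PP \<Longrightarrow> 0 \<in> N p"
    and N_diff: "\<lbrakk>p \<in> PP; X \<in> N p; Y \<in> N p\<rbrakk> \<Longrightarrow> X - Y \<in> N p"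
    and S_sub: "p \<in> PP \<Longrightarrow> S p \<subseteq> GT" and S_0: "p \<in> PP \<Longrightarrow> 0 \<in> S p"
    and S_diff: "\<lbrakk>p \<in> PP; T \<in> S p; T' \<in> S p\<rbrakk> \<Longrightarrow> T - T' \<in> S p"
    and orthogonality: "\<lbrakk>p \<in> PP; X \<in> GX\<rbrakk> \<Longrightarrow>
      (\<Sum>T\<in>S p. e X T) = of_bool (X \<in> N p) * of_nat (card (S p))"
begin

definition ev :: "('x \<Rightarrow> complex) \<Rightarrow> 't \<Rightarrow> complex" where
  "ev a T = (\<Sum>X\<in>GX. a X * e X T)"

text \<open>The restriction of \<open>ev a\<close> to \<open>T + S p\<close> has its Fourier coefficients indexed by \<open>GX\<close> modulo
  \<open>N p\<close>. Functions on this quotient are represented by functions on \<open>GX\<close> that are constant on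
  cosets, which is why sums over \<open>GX\<close> are divided by \<open>card (N p)\<close>.\<close>

definition coset_sum :: "('x \<Rightarrow> complex) \<Rightarrow> 'p \<Rightarrow> 'x \<Rightarrow> 't \<Rightarrow> complex" where
  "coset_sum a p X T = (\<Sum>Y\<in>GX. of_bool (Y - X \<in> N p) * (a Y * e Y T))"

definition NS :: "('x \<Rightarrow> complex) \<Rightarrow> 'p \<Rightarrow> 't \<Rightarrow> real" where
  "NS a p T = (\<Sum>X\<in>GX. (cmod (coset_sum a p X T))\<^sup>2) / real (card (N p))"

definition mean :: "'p \<Rightarrow> ('t \<Rightarrow> real) \<Rightarrow> real" where
  "mean p \<phi> = (\<Sum>R\<in>S p. \<phi> R) / real (card (S p))"

lemma GX_uminus: "X \<in> GX \<Longrightarrow> - X \<in> GX"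
  using GX_diff[OF GX_0] by fastforce

lemma GX_add: "\<lbrakk>X \<in> GX; Y \<in> GX\<rbrakk> \<Longrightarrow> X + Y \<in> GX"
  using GX_diff[of X "- Y"] GX_uminus[of Y] by simp

lemma N_uminus: "\<lbrakk>p \<in> PP; X \<in> N p\<rbrakk> \<Longrightarrow> - X \<in> N p"
  using N_diff[of p 0 X] N_0[of p] by simp

lemma N_add: "\<lbrakk>p \<in> PP; X \<in> N p; Y \<in> N p\<rbrakk> \<Longrightarrow> X + Y \<in> N p"
  using N_diff[of p X "- Y"] N_uminus[of p Y] by simp

lemma N_add_iff: "\<lbrakk>p \<in> PP; Y \<in> N p\<rbrakk> \<Longrightarrow> X + Y \<in> N p \<longleftrightarrow> X \<in> N p"
  using N_diff[of p "X + Y" Y] N_add[of p X Y] by auto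

lemma N_commute: "p \<in> PP \<Longrightarrow> X - Y \<in> N p \<longleftrightarrow> Y - X \<in> N p"
  using N_uminus[of p "X - Y"] N_uminus[of p "Y - X"] by auto

lemma S_uminus: "\<lbrakk>p \<in> PP; T \<in> S p\<rbrakk> \<Longrightarrow> - T \<in> S p"
  using S_diff[of p 0 T] S_0[of p] by simp

lemma S_add: "\<lbrakk>p \<in> PP; T \<in> S p; T' \<in> S p\<rbrakk> \<Longrightarrow> T + T' \<in> S p"
  using S_diff[of p T "- T'"] S_uminus[of p T'] by simp

lemma GT_uminus: "T \<in> GT \<Longrightarrow> - T \<in> GT"
  using GT_diff[OF GT_0] by fastforce

lemma GT_add: "\<lbrakk>T \<in> GT; T' \<in> GT\<rbrakk> \<Longrightarrow> T + T' \<in> GT"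
  using GT_diff[of T "- T'"] GT_uminus[of T'] by simp

lemma finite_N: "p \<in> PP \<Longrightarrow> finite (N p)"
  using N_sub finite_GX finite_subset by blast

lemma finite_S: "p \<in> PP \<Longrightarrow> finite (S p)"
  using S_sub finite_GT finite_subset by blast

lemma card_N_pos: "p \<in> PP \<Longrightarrow> card (N p) > 0"
  using finite_N N_0 by (metis card_gt_0_iff empty_iff)

lemma card_S_pos: "p \<in> PP \<Longrightarrow> card (S p) > 0"
  using finite_S S_0 by (metis card_gt_0_iff empty_iff)

lemma e_0: "T \<in> GT \<Longrightarrow> e 0 T = 1"
  using e_add_left[OF GX_0 GX_0, of T] norm_e[OF GX_0, of T] by (metis add_0 mult_cancel_left2 norm_zero zero_neq_one)

lemma cnj_e: "\<lbrakk>X \<in> GX; T \<in> GT\<rbrakk> \<Longrightarrow> cnj (e X T) = e (- X) T"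
proof -
  assume X: "X \<in> GX" and T: "T \<in> GT"
  have "e X T * cnj (e X T) = 1"
    using norm_e[OF X T] by (metis complex_norm_square of_real_1 one_power2)
  moreover have "e X T * e (- X) T = 1"
    using e_add_left[OF X GX_uminus[OF X] T] e_0[OF T] by simp
  ultimately show ?thesis by (metis mult.assoc mult.commute mult_1)
qed

lemma e_diff: "\<lbrakk>X \<in> GX; Y \<in> GX; T \<in> GT\<rbrakk> \<Longrightarrow> e (X - Y) T = e X T * cnj (e Y T)"
  using e_add_left[of X "- Y" T] GX_uminus[of Y] cnj_e by simp

lemma sum_rotate:
  fixes \<phi> :: "'i \<Rightarrow> 'j \<Rightarrow> 'l \<Rightarrow> 'c::comm_monoid_add"
  shows "(\<Sum>i\<in>I. \<Sum>j\<in>J. \<Sum>l\<in>L. \<phi> i j l) = (\<Sum>j\<in>J. \<Sum>l\<in>L. \<Sum>i\<in>I. \<phi> i j l)"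
  by (rule trans[OF sum.swap], intro sum.cong refl, rule sum.swap)

lemma sum_translate:
  fixes \<phi> :: "'x \<Rightarrow> 'c::comm_monoid_add"
  assumes "Y \<in> GX"
  shows "(\<Sum>X\<in>GX. \<phi> (X + Y)) = (\<Sum>X\<in>GX. \<phi> X)"
  by (rule sum.reindex_bij_witness[of _ "\<lambda>X. X - Y" "\<lambda>X. X + Y"])
     (use assms GX_add GX_diff in auto)

lemma card_coset: assumes "p \<in> PP" "X \<in> GX"
  shows "(\<Sum>Y\<in>GX. of_bool (Y - X \<in> N p)) = (of_nat (card (N p)) :: 'c::semiring_1)"
proof -
  have "(\<Sum>Y\<in>GX. of_bool (Y - X \<in> N p)) = (\<Sum>Y\<in>GX. (of_bool ((Y + X) - X \<in> N p) :: 'c))"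
    by (rule sum_translate[symmetric]) fact
  also have "\<dots> = (\<Sum>Y\<in>N p. 1)"
    using N_sub[OF assms(1)] finite_GX
    by (simp add: of_bool_def sum.If_cases Int_absorb1)
  finally show ?thesis by simp
qed

lemma double_coset:
  assumes p: "p \<in> PP" and X: "X \<in> GX"
  shows "(\<Sum>Z\<in>GX. of_bool (X - Z \<in> N p) * of_bool (Y - Z \<in> N p))
    = (of_bool (X - Y \<in> N p) * of_nat (card (N p)) :: 'c::comm_semiring_1)"
proof -
  have *: "X - Z \<in> N p \<and> Y - Z \<in> N p \<longleftrightarrow> X - Y \<in> N p \<and> Z - X \<in> N p" for Z
  proof
    assume a: "X - Z \<in> N p \<and> Y - Z \<in> N p"
    then have "(X - Z) - (Y - Z) \<in> N p" using N_diff[OF p] by blast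
    then show "X - Y \<in> N p \<and> Z - X \<in> N p" using a N_commute[OF p] by auto
  next
    assume a: "X - Y \<in> N p \<and> Z - X \<in> N p"
    then have "(X - Y) + (Z - X) \<in> N p" using N_add[OF p] by blast
    then show "X - Z \<in> N p \<and> Y - Z \<in> N p" using a N_commute[OF p]
      by (metis add_diff_cancel_left' diff_add_eq diff_diff_eq2 uminus_add_conv_diff)
  qed
  have "(\<Sum>Z\<in>GX. of_bool (X - Z \<in> N p) * of_bool (Y - Z \<in> N p) :: 'c) =
    (\<Sum>Z\<in>GX. of_bool (X - Y \<in> N p) * (of_bool (Z - X \<in> N p) :: 'c))"
    by (intro sum.cong refl) (simp only: of_bool_conj[symmetric] *)
  then show ?thesis using card_coset[OF p X, where 'c='c] by (simp flip: sum_distrib_left)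
qed

lemma ev_translate: "\<lbrakk>T \<in> GT; R \<in> GT\<rbrakk> \<Longrightarrow> ev a (T + R) = (\<Sum>X\<in>GX. a X * e X T * e X R)"
  unfolding ev_def by (intro sum.cong refl) (simp add: e_add_right)

text \<open>Both sides select the pairs \<open>X\<close>, \<open>Y\<close> in a common coset of
  \<open>N p\<close>: the left by orthogonality over \<open>S p\<close>, the right because such a
  pair is seen from each of the \<open>card (N p)\<close> representatives \<open>Z\<close> of its
  coset.\<close>

lemma parseval_inner:
  assumes p: "p \<in> PP" and T: "T \<in> GT"
  shows "(\<Sum>R\<in>S p. ev a (T + R) * cnj (ev b (T + R))) / of_nat (card (S p))
    = (\<Sum>X\<in>GX. coset_sum a p X T * cnj (coset_sum b p X T)) / of_nat (card (N p))"
proof -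
  have "(\<Sum>R\<in>S p. ev a (T + R) * cnj (ev b (T + R)))
     = (\<Sum>R\<in>S p. \<Sum>X\<in>GX. \<Sum>Y\<in>GX. (a X * e X T) * cnj (b Y * e Y T) * e (X - Y) R)"
  proof (intro sum.cong refl)
    fix R assume "R \<in> S p"
    then have R: "R \<in> GT" using S_sub p by blast
    show "ev a (T + R) * cnj (ev b (T + R)) =
      (\<Sum>X\<in>GX. \<Sum>Y\<in>GX. (a X * e X T) * cnj (b Y * e Y T) * e (X - Y) R)"
      unfolding ev_translate[OF T R] cnj_sum sum_product
      by (intro sum.cong refl) (simp add: e_diff R)
  qed
  also have "\<dots> = (\<Sum>X\<in>GX. \<Sum>Y\<in>GX. \<Sum>R\<in>S p. (a X * e X T) * cnj (b Y * e Y T) * e (X - Y) R)"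
    by (rule sum_rotate)
  also have "\<dots> = (\<Sum>X\<in>GX. \<Sum>Y\<in>GX. (a X * e X T) * cnj (b Y * e Y T) *
      of_bool (X - Y \<in> N p)) * of_nat (card (S p))"
    unfolding sum_distrib_right
    by (intro sum.cong refl) (simp add: orthogonality[OF p] GX_diff flip: sum_distrib_left)
  finally have 1: "(\<Sum>R\<in>S p. ev a (T + R) * cnj (ev b (T + R))) / of_nat (card (S p)) =
     (\<Sum>X\<in>GX. \<Sum>Y\<in>GX. (a X * e X T) * cnj (b Y * e Y T) * of_bool (X - Y \<in> N p))"
    using card_S_pos[OF p] by simp
  have "(\<Sum>Z\<in>GX. coset_sum a p Z T * cnj (coset_sum b p Z T)) =
    (\<Sum>Z\<in>GX. \<Sum>X\<in>GX. \<Sum>Y\<in>GX. (a X * e X T) * cnj (b Y * e Y T) *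
       (of_bool (X - Z \<in> N p) * of_bool (Y - Z \<in> N p)))"
    unfolding coset_sum_def cnj_sum sum_product
    by (intro sum.cong refl) simp
  also have "\<dots> = (\<Sum>X\<in>GX. \<Sum>Y\<in>GX. \<Sum>Z\<in>GX. (a X * e X T) * cnj (b Y * e Y T) *
       (of_bool (X - Z \<in> N p) * of_bool (Y - Z \<in> N p)))"
    by (rule sum_rotate)
  also have "\<dots> = (\<Sum>X\<in>GX. \<Sum>Y\<in>GX. (a X * e X T) * cnj (b Y * e Y T) *
      of_bool (X - Y \<in> N p)) * of_nat (card (N p))"
    unfolding sum_distrib_right
    by (intro sum.cong refl) (simp add: double_coset[OF p] flip: sum_distrib_left)
  finally show ?thesis unfolding 1 using card_N_pos[OF p] by simp
qed

lemma NS_eq_mean: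
  assumes "p \<in> PP" "T \<in> GT"
  shows "NS a p T = mean p (\<lambda>R. (cmod (ev a (T + R)))\<^sup>2)"
proof -
  have "complex_of_real (NS a p T) = complex_of_real (mean p (\<lambda>R. (cmod (ev a (T + R)))\<^sup>2))"
    unfolding NS_def mean_def
    using parseval_inner[OF assms, of a a] by (simp flip: complex_norm_square)
  then show ?thesis using of_real_eq_iff by blast
qed

lemma NS_nonneg: "NS a p T \<ge> 0"
  unfolding NS_def by (simp add: sum_nonneg)

lemma mean_mono: "(\<And>R. R \<in> S p \<Longrightarrow> \<phi> R \<le> \<psi> R) \<Longrightarrow> mean p \<phi> \<le> mean p \<psi>"
  unfolding mean_def by (intro divide_right_mono sum_mono) auto

lemma mean_cong: "(\<And>R. R \<in> S p \<Longrightarrow> \<phi> R = \<psi> R) \<Longrightarrow> mean p \<phi> = mean p \<psi>"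
  unfolding mean_def by simp

lemma mean_const: "p \<in> PP \<Longrightarrow> mean p (\<lambda>_. c) = c"
  unfolding mean_def using card_S_pos by simp

lemma mean_cmult: "mean p (\<lambda>R. c * \<phi> R) = c * mean p \<phi>"
  unfolding mean_def by (simp add: sum_distrib_left)

lemma mean_nonneg: "(\<And>R. R \<in> S p \<Longrightarrow> \<phi> R \<ge> 0) \<Longrightarrow> mean p \<phi> \<ge> 0"
  unfolding mean_def by (intro divide_nonneg_nonneg sum_nonneg) auto

lemma mean_le: "p \<in> PP \<Longrightarrow> (\<And>R. R \<in> S p \<Longrightarrow> \<phi> R \<le> c) \<Longrightarrow> mean p \<phi> \<le> c"
  using mean_mono[of p \<phi> "\<lambda>_. c"] mean_const[of p c] by simp

lemma mean_translate:
  assumes "p \<in> PP" "R \<in> S p"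
  shows "mean p (\<lambda>Q. \<phi> (Q + R)) = mean p \<phi>"
proof -
  have "(\<Sum>Q\<in>S p. \<phi> (Q + R)) = (\<Sum>Q\<in>S p. \<phi> Q)"
    by (rule sum.reindex_bij_witness[of _ "\<lambda>X. X - R" "\<lambda>X. X + R"])
       (use assms S_add S_diff in auto)
  then show ?thesis unfolding mean_def by simp
qed

text \<open>After exchanging the averages, the inner one runs over a translate of \<open>S p\<close>
  by an element of \<open>S p\<close>. This lets a norm at \<open>p\<close> be computed on finer
  restrictions and averaged back.\<close>

lemma mean_tower:
  assumes p: "p \<in> PP" and p': "p' \<in> PP" and sub: "S p' \<subseteq> S p"
  shows "mean p (\<lambda>R. mean p' (\<lambda>R'. \<phi> (R + R'))) = mean p \<phi>"
proof -
  let ?c = "real (card (S p))" and ?c' = "real (card (S p'))"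
  have "mean p (\<lambda>R. mean p' (\<lambda>R'. \<phi> (R + R'))) = (\<Sum>R\<in>S p. \<Sum>R'\<in>S p'. \<phi> (R + R')) / ?c' / ?c"
    unfolding mean_def by (simp only: sum_divide_distrib)
  also have "\<dots> = (\<Sum>R'\<in>S p'. \<Sum>R\<in>S p. \<phi> (R + R')) / ?c / ?c'"
    by (subst sum.swap) (simp only: divide_divide_eq_left mult.commute)
  also have "\<dots> = mean p' (\<lambda>R'. mean p (\<lambda>R. \<phi> (R + R')))"
    unfolding mean_def by (simp only: sum_divide_distrib)
  also have "\<dots> = mean p' (\<lambda>_. mean p \<phi>)"
    by (rule mean_cong, rule mean_translate[OF p subsetD[OF sub]])
  finally show ?thesis by (simp add: mean_const p')
qed

lemma coset_sum_cong:
  assumes p: "p \<in> PP" and "X' - X \<in> N p"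
  shows "coset_sum a p X T = coset_sum a p X' T"
proof -
  have "Y - X \<in> N p \<longleftrightarrow> Y - X' \<in> N p" for Y
    using N_add_iff[OF p assms(2), of "Y - X'"] by simp
  then show ?thesis unfolding coset_sum_def by simp
qed

lemma coset_sum_translate:
  assumes p: "p \<in> PP" and T: "T \<in> GT" and R: "R \<in> S p" and X: "X \<in> GX"
  shows "coset_sum a p X (T + R) = coset_sum a p X T * e X R"
proof -
  have RG: "R \<in> GT" using R S_sub[OF p] by blast
  \<comment> \<open>That \<open>N p\<close> annihilates \<open>S p\<close> pointwise is extracted
    from the orthogonality of sums: numbers of modulus 1 that add up to their number are all
    1.\<close>
  have N1: "e Y R = 1" if "Y \<in> N p" for Y
  proof -
    have Y: "Y \<in> GX" using that N_sub[OF p] by blast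
    have "(\<Sum>Q\<in>S p. e Y Q) = of_nat (card (S p))"
      using orthogonality[OF p Y] that by simp
    then have s: "(\<Sum>Q\<in>S p. 1 - Re (e Y Q)) = 0"
      by (simp add: sum_subtractf Re_sum[symmetric])
    have "1 - Re (e Y Q) \<ge> 0" if "Q \<in> S p" for Q
      using complex_Re_le_cmod[of "e Y Q"] norm_e[OF Y, of Q] that S_sub[OF p] by auto
    then have "Re (e Y R) = 1"
      using s R by (subst (asm) sum_nonneg_eq_0_iff) (auto simp: finite_S[OF p])
    moreover have "(Re (e Y R))\<^sup>2 + (Im (e Y R))\<^sup>2 = 1"
      using norm_e[OF Y RG] by (simp flip: cmod_power2)
    ultimately show ?thesis by (simp add: complex_eq_iff)
  qed
  show ?thesis unfolding coset_sum_def sum_distrib_right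
  proof (intro sum.cong refl)
    fix Y assume Y: "Y \<in> GX"
    have "e Y R = e X R" if "Y - X \<in> N p"
      using e_add_left[of "Y - X" X R] N1[OF that] GX_diff Y X RG by simp
    then show "of_bool (Y - X \<in> N p) * (a Y * e Y (T + R)) =
         of_bool (Y - X \<in> N p) * (a Y * e Y T) * e X R"
      using e_add_right[OF Y T RG] by auto
  qed
qed

lemma NS_translate:
  assumes p: "p \<in> PP" and T: "T \<in> GT" and R: "R \<in> S p"
  shows "NS a p (T + R) = NS a p T"
proof -
  have "cmod (coset_sum a p X (T + R)) = cmod (coset_sum a p X T)" if "X \<in> GX" for X
    using norm_e[OF that, of R] R S_sub[OF p] coset_sum_translate[OF p T R that]
    by (auto simp: norm_mult)
  then show ?thesis unfolding NS_def by simp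
qed

lemma coset_sum_restrict:
  assumes p: "p \<in> PP" and X: "X \<in> GX"
    and inv: "\<And>X Y. \<lbrakk>X \<in> GX; Y \<in> GX; Y - X \<in> N p; C X\<rbrakk> \<Longrightarrow> C Y"
  shows "coset_sum (\<lambda>X. of_bool (C X) * a X) p X T = of_bool (C X) * coset_sum a p X T"
  unfolding coset_sum_def sum_distrib_left
proof (intro sum.cong refl)
  fix Y assume Y: "Y \<in> GX"
  have "C X \<longleftrightarrow> C Y" if "Y - X \<in> N p"
    using inv[OF X Y] inv[OF Y X] that N_commute[OF p] by blast
  then show "of_bool (Y - X \<in> N p) * (of_bool (C Y) * a Y * e Y T) =
    of_bool (C X) * (of_bool (Y - X \<in> N p) * (a Y * e Y T))" by auto
qed

definition convol :: "('x \<Rightarrow> complex) \<Rightarrow> ('x \<Rightarrow> complex) \<Rightarrow> 'x \<Rightarrow> complex" where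
  "convol a b Z = (\<Sum>X\<in>GX. a X * b (Z - X))"

lemma ev_convol:
  assumes T: "T \<in> GT"
  shows "ev (convol a b) T = ev a T * ev b T"
proof -
  have "ev a T * ev b T = (\<Sum>X\<in>GX. \<Sum>Y\<in>GX. a X * b Y * e (X + Y) T)"
    unfolding ev_def sum_product by (intro sum.cong refl) (simp add: e_add_left T)
  also have "\<dots> = (\<Sum>X\<in>GX. \<Sum>Z\<in>GX. a X * b (Z - X) * e Z T)"
  proof (rule sum.cong[OF refl])
    fix X assume X: "X \<in> GX"
    show "(\<Sum>Y\<in>GX. a X * b Y * e (X + Y) T) = (\<Sum>Z\<in>GX. a X * b (Z - X) * e Z T)"
      using sum_translate[OF X, of "\<lambda>Z. a X * b (Z - X) * e Z T"] by (simp add: add.commute)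
  qed
  also have "\<dots> = ev (convol a b) T"
    unfolding ev_def convol_def sum_distrib_right by (rule sum.swap)
  finally show ?thesis by simp
qed

end

section \<open>Cauchy-Schwarz for filtered convolutions, and the abstract fourth moment\<close>

lemma cmod_sum_mult_le:
  fixes f g :: "'i \<Rightarrow> complex"
  shows "(cmod (\<Sum>i\<in>I. f i * g i))\<^sup>2 \<le> (\<Sum>i\<in>I. (cmod (f i))\<^sup>2) * (\<Sum>i\<in>I. (cmod (g i))\<^sup>2)"
proof -
  have "cmod (\<Sum>i\<in>I. f i * g i) \<le> (\<Sum>i\<in>I. cmod (f i) * cmod (g i))"
    by (rule order_trans[OF norm_sum]) (simp add: norm_mult)
  then have "(cmod (\<Sum>i\<in>I. f i * g i))\<^sup>2 \<le> (\<Sum>i\<in>I. cmod (f i) * cmod (g i))\<^sup>2"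
    by (intro power_mono) auto
  also have "\<dots> \<le> (\<Sum>i\<in>I. (cmod (f i))\<^sup>2) * (\<Sum>i\<in>I. (cmod (g i))\<^sup>2)"
    by (rule Cauchy_Schwarz_ineq_sum)
  finally show ?thesis .
qed

text \<open>Cauchy-Schwarz against the indicator of \<open>Q\<close>, so that only terms that can be
  nonzero are counted.\<close>

lemma cmod_sum_le_card:
  fixes f :: "'i \<Rightarrow> complex"
  assumes "finite I" "\<And>i. i \<in> I \<Longrightarrow> f i \<noteq> 0 \<Longrightarrow> Q i"
  shows "(cmod (\<Sum>i\<in>I. f i))\<^sup>2 \<le> real (card {i\<in>I. Q i}) * (\<Sum>i\<in>I. (cmod (f i))\<^sup>2)"
proof -
  have "(\<Sum>i\<in>I. f i) = (\<Sum>i\<in>I. of_bool (Q i) * f i)"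
    using assms(2) by (intro sum.cong refl) auto
  then have "(cmod (\<Sum>i\<in>I. f i))\<^sup>2 \<le> (\<Sum>i\<in>I. (cmod (of_bool (Q i)))\<^sup>2) * (\<Sum>i\<in>I. (cmod (f i))\<^sup>2)"
    using cmod_sum_mult_le[where f="\<lambda>i. of_bool (Q i)"] by simp
  also have "(\<Sum>i\<in>I. (cmod (of_bool (Q i)))\<^sup>2) = real (card {i\<in>I. Q i})"
    using assms(1) by (simp add: of_bool_def if_distrib if_distribR sum.If_cases Int_def cong: if_cong)
  finally show ?thesis .
qed

context char_pairing
begin

text \<open>\<open>H\<close> is constant on cosets, and on the right each \<open>Y\<close> occurs
  once for every representative \<open>X\<close> of its coset.\<close>

lemma sum_coset_average:
  assumes p: "p \<in> PP"
    and inv: "\<And>X Y. \<lbrakk>X \<in> GX; Y \<in> GX; Y - X \<in> N p\<rbrakk> \<Longrightarrow> H X = H Y"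
  shows "(\<Sum>X\<in>GX. a X * e X T * H X) * of_nat (card (N p)) = (\<Sum>X\<in>GX. coset_sum a p X T * H X)"
proof -
  have "(\<Sum>X\<in>GX. coset_sum a p X T * H X) =
    (\<Sum>X\<in>GX. \<Sum>Y\<in>GX. of_bool (Y - X \<in> N p) * (a Y * e Y T * H Y))"
    unfolding coset_sum_def sum_distrib_right
    using inv by (intro sum.cong refl) auto
  also have "\<dots> = (\<Sum>Y\<in>GX. (\<Sum>X\<in>GX. of_bool (X - Y \<in> N p)) * (a Y * e Y T * H Y))"
    unfolding sum_distrib_right
    by (rule trans[OF sum.swap]) (simp add: N_commute[OF p])
  also have "\<dots> = (\<Sum>Y\<in>GX. of_nat (card (N p)) * (a Y * e Y T * H Y))"
    by (intro sum.cong refl) (simp only: card_coset[OF p])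
  finally show ?thesis by (simp add: sum_distrib_left mult_ac)
qed

lemma coset_sum_sum:
  "coset_sum (\<lambda>X. \<Sum>i\<in>I. c i * a i X) p X T = (\<Sum>i\<in>I. c i * coset_sum (a i) p X T)"
  unfolding coset_sum_def sum_distrib_left sum_distrib_right
  by (rule trans[OF sum.swap]) (simp add: mult_ac)

lemma coset_sum_eq_0:
  assumes "\<And>Y. \<lbrakk>Y \<in> GX; Y - X \<in> N p\<rbrakk> \<Longrightarrow> a Y = 0"
  shows "coset_sum a p X T = 0"
  unfolding coset_sum_def using assms by (intro sum.neutral) auto

text \<open>The filter looks at the first factor and the sum, not at the two factors: for a fixed
  second factor \<open>Z - X\<close> it is the number of admissible sums \<open>Z\<close> that will
  be small.\<close>

definition twisted :: "('x \<Rightarrow> 'x \<Rightarrow> bool) \<Rightarrow> ('x \<Rightarrow> complex) \<Rightarrow> ('x \<Rightarrow> complex) \<Rightarrow> 'x \<Rightarrow> complex" where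
  "twisted D a b Z = (\<Sum>X\<in>GX. of_bool (D X Z) * (a X * b (Z - X)))"

text \<open>\<open>D\<close> depends only on classes modulo \<open>N p\<close>, so the filtered
  convolution descends to the quotient. The factor \<open>card (N p)\<close> comes from writing a
  sum over classes as a sum over representatives.\<close>

lemma coset_sum_twisted:
  assumes p: "p \<in> PP" and T: "T \<in> GT" and Z: "Z \<in> GX"
    and inv: "\<And>X X' Z Z'. \<lbrakk>X \<in> GX; X' \<in> GX; Z \<in> GX; Z' \<in> GX; X' - X \<in> N p; Z' - Z \<in> N p; D X Z\<rbrakk> \<Longrightarrow> D X' Z'"
  shows "coset_sum (twisted D a b) p Z T * of_nat (card (N p))
    = (\<Sum>X\<in>GX. coset_sum a p X T * (of_bool (D X Z) * coset_sum b p (Z - X) T))"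
proof -
  have Dinv: "D X Z = D X' Z'" if "X \<in> GX" "X' \<in> GX" "Z \<in> GX" "Z' \<in> GX" "X' - X \<in> N p" "Z' - Z \<in> N p" for X X' Z Z'
    using inv[of X X' Z Z'] inv[of X' X Z' Z] that N_commute[OF p] by blast
  have "coset_sum (twisted D a b) p Z T =
    (\<Sum>X\<in>GX. \<Sum>Y\<in>GX. of_bool (Y - Z \<in> N p) * (of_bool (D X Y) * (a X * b (Y - X)) * e Y T))"
    unfolding coset_sum_def twisted_def sum_distrib_left sum_distrib_right
    by (rule sum.swap)
  also have "\<dots> = (\<Sum>X\<in>GX. a X * e X T * (of_bool (D X Z) * coset_sum b p (Z - X) T))"
  proof (rule sum.cong[OF refl])
    fix X assume X: "X \<in> GX"
    have "(\<Sum>Y\<in>GX. of_bool (Y - Z \<in> N p) * (of_bool (D X Y) * (a X * b (Y - X)) * e Y T))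
      = (\<Sum>Y\<in>GX. of_bool (Y + X - Z \<in> N p) * (of_bool (D X (Y + X)) * (a X * b (Y + X - X)) * e (Y + X) T))"
      by (rule sum_translate[OF X, symmetric])
    also have "\<dots> = (\<Sum>Y\<in>GX. a X * e X T * (of_bool (D X Z) * (of_bool (Y - (Z - X) \<in> N p) * (b Y * e Y T))))"
    proof (rule sum.cong[OF refl])
      fix Y assume Y: "Y \<in> GX"
      have "D X (Y + X) = D X Z" if "Y + X - Z \<in> N p"
        using Dinv[OF X X Z GX_add[OF Y X]] that N_0[OF p] by simp
      moreover have eq: "Y - (Z - X) = Y + X - Z" by (simp add: algebra_simps)
      ultimately show "of_bool (Y + X - Z \<in> N p) * (of_bool (D X (Y + X)) * (a X * b (Y + X - X)) * e (Y + X) T)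
        = a X * e X T * (of_bool (D X Z) * (of_bool (Y - (Z - X) \<in> N p) * (b Y * e Y T)))"
        unfolding eq e_add_left[OF Y X T] by (cases "Y + X - Z \<in> N p") auto
    qed
    also have "\<dots> = a X * e X T * (of_bool (D X Z) * coset_sum b p (Z - X) T)"
      by (simp only: coset_sum_def sum_distrib_left)
    finally show "(\<Sum>Y\<in>GX. of_bool (Y - Z \<in> N p) * (of_bool (D X Y) * (a X * b (Y - X)) * e Y T))
      = a X * e X T * (of_bool (D X Z) * coset_sum b p (Z - X) T)" .
  qed
  finally have 1: "coset_sum (twisted D a b) p Z T =
     (\<Sum>X\<in>GX. a X * e X T * (of_bool (D X Z) * coset_sum b p (Z - X) T))" .
  show ?thesis unfolding 1
  proof (rule sum_coset_average[OF p])
    fix X Y assume *: "X \<in> GX" "Y \<in> GX" "Y - X \<in> N p"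
    have "D X Z = D Y Z" using Dinv[OF *(1,2) Z Z *(3)] N_0[OF p] by simp
    moreover have "coset_sum b p (Z - X) T = coset_sum b p (Z - Y) T"
    proof (rule coset_sum_cong[OF p])
      have "Z - Y - (Z - X) = - (Y - X)" by simp
      then show "Z - Y - (Z - X) \<in> N p" using N_uminus[OF p *(3)] by metis
    qed
    ultimately show "of_bool (D X Z) * coset_sum b p (Z - X) T = of_bool (D Y Z) * coset_sum b p (Z - Y) T"
      by simp
  qed
qed

text \<open>For each \<open>Z\<close>, Cauchy-Schwarz in \<open>X\<close> leaves the whole filter
  with \<open>b\<close>. After summation over \<open>Z\<close>, each \<open>Y = Z - X\<close> is
  counted once for every admissible \<open>Z\<close>, that is, for at most \<open>J\<close> classes
  modulo \<open>N p\<close>.\<close>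

lemma NS_twisted_le:
  assumes p: "p \<in> PP" and T: "T \<in> GT"
    and inv: "\<And>X X' Z Z'. \<lbrakk>X \<in> GX; X' \<in> GX; Z \<in> GX; Z' \<in> GX; X' - X \<in> N p; Z' - Z \<in> N p; D X Z\<rbrakk> \<Longrightarrow> D X' Z'"
    and few: "\<And>Y. \<lbrakk>Y \<in> GX; coset_sum b p Y T \<noteq> 0\<rbrakk> \<Longrightarrow> real (card {Z\<in>GX. D (Z - Y) Z}) \<le> J * real (card (N p))"
  shows "NS (twisted D a b) p T \<le> J * NS a p T * NS b p T"
proof -
  let ?n = "real (card (N p))"
  have n: "?n > 0" using card_N_pos[OF p] by simp
  have 1: "(cmod (coset_sum (twisted D a b) p Z T))\<^sup>2 * ?n\<^sup>2 \<le>
    (\<Sum>X\<in>GX. (cmod (coset_sum a p X T))\<^sup>2) * (\<Sum>X\<in>GX. of_bool (D X Z) * (cmod (coset_sum b p (Z - X) T))\<^sup>2)"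
    if Z: "Z \<in> GX" for Z
  proof -
    have "(cmod (coset_sum (twisted D a b) p Z T))\<^sup>2 * ?n\<^sup>2 =
      (cmod (coset_sum (twisted D a b) p Z T * of_nat (card (N p))))\<^sup>2"
      by (simp add: norm_mult power_mult_distrib)
    also have "\<dots> \<le> (\<Sum>X\<in>GX. (cmod (coset_sum a p X T))\<^sup>2) *
       (\<Sum>X\<in>GX. (cmod (of_bool (D X Z) * coset_sum b p (Z - X) T))\<^sup>2)"
      using cmod_sum_mult_le by (subst coset_sum_twisted[OF p T Z]) (blast intro: inv)+
    also have "(\<Sum>X\<in>GX. (cmod (of_bool (D X Z) * coset_sum b p (Z - X) T))\<^sup>2) =
      (\<Sum>X\<in>GX. of_bool (D X Z) * (cmod (coset_sum b p (Z - X) T))\<^sup>2)"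
      by (intro sum.cong refl) auto
    finally show ?thesis .
  qed
  have 2: "(\<Sum>Z\<in>GX. \<Sum>X\<in>GX. of_bool (D X Z) * (cmod (coset_sum b p (Z - X) T))\<^sup>2)
    \<le> J * ?n * (\<Sum>Y\<in>GX. (cmod (coset_sum b p Y T))\<^sup>2)"
  proof -
    have "(\<Sum>Z\<in>GX. \<Sum>X\<in>GX. of_bool (D X Z) * (cmod (coset_sum b p (Z - X) T))\<^sup>2)
      = (\<Sum>Z\<in>GX. \<Sum>Y\<in>GX. of_bool (D (Z - Y) Z) * (cmod (coset_sum b p Y T))\<^sup>2)"
    proof (rule sum.cong[OF refl])
      fix Z assume Z: "Z \<in> GX"
      show "(\<Sum>X\<in>GX. of_bool (D X Z) * (cmod (coset_sum b p (Z - X) T))\<^sup>2)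
        = (\<Sum>Y\<in>GX. of_bool (D (Z - Y) Z) * (cmod (coset_sum b p Y T))\<^sup>2)"
        by (rule sum.reindex_bij_witness[of _ "\<lambda>X. Z - X" "\<lambda>X. Z - X"]) (use GX_diff Z in auto)
    qed
    also have "\<dots> = (\<Sum>Y\<in>GX. (\<Sum>Z\<in>GX. of_bool (D (Z - Y) Z)) * (cmod (coset_sum b p Y T))\<^sup>2)"
      unfolding sum_distrib_right by (rule sum.swap)
    also have "\<dots> = (\<Sum>Y\<in>GX. real (card {Z\<in>GX. D (Z - Y) Z}) * (cmod (coset_sum b p Y T))\<^sup>2)"
      by (simp add: finite_GX Int_def)
    also have "\<dots> \<le> (\<Sum>Y\<in>GX. J * ?n * (cmod (coset_sum b p Y T))\<^sup>2)"
    proof (rule sum_mono)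
      fix Y assume "Y \<in> GX"
      then show "real (card {Z\<in>GX. D (Z - Y) Z}) * (cmod (coset_sum b p Y T))\<^sup>2 \<le> J * ?n * (cmod (coset_sum b p Y T))\<^sup>2"
        using few[of Y] by (cases "coset_sum b p Y T = 0") (auto intro: mult_right_mono)
    qed
    finally show ?thesis by (simp add: sum_distrib_left)
  qed
  let ?A = "\<Sum>X\<in>GX. (cmod (coset_sum a p X T))\<^sup>2" and ?B = "\<Sum>Y\<in>GX. (cmod (coset_sum b p Y T))\<^sup>2"
  have "(\<Sum>Z\<in>GX. (cmod (coset_sum (twisted D a b) p Z T))\<^sup>2) * ?n\<^sup>2
     \<le> (\<Sum>Z\<in>GX. ?A * (\<Sum>X\<in>GX. of_bool (D X Z) * (cmod (coset_sum b p (Z - X) T))\<^sup>2))"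
    by (subst sum_distrib_right) (rule sum_mono, rule 1)
  also have "\<dots> \<le> ?A * (J * ?n * ?B)"
    unfolding sum_distrib_left[symmetric] by (intro mult_left_mono 2 sum_nonneg) auto
  finally have "(\<Sum>Z\<in>GX. (cmod (coset_sum (twisted D a b) p Z T))\<^sup>2) * ?n\<^sup>2 \<le> ?A * (J * ?n * ?B)" .
  then show ?thesis unfolding NS_def using n
    by (simp add: field_simps power2_eq_square)
qed

lemma NS_eq_0: "(\<And>X. X \<in> GX \<Longrightarrow> a X = 0) \<Longrightarrow> NS a p T = 0"
  unfolding NS_def coset_sum_def by simp

text \<open>The labels sort the pairs \<open>(X, X + Y)\<close>. The conditions \<open>C\<close> are
  invariant under \<open>N b\<close> only and have to stay at \<open>b\<close>: \<open>C l X\<close>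
  is absorbed into the coefficients \<open>aC l\<close>, and \<open>C l Z\<close> limits the labels
  that contribute to a sum \<open>Z\<close>. The condition \<open>D l\<close> is invariant under the
  larger \<open>N (P l)\<close>, so \<open>NS_twisted_le\<close> applies on the finer restriction
  \<open>P l\<close>.\<close>

lemma fourth_moment_le:
  fixes \<Lambda> :: "'l set" and \<mu> :: "'l \<Rightarrow> real" and C :: "'l \<Rightarrow> 'x \<Rightarrow> bool"
    and P :: "'l \<Rightarrow> 'p" and D :: "'l \<Rightarrow> 'x \<Rightarrow> 'x \<Rightarrow> bool"
  assumes b: "b \<in> PP" and T0: "T0 \<in> GT" and fin: "finite \<Lambda>"
    and P: "\<And>l. l \<in> \<Lambda> \<Longrightarrow> P l \<in> PP" and SP: "\<And>l. l \<in> \<Lambda> \<Longrightarrow> S (P l) \<subseteq> S b"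
    and C_inv: "\<And>l X Y. \<lbrakk>l \<in> \<Lambda>; X \<in> GX; Y \<in> GX; Y - X \<in> N b; C l X\<rbrakk> \<Longrightarrow> C l Y"
    and D_inv: "\<And>l X X' Z Z'. \<lbrakk>l \<in> \<Lambda>; X \<in> GX; X' \<in> GX; Z \<in> GX; Z' \<in> GX; X' - X \<in> N (P l);
        Z' - Z \<in> N (P l); D l X Z\<rbrakk> \<Longrightarrow> D l X' Z'"
    and supp: "\<And>X. X \<in> GX \<Longrightarrow> a X \<noteq> 0 \<Longrightarrow> X \<in> R" and RG: "R \<subseteq> GX"
    and identity: "\<And>X Y. \<lbrakk>X \<in> R; Y \<in> R\<rbrakk> \<Longrightarrow>
        (\<Sum>l\<in>\<Lambda>. of_bool (C l X \<and> C l (X + Y) \<and> D l X (X + Y)) * \<mu> l) = 1"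
    and \<mu>: "\<And>l. l \<in> \<Lambda> \<Longrightarrow> \<bar>\<mu> l\<bar> \<le> m0"
    and few_Z: "\<And>X Y. \<lbrakk>X \<in> R; Y \<in> R\<rbrakk> \<Longrightarrow> real (card {l\<in>\<Lambda>. C l (X + Y)}) \<le> L2"
    and few_X: "\<And>X. X \<in> R \<Longrightarrow> real (card {l\<in>\<Lambda>. C l X}) \<le> L1"
    and few_D: "\<And>l Y Y'. \<lbrakk>l \<in> \<Lambda>; Y \<in> GX; Y' \<in> R; Y' - Y \<in> N (P l)\<rbrakk> \<Longrightarrow>
        real (card {Z\<in>GX. D l (Z - Y) Z}) \<le> J * real (card (N (P l)))"
    and sup: "\<And>l X Q. \<lbrakk>l \<in> \<Lambda>; X \<in> R; C l X; Q \<in> S b\<rbrakk> \<Longrightarrow> NS a (P l) (T0 + Q) \<le> A"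
    and nn: "J \<ge> 0" "L2 \<ge> 0" "A \<ge> 0"
  shows "mean b (\<lambda>Q. (cmod (ev a (T0 + Q)))^4) \<le> L2 * m0\<^sup>2 * J * A * L1 * NS a b T0"
proof -
  define aC where "aC = (\<lambda>l X. of_bool (C l X) * a X)"
  define \<gamma> where "\<gamma> = (\<lambda>l. twisted (D l) (aC l) a)"
  have Sb: "T0 + Q \<in> GT" if "Q \<in> S b" for Q using that S_sub[OF b] GT_add T0 by blast
  have conv: "convol a a Z = (\<Sum>l\<in>\<Lambda>. (of_bool (C l Z) * of_real (\<mu> l)) * \<gamma> l Z)" if Z: "Z \<in> GX" for Z
  proof -
    have "(\<Sum>l\<in>\<Lambda>. (of_bool (C l Z) * of_real (\<mu> l)) * \<gamma> l Z) =
      (\<Sum>X\<in>GX. \<Sum>l\<in>\<Lambda>. (of_bool (C l Z) * of_real (\<mu> l)) * (of_bool (D l X Z) * (aC l X * a (Z - X))))"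
      unfolding \<gamma>_def twisted_def sum_distrib_left by (rule sum.swap)
    also have "\<dots> = (\<Sum>X\<in>GX. a X * a (Z - X))"
    proof (rule sum.cong[OF refl])
      fix X assume X: "X \<in> GX"
      show "(\<Sum>l\<in>\<Lambda>. (of_bool (C l Z) * of_real (\<mu> l)) * (of_bool (D l X Z) * (aC l X * a (Z - X)))) = a X * a (Z - X)"
      proof (cases "a X = 0 \<or> a (Z - X) = 0")
        case True
        then show ?thesis unfolding aC_def by auto
      next
        case False
        then have "X \<in> R" "Z - X \<in> R" using supp X GX_diff[OF Z X] by auto
        from identity[OF this]
        have "complex_of_real (\<Sum>l\<in>\<Lambda>. of_bool (C l X \<and> C l Z \<and> D l X Z) * \<mu> l) = 1" by simp
        moreover have "complex_of_real (of_bool Q * r) = of_bool Q * complex_of_real r" for Q r by simp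
        ultimately have "(\<Sum>l\<in>\<Lambda>. of_bool (C l X \<and> C l Z \<and> D l X Z) * complex_of_real (\<mu> l)) = 1"
          by (simp only: of_real_sum)
        then have "a X * a (Z - X) = (\<Sum>l\<in>\<Lambda>. of_bool (C l X \<and> C l Z \<and> D l X Z) * complex_of_real (\<mu> l)) * (a X * a (Z - X))"
          by simp
        also have "\<dots> = (\<Sum>l\<in>\<Lambda>. (of_bool (C l Z) * of_real (\<mu> l)) * (of_bool (D l X Z) * (aC l X * a (Z - X))))"
          unfolding aC_def sum_distrib_right by (intro sum.cong refl) auto
        finally show ?thesis by simp
      qed
    qed
    finally show ?thesis unfolding convol_def by simp
  qed
  have "mean b (\<lambda>Q. (cmod (ev a (T0 + Q)))^4) = mean b (\<lambda>Q. (cmod (ev (convol a a) (T0 + Q)))\<^sup>2)"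
    by (rule mean_cong) (simp add: ev_convol Sb norm_mult power4_eq_xxxx power2_eq_square mult.assoc)
  also have "\<dots> = NS (convol a a) b T0" by (rule NS_eq_mean[OF b T0, symmetric])
  also have "\<dots> \<le> (\<Sum>Z\<in>GX. L2 * m0\<^sup>2 * (\<Sum>l\<in>\<Lambda>. (cmod (coset_sum (\<gamma> l) b Z T0))\<^sup>2)) / real (card (N b))"
    unfolding NS_def
  proof (intro divide_right_mono sum_mono)
    fix Z assume Z: "Z \<in> GX"
    let ?c = "\<lambda>l. coset_sum (\<gamma> l) b Z T0"
    have "coset_sum (convol a a) b Z T0 =
      coset_sum (\<lambda>Z. \<Sum>l\<in>\<Lambda>. of_real (\<mu> l) * (of_bool (C l Z) * \<gamma> l Z)) b Z T0"
      unfolding coset_sum_def by (intro sum.cong refl) (simp add: conv mult_ac)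
    also have "\<dots> = (\<Sum>l\<in>\<Lambda>. of_real (\<mu> l) * (of_bool (C l Z) * ?c l))"
      unfolding coset_sum_sum using C_inv by (intro sum.cong refl) (simp add: coset_sum_restrict[OF b Z])
    finally have eq: "coset_sum (convol a a) b Z T0 = (\<Sum>l\<in>\<Lambda>. of_real (\<mu> l) * (of_bool (C l Z) * ?c l))" .
    show "(cmod (coset_sum (convol a a) b Z T0))\<^sup>2 \<le> L2 * m0\<^sup>2 * (\<Sum>l\<in>\<Lambda>. (cmod (?c l))\<^sup>2)"
    proof (cases "\<exists>X\<in>R. \<exists>Y\<in>R. X + Y - Z \<in> N b")
      case True
      then obtain X Y where XY: "X \<in> R" "Y \<in> R" "X + Y - Z \<in> N b" by blast
      then have G: "X + Y \<in> GX" using GX_add RG by blast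
      have "Z - (X + Y) \<in> N b" using N_commute[OF b] XY(3) by blast
      then have "C l Z = C l (X + Y)" if "l \<in> \<Lambda>" for l
        using C_inv[OF that Z G XY(3)] C_inv[OF that G Z] by blast
      then have cs: "{l\<in>\<Lambda>. C l Z} = {l\<in>\<Lambda>. C l (X + Y)}" by blast
      have "(cmod (coset_sum (convol a a) b Z T0))\<^sup>2 \<le>
         real (card {l\<in>\<Lambda>. C l Z}) * (\<Sum>l\<in>\<Lambda>. (cmod (of_real (\<mu> l) * (of_bool (C l Z) * ?c l)))\<^sup>2)"
        unfolding eq by (rule cmod_sum_le_card[OF fin]) auto
      also have "\<dots> \<le> L2 * (\<Sum>l\<in>\<Lambda>. m0\<^sup>2 * (cmod (?c l))\<^sup>2)"
      proof (intro mult_mono sum_mono)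
        show "real (card {l \<in> \<Lambda>. C l Z}) \<le> L2" unfolding cs by (rule few_Z[OF XY(1,2)])
        fix l assume l: "l \<in> \<Lambda>"
        have "\<bar>\<mu> l\<bar>\<^sup>2 \<le> m0\<^sup>2" using \<mu>[OF l] by (intro power_mono) auto
        then show "(cmod (of_real (\<mu> l) * (of_bool (C l Z) * ?c l)))\<^sup>2 \<le> m0\<^sup>2 * (cmod (?c l))\<^sup>2"
          by (auto simp: norm_mult power_mult_distrib intro!: mult_right_mono)
      qed (use nn in \<open>auto intro: sum_nonneg\<close>)
      finally show ?thesis by (simp add: sum_distrib_left mult_ac)
    next
      \<comment> \<open>\<open>few_Z\<close> only speaks of sums of two members of \<open>R\<close>.
        A class of \<open>Z\<close> without such a sum carries no coefficient of any
        \<open>\<gamma> l\<close>.\<close>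
      case False
      have "?c l = 0" for l
      proof (rule coset_sum_eq_0)
        fix Y assume Y: "Y \<in> GX" "Y - Z \<in> N b"
        have "aC l X * a (Y - X) = 0" if X: "X \<in> GX" for X
        proof (rule ccontr)
          assume "aC l X * a (Y - X) \<noteq> 0"
          then have "X \<in> R" "Y - X \<in> R" using supp X GX_diff[OF Y(1) X] by (auto simp: aC_def)
          then show False using False Y(2) by (metis add.commute diff_add_cancel)
        qed
        then show "\<gamma> l Y = 0" unfolding \<gamma>_def twisted_def by (intro sum.neutral) auto
      qed
      then show ?thesis unfolding eq by simp
    qed
  qed auto
  also have "\<dots> = L2 * m0\<^sup>2 * (\<Sum>l\<in>\<Lambda>. NS (\<gamma> l) b T0)"
    unfolding NS_def sum_divide_distrib[symmetric] sum_distrib_left[symmetric]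
    by (subst sum.swap) simp
  also have "\<dots> \<le> L2 * m0\<^sup>2 * (\<Sum>l\<in>\<Lambda>. J * A * NS (aC l) b T0)"
  proof (intro mult_left_mono sum_mono)
    fix l assume l: "l \<in> \<Lambda>"
    show "NS (\<gamma> l) b T0 \<le> J * A * NS (aC l) b T0"
    proof (cases "\<exists>X\<in>R. C l X")
      case False
      then have z: "aC l X = 0" if "X \<in> GX" for X using supp[OF that] by (auto simp: aC_def)
      then have "\<gamma> l X = 0" for X unfolding \<gamma>_def twisted_def by simp
      then show ?thesis using z by (simp add: NS_eq_0)
    next
      case True
      then obtain X where X: "X \<in> R" "C l X" by blast
      \<comment> \<open>The norm at \<open>b\<close> is the average of the norms at
        \<open>P l\<close> over translates. The bound for filtered convolutions is applied to each
        translate and then averaged back.\<close>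
      have tower: "NS c b T0 = mean b (\<lambda>Q. NS c (P l) (T0 + Q))" for c
      proof -
        have "NS c b T0 = mean b (\<lambda>Q. (cmod (ev c (T0 + Q)))\<^sup>2)" by (rule NS_eq_mean[OF b T0])
        also have "\<dots> = mean b (\<lambda>Q. mean (P l) (\<lambda>Q'. (cmod (ev c (T0 + (Q + Q'))))\<^sup>2))"
          by (rule mean_tower[OF b P[OF l] SP[OF l], symmetric])
        also have "\<dots> = mean b (\<lambda>Q. NS c (P l) (T0 + Q))"
          by (rule mean_cong) (simp add: NS_eq_mean[OF P[OF l] Sb] add.assoc)
        finally show ?thesis .
      qed
      have "NS (\<gamma> l) b T0 \<le> mean b (\<lambda>Q. J * A * NS (aC l) (P l) (T0 + Q))"
        unfolding tower
      proof (rule mean_mono)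
        fix Q assume Q: "Q \<in> S b"
        have "NS (\<gamma> l) (P l) (T0 + Q) \<le> J * NS (aC l) (P l) (T0 + Q) * NS a (P l) (T0 + Q)"
          unfolding \<gamma>_def
        proof (rule NS_twisted_le[OF P[OF l] Sb[OF Q]])
          fix Y assume Y: "Y \<in> GX" "coset_sum a (P l) Y (T0 + Q) \<noteq> 0"
          then obtain Y' where "Y' \<in> GX" "Y' - Y \<in> N (P l)" "a Y' \<noteq> 0"
            using coset_sum_eq_0 by blast
          then show "real (card {Z\<in>GX. D l (Z - Y) Z}) \<le> J * real (card (N (P l)))"
            using few_D[OF l Y(1)] supp by blast
        qed (use D_inv[OF l] in blast)
        also have "\<dots> \<le> J * NS (aC l) (P l) (T0 + Q) * A"
          using sup[OF l X Q] nn NS_nonneg by (intro mult_left_mono) auto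
        finally show "NS (\<gamma> l) (P l) (T0 + Q) \<le> J * A * NS (aC l) (P l) (T0 + Q)" by (simp add: mult_ac)
      qed
      then show ?thesis by (simp add: mean_cmult tower)
    qed
  qed (use nn in auto)
  also have "\<dots> = L2 * m0\<^sup>2 * J * A * (\<Sum>l\<in>\<Lambda>. NS (aC l) b T0)"
    by (simp add: sum_distrib_left mult_ac)
  also have "\<dots> \<le> L2 * m0\<^sup>2 * J * A * (L1 * NS a b T0)"
  proof (rule mult_left_mono)
    have "(\<Sum>l\<in>\<Lambda>. NS (aC l) b T0) = (\<Sum>l\<in>\<Lambda>. \<Sum>X\<in>GX. of_bool (C l X) * (cmod (coset_sum a b X T0))\<^sup>2) / real (card (N b))"
      unfolding NS_def sum_divide_distrib[symmetric]
    proof (intro arg_cong2[where f="(/)"] refl sum.cong)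
      fix l X assume "l \<in> \<Lambda>" "X \<in> GX"
      then show "(cmod (coset_sum (aC l) b X T0))\<^sup>2 = of_bool (C l X) * (cmod (coset_sum a b X T0))\<^sup>2"
        unfolding aC_def using C_inv by (subst coset_sum_restrict[OF b]) (auto simp: norm_mult)
    qed
    also have "\<dots> = (\<Sum>X\<in>GX. real (card {l\<in>\<Lambda>. C l X}) * (cmod (coset_sum a b X T0))\<^sup>2) / real (card (N b))"
      by (subst sum.swap) (simp add: fin Int_def flip: sum_distrib_right)
    also have "\<dots> \<le> (\<Sum>X\<in>GX. L1 * (cmod (coset_sum a b X T0))\<^sup>2) / real (card (N b))"
    proof (intro divide_right_mono sum_mono)
      fix X assume X: "X \<in> GX"
      show "real (card {l\<in>\<Lambda>. C l X}) * (cmod (coset_sum a b X T0))\<^sup>2 \<le> L1 * (cmod (coset_sum a b X T0))\<^sup>2"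
      proof (cases "coset_sum a b X T0 = 0")
        case False
        then obtain Y where Y: "Y \<in> GX" "Y - X \<in> N b" "a Y \<noteq> 0" using coset_sum_eq_0 by blast
        then have YX: "X - Y \<in> N b" using N_commute[OF b] by blast
        have "{l\<in>\<Lambda>. C l X} = {l\<in>\<Lambda>. C l Y}"
          using C_inv[OF _ X Y(1,2)] C_inv[OF _ Y(1) X YX] by blast
        then show ?thesis using few_X[OF supp[OF Y(1,3)]] by (simp add: mult_right_mono)
      qed simp
    qed auto
    finally show "(\<Sum>l\<in>\<Lambda>. NS (aC l) b T0) \<le> L1 * NS a b T0"
      by (simp add: NS_def sum_distrib_left)
  qed (use nn in auto)
  finally show ?thesis by (simp add: mult_ac)
qed

text \<open>A cut-off \<open>Q\<close> that is not invariant under \<open>N n\<close> cannot be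
  pulled out of the classes modulo \<open>N n\<close>. It is expanded into coefficients
  \<open>c p\<close>, each invariant under the smaller \<open>N p\<close>. Cauchy-Schwarz over
  \<open>I\<close> then costs \<open>card I\<close>, and a second one, over the classes modulo
  \<open>N p\<close> inside a class modulo \<open>N n\<close>, costs \<open>L\<close>.\<close>

lemma NS_restriction_le:
  fixes I :: "'p set" and c :: "'p \<Rightarrow> 'x \<Rightarrow> real"
  assumes n: "n \<in> PP" and T: "T \<in> GT" and fin: "finite I"
    and I: "\<And>p. p \<in> I \<Longrightarrow> p \<in> PP" and NI: "\<And>p. p \<in> I \<Longrightarrow> N p \<subseteq> N n"
    and c_inv: "\<And>p X Y. \<lbrakk>p \<in> I; X \<in> GX; Y \<in> GX; Y - X \<in> N p\<rbrakk> \<Longrightarrow> c p X = c p Y"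
    and identity: "\<And>X. X \<in> GX \<Longrightarrow> of_bool (Q X) = (\<Sum>p\<in>I. c p X)"
    and c_bound: "\<And>p X. \<lbrakk>p \<in> I; X \<in> GX\<rbrakk> \<Longrightarrow> \<bar>c p X\<bar> \<le> \<kappa>"
    and few: "\<And>p X0. \<lbrakk>p \<in> I; X0 \<in> GX\<rbrakk> \<Longrightarrow>
      real (card {X\<in>GX. X - X0 \<in> N n \<and> c p X \<noteq> 0}) \<le> L * real (card (N p))"
  shows "NS (\<lambda>X. of_bool (Q X) * a X) n T \<le> real (card I) * L * \<kappa>\<^sup>2 *
    (\<Sum>p\<in>I. (\<Sum>X\<in>GX. of_bool (c p X \<noteq> 0) * (cmod (coset_sum a p X T))\<^sup>2) / real (card (N p)))"
proof -
  let ?a = "\<lambda>X. of_bool (Q X) * a X"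
  let ?s = "\<lambda>p X. (cmod (coset_sum a p X T))\<^sup>2"
  let ?n = "\<lambda>p. real (card (N p))"
  let ?w = "\<lambda>p X0 X. of_bool (X - X0 \<in> N n) * (of_bool (c p X \<noteq> 0) * ?s p X)"
  have n0: "?n p > 0" if "p \<in> PP" for p using card_N_pos[OF that] by simp
  have 1: "(cmod (coset_sum ?a n X0 T))\<^sup>2 \<le> real (card I) * L * \<kappa>\<^sup>2 *
    (\<Sum>p\<in>I. (\<Sum>X\<in>GX. ?w p X0 X) / ?n p)"
    if X0: "X0 \<in> GX" for X0
  proof -
    \<comment> \<open>Divided by \<open>card (N p)\<close>, this is the sum of \<open>c p\<close>
      times the Fourier coefficient at \<open>p\<close> over the classes modulo \<open>N p\<close>
      contained in \<open>X0 + N n\<close>.\<close>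
    define f where "f = (\<lambda>p. (\<Sum>X\<in>GX. coset_sum a p X T * (of_bool (X - X0 \<in> N n) * of_real (c p X))))"
    have "coset_sum ?a n X0 T =
      (\<Sum>Y\<in>GX. \<Sum>p\<in>I. a Y * e Y T * (of_bool (Y - X0 \<in> N n) * of_real (c p Y)))"
      unfolding coset_sum_def
    proof (rule sum.cong[OF refl])
      fix Y assume Y: "Y \<in> GX"
      have "of_bool (Q Y) = complex_of_real (of_bool (Q Y))" by simp
      also have "\<dots> = (\<Sum>p\<in>I. complex_of_real (c p Y))"
        using identity[OF Y] by (simp only: of_real_sum)
      finally have "of_bool (Q Y) = (\<Sum>p\<in>I. complex_of_real (c p Y))" .
      then show "of_bool (Y - X0 \<in> N n) * (of_bool (Q Y) * a Y * e Y T) =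
         (\<Sum>p\<in>I. a Y * e Y T * (of_bool (Y - X0 \<in> N n) * of_real (c p Y)))"
        by (simp add: sum_distrib_left sum_distrib_right mult_ac)
    qed
    also have "\<dots> = (\<Sum>p\<in>I. \<Sum>Y\<in>GX. a Y * e Y T * (of_bool (Y - X0 \<in> N n) * of_real (c p Y)))"
      by (rule sum.swap)
    also have "\<dots> = (\<Sum>p\<in>I. f p / of_nat (card (N p)))"
    proof (rule sum.cong[OF refl])
      fix p assume p: "p \<in> I"
      have "(\<Sum>Y\<in>GX. a Y * e Y T * (of_bool (Y - X0 \<in> N n) * of_real (c p Y))) * of_nat (card (N p)) = f p"
        unfolding f_def
      proof (rule sum_coset_average[OF I[OF p]])
        fix X Y assume *: "X \<in> GX" "Y \<in> GX" "Y - X \<in> N p"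
        then have "Y - X \<in> N n" using NI[OF p] by blast
        then have "X - X0 \<in> N n \<longleftrightarrow> Y - X0 \<in> N n"
          using N_add_iff[OF n, of "Y - X" "X - X0"] by (simp add: algebra_simps)
        then show "of_bool (X - X0 \<in> N n) * complex_of_real (c p X) = of_bool (Y - X0 \<in> N n) * of_real (c p Y)"
          using c_inv[OF p *] by simp
      qed
      then show "(\<Sum>Y\<in>GX. a Y * e Y T * (of_bool (Y - X0 \<in> N n) * of_real (c p Y))) = f p / of_nat (card (N p))"
        using n0[OF I[OF p]] by (simp add: field_simps)
    qed
    finally have eq: "coset_sum ?a n X0 T = (\<Sum>p\<in>I. f p / of_nat (card (N p)))" .
    have "(cmod (coset_sum ?a n X0 T))\<^sup>2 \<le> real (card {p\<in>I. True}) * (\<Sum>p\<in>I. (cmod (f p / of_nat (card (N p))))\<^sup>2)"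
      unfolding eq by (rule cmod_sum_le_card[OF fin]) simp
    also have "\<dots> \<le> real (card I) * (\<Sum>p\<in>I. L * \<kappa>\<^sup>2 * ((\<Sum>X\<in>GX. ?w p X0 X) / ?n p))"
      unfolding simp_thms Collect_mem_eq
    proof (intro mult_left_mono sum_mono)
      fix p assume p: "p \<in> I"
      let ?g = "\<lambda>X. coset_sum a p X T * (of_bool (X - X0 \<in> N n) * of_real (c p X))"
      have "(cmod (f p))\<^sup>2 \<le> real (card {X\<in>GX. X - X0 \<in> N n \<and> c p X \<noteq> 0}) * (\<Sum>X\<in>GX. (cmod (?g X))\<^sup>2)"
        unfolding f_def by (rule cmod_sum_le_card[OF finite_GX]) auto
      also have "\<dots> \<le> (L * ?n p) * (\<Sum>X\<in>GX. \<kappa>\<^sup>2 * (?w p X0 X))"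
      proof (intro mult_mono sum_mono few[OF p X0])
        fix X assume X: "X \<in> GX"
        have "\<bar>c p X\<bar>\<^sup>2 \<le> \<kappa>\<^sup>2" using c_bound[OF p X] by (intro power_mono) auto
        then show "(cmod (?g X))\<^sup>2 \<le> \<kappa>\<^sup>2 * (?w p X0 X)"
          by (auto simp: norm_mult power_mult_distrib mult.commute intro!: mult_right_mono)
      qed (use few[OF p X0] in \<open>auto intro!: sum_nonneg intro: order_trans[OF of_nat_0_le_iff]\<close>)
      also have "\<dots> = L * \<kappa>\<^sup>2 * (\<Sum>X\<in>GX. ?w p X0 X) * ?n p"
        by (simp add: sum_distrib_left mult_ac)
      finally show "(cmod (f p / of_nat (card (N p))))\<^sup>2 \<le>
        L * \<kappa>\<^sup>2 * ((\<Sum>X\<in>GX. ?w p X0 X) / ?n p)"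
        using n0[OF I[OF p]] by (simp add: norm_divide power_divide field_simps power2_eq_square)
    qed simp
    finally show ?thesis by (simp add: sum_distrib_left mult_ac)
  qed
  have "NS ?a n T \<le> (\<Sum>X0\<in>GX. real (card I) * L * \<kappa>\<^sup>2 *
    (\<Sum>p\<in>I. (\<Sum>X\<in>GX. ?w p X0 X) / ?n p)) / ?n n"
    unfolding NS_def by (intro divide_right_mono sum_mono 1) auto
  also have "\<dots> = real (card I) * L * \<kappa>\<^sup>2 * (\<Sum>p\<in>I. \<Sum>X0\<in>GX.
      (\<Sum>X\<in>GX. ?w p X0 X) / ?n p) / ?n n"
    unfolding sum_distrib_left[symmetric] sum.swap[of _ I GX] ..
  also have "\<dots> = real (card I) * L * \<kappa>\<^sup>2 *
      (\<Sum>p\<in>I. ?n n * ((\<Sum>X\<in>GX. of_bool (c p X \<noteq> 0) * ?s p X) / ?n p)) / ?n n"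
  proof -
    have "(\<Sum>X0\<in>GX. (\<Sum>X\<in>GX. ?w p X0 X) / ?n p) =
      ?n n * ((\<Sum>X\<in>GX. of_bool (c p X \<noteq> 0) * ?s p X) / ?n p)" for p
    proof -
      have "(\<Sum>X0\<in>GX. \<Sum>X\<in>GX. ?w p X0 X)
        = (\<Sum>X\<in>GX. (\<Sum>X0\<in>GX. of_bool (X0 - X \<in> N n)) * (of_bool (c p X \<noteq> 0) * ?s p X))"
        unfolding sum_distrib_right
        by (rule trans[OF sum.swap], intro sum.cong refl) (subst N_commute[OF n], rule refl)
      also have "\<dots> = (\<Sum>X\<in>GX. ?n n * (of_bool (c p X \<noteq> 0) * ?s p X))"
        by (intro sum.cong refl) (simp only: card_coset[OF n])
      finally show ?thesis by (simp add: sum_distrib_left flip: sum_divide_distrib)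
    qed
    then show ?thesis by simp
  qed
  also have "\<dots> = real (card I) * L * \<kappa>\<^sup>2 * (\<Sum>p\<in>I. (\<Sum>X\<in>GX. of_bool (c p X \<noteq> 0) * ?s p X) / ?n p)"
    unfolding sum_distrib_left[symmetric] using n0[OF n] by simp
  finally show ?thesis .
qed

end

section \<open>Counting subspaces over a finite field\<close>

text \<open>All nonempty fibres of the map from \<open>A \<times> B\<close> sending
  \<open>(a, b)\<close> to \<open>\<phi> a + b\<close> have the size of the preimage of
  \<open>B\<close>. This is rank-nullity for the map induced modulo \<open>B\<close>, phrased by
  cardinalities so that no quotient types are formed.\<close>

lemma card_hom_fibers:
  fixes \<phi> :: "'a::ab_group_add \<Rightarrow> 'b::ab_group_add"
  assumes fin: "finite A" "finite B"
    and A: "\<And>x y. \<lbrakk>x \<in> A; y \<in> A\<rbrakk> \<Longrightarrow> x - y \<in> A" "\<And>x y. \<lbrakk>x \<in> A; y \<in> A\<rbrakk> \<Longrightarrow> x + y \<in> A"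
    and B: "\<And>x y. \<lbrakk>x \<in> B; y \<in> B\<rbrakk> \<Longrightarrow> x - y \<in> B" "\<And>x y. \<lbrakk>x \<in> B; y \<in> B\<rbrakk> \<Longrightarrow> x + y \<in> B"
    and \<phi>: "\<And>x y. \<lbrakk>x \<in> A; y \<in> A\<rbrakk> \<Longrightarrow> \<phi> (x + y) = \<phi> x + \<phi> y"
  shows "card A * card B = card {a\<in>A. \<phi> a \<in> B} * card {\<phi> a + b | a b. a \<in> A \<and> b \<in> B}"
proof -
  let ?g = "\<lambda>(a, b). \<phi> a + b"
  have img: "{\<phi> a + b | a b. a \<in> A \<and> b \<in> B} = ?g ` (A \<times> B)" by auto
  have dif: "\<phi> (x - y) = \<phi> x - \<phi> y" if "x \<in> A" "y \<in> A" for x y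
    using \<phi>[OF A(1)[OF that] that(2)] by (simp add: algebra_simps)
  have fib: "card {z\<in>A \<times> B. ?g z = y} = card {a\<in>A. \<phi> a \<in> B}" if y: "y \<in> ?g ` (A \<times> B)" for y
  proof -
    obtain a0 b0 where ab: "a0 \<in> A" "b0 \<in> B" "y = \<phi> a0 + b0" using y by auto
    have zB: "0 \<in> B" using B(1)[OF ab(2) ab(2)] by simp
    have "bij_betw (\<lambda>a. (a + a0, b0 - \<phi> a)) {a\<in>A. \<phi> a \<in> B} {z\<in>A \<times> B. ?g z = y}"
    proof (rule bij_betw_byWitness[where f'="\<lambda>z. fst z - a0"])
      show "\<forall>z\<in>{z\<in>A \<times> B. ?g z = y}. (fst z - a0 + a0, b0 - \<phi> (fst z - a0)) = z"
      proof (rule ballI)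
        fix z assume "z \<in> {z\<in>A \<times> B. ?g z = y}"
        then have z: "fst z \<in> A" "\<phi> (fst z) + snd z = y" by (auto split: prod.splits)
        have "b0 - (\<phi> (fst z) - \<phi> a0) = snd z" using z(2) ab(3) by (simp add: algebra_simps)
        then show "(fst z - a0 + a0, b0 - \<phi> (fst z - a0)) = z"
          using dif[OF z(1) ab(1)] by simp
      qed
      show "(\<lambda>a. (a + a0, b0 - \<phi> a)) ` {a \<in> A. \<phi> a \<in> B} \<subseteq> {z \<in> A \<times> B. ?g z = y}"
        using ab A B \<phi> by (auto simp: algebra_simps)
      show "(\<lambda>z. fst z - a0) ` {z \<in> A \<times> B. ?g z = y} \<subseteq> {a \<in> A. \<phi> a \<in> B}"
      proof
        fix x assume "x \<in> (\<lambda>z. fst z - a0) ` {z \<in> A \<times> B. ?g z = y}"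
        then obtain a b where x: "a \<in> A" "b \<in> B" "\<phi> a + b = \<phi> a0 + b0" "x = a - a0"
          using ab(3) by auto
        have "\<phi> a - \<phi> a0 = b0 - b" using x(3) by (simp add: algebra_simps)
        then have "\<phi> x = b0 - b" unfolding x(4) dif[OF x(1) ab(1)] .
        then show "x \<in> {a \<in> A. \<phi> a \<in> B}" using x A(1)[OF x(1) ab(1)] B(1)[OF ab(2) x(2)] by simp
      qed
    qed auto
    then show ?thesis by (rule bij_betw_same_card[symmetric])
  qed
  have "card A * card B = (\<Sum>z\<in>A \<times> B. 1)" by (simp add: card_cartesian_product)
  also have "\<dots> = (\<Sum>y\<in>?g ` (A \<times> B). \<Sum>z\<in>{z\<in>A \<times> B. ?g z = y}. 1)"
    using fin by (intro sum.image_gen) auto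
  also have "\<dots> = (\<Sum>y\<in>?g ` (A \<times> B). card {a\<in>A. \<phi> a \<in> B})"
    by (intro sum.cong refl) (simp only: card_eq_sum[symmetric] fib)
  finally show ?thesis unfolding img by simp
qed

locale fin_vs = finite_dimensional_vector_space scale Basis
  for scale :: "'k::{field,finite} \<Rightarrow> 'v::ab_group_add \<Rightarrow> 'v" and Basis
begin

lemma card_field_ge_2: "CARD('k) \<ge> 2"
proof -
  have "card {0, 1 :: 'k} \<le> CARD('k)" by (intro card_mono) auto
  then show ?thesis by simp
qed

lemma card_span_independent:
  assumes "finite B" "independent B"
  shows "finite (span B) \<and> card (span B) = CARD('k) ^ card B"
  using assms
proof (induction B)
  case empty
  show ?case by simp
next
  case (insert b B)
  then have IH: "finite (span B)" "card (span B) = CARD('k) ^ card B"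
    using independent_mono[of "insert b B" B] by auto
  have b: "b \<notin> span B" using insert by (simp add: independent_insert)
  have "bij_betw (\<lambda>(k, y). scale k b + y) (UNIV \<times> span B) (span (insert b B))"
  proof (rule bij_betw_imageI)
    show "inj_on (\<lambda>(k, y). scale k b + y) (UNIV \<times> span B)"
    proof (rule inj_onI, clarsimp)
      fix k y k' y' assume y: "y \<in> span B" "y' \<in> span B" and eq: "scale k b + y = scale k' b + y'"
      have "scale (k - k') b = y' - y" using eq by (simp add: algebra_simps)
      then have "scale (k - k') b \<in> span B" using y span_diff by metis
      then have "scale (inverse (k - k') * (k - k')) b \<in> span B"
        using span_scale[of "scale (k - k') b" B "inverse (k - k')"] by simp
      then have "k - k' = 0" using b by (metis left_inverse scale_one)
      then show "k = k' \<and> y = y'" using eq by simp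
    qed
    show "(\<lambda>(k, y). scale k b + y) ` (UNIV \<times> span B) = span (insert b B)"
    proof
      show "(\<lambda>(k, y). scale k b + y) ` (UNIV \<times> span B) \<subseteq> span (insert b B)"
      proof -
        have "span B \<subseteq> span (insert b B)" by (rule span_mono) auto
        moreover have "b \<in> span (insert b B)" by (simp add: span_base)
        ultimately show ?thesis by (auto intro!: span_add span_scale)
      qed
      show "span (insert b B) \<subseteq> (\<lambda>(k, y). scale k b + y) ` (UNIV \<times> span B)"
      proof
        fix x assume "x \<in> span (insert b B)"
        then obtain k where "x - scale k b \<in> span B" using span_breakdown_eq by blast
        then show "x \<in> (\<lambda>(k, y). scale k b + y) ` (UNIV \<times> span B)"
          by (intro image_eqI[of _ _ "(k, x - scale k b)"]) auto
      qed
    qed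
  qed
  note bij = this
  have "finite (span (insert b B))" using bij_betw_finite[OF bij] IH by simp
  moreover have "card (span (insert b B)) = CARD('k) * card (span B)"
    using bij_betw_same_card[OF bij] by (simp add: card_cartesian_product)
  ultimately show ?case using IH insert.hyps by simp
qed

lemma finite_UNIV_vs: "finite (UNIV :: 'v set)"
  using card_span_independent[OF finite_Basis independent_Basis] span_Basis by simp

lemma finite_vs [simp]: "finite (A :: 'v set)"
  by (rule finite_subset[OF subset_UNIV finite_UNIV_vs])

lemma card_subspace: "subspace U \<Longrightarrow> card U = CARD('k) ^ dim U"
  using basis_exists[of U] card_span_independent span_subspace
  by (metis finiteI_independent)

lemma subspace_sub_eq: "\<lbrakk>subspace U; subspace U'; U \<subseteq> U'; dim U' \<le> dim U\<rbrakk> \<Longrightarrow> U = U'"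
  using subspace_dim_equal by blast

lemma subspace_insert_span:
  assumes "subspace U"
  shows "span (insert v U) = {scale k v + u | k u. u \<in> U}"
proof -
  have "x - scale k v \<in> U \<longleftrightarrow> (\<exists>u\<in>U. x = scale k v + u)" for x k
    by (metis add_diff_cancel_left' add_diff_cancel_right' add.commute diff_add_cancel)
  then show ?thesis unfolding span_insert span_eq_iff[THEN iffD2, OF assms] by blast
qed

lemma dim_span_insert: "\<lbrakk>subspace U; v \<notin> U\<rbrakk> \<Longrightarrow> dim (span (insert v U)) = dim U + 1"
  by (simp add: dim_insert span_eq_iff[THEN iffD2])

lemma span_insert_le: "\<lbrakk>subspace I; U \<subseteq> I; v \<in> I\<rbrakk> \<Longrightarrow> span (insert v U) \<subseteq> I"
  by (simp add: span_minimal)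

lemma vector_space_over_itself: "vector_space ((*) :: 'k \<Rightarrow> 'k \<Rightarrow> 'k)"
  by standard (simp_all add: distrib_left distrib_right)

abbreviation functional :: "('v \<Rightarrow> 'k) \<Rightarrow> bool" where
  "functional \<equiv> Vector_Spaces.linear scale (*)"

lemma separating_functional:
  assumes U: "subspace U" and v: "v \<notin> U"
  obtains \<phi> where "functional \<phi>"
    "\<And>u. u \<in> U \<Longrightarrow> \<phi> u = 0" "\<phi> v = 1"
proof -
  obtain C where C: "C \<subseteq> U" "independent C" "U \<subseteq> span C" using basis_exists[of U] by metis
  then have sC: "span C = U" using span_subspace U by blast
  have iv: "independent (insert v C)" using C v sC by (simp add: independent_insertI)
  let ?B = "extend_basis (insert v C)"
  have B: "independent ?B" "span ?B = UNIV" "insert v C \<subseteq> ?B"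
    using independent_extend_basis[OF iv] span_extend_basis[OF iv] extend_basis_superset[OF iv] by auto
  let ?\<phi> = "\<lambda>x. representation ?B x v"
  have lin: "functional ?\<phi>" by (rule linear_representation) (use B in auto)
  have "?\<phi> u = 0" if "u \<in> U" for u
  proof -
    have "representation ?B u = representation C u"
      by (rule representation_extend) (use B sC that in auto)
    moreover have "v \<notin> C" using C(1) v by blast
    ultimately show ?thesis using representation_ne_zero[of C u v] by auto
  qed
  moreover have "?\<phi> v = 1" using representation_basis[OF B(1), of v] B(3) by auto
  ultimately show ?thesis using that[OF lin] by blast
qed

definition between :: "'v set \<Rightarrow> 'v set \<Rightarrow> 'v set set" where
  "between U M = {I. subspace I \<and> U \<subseteq> I \<and> I \<subseteq> M}"

lemma finite_between [simp]: "finite (between U M)"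
  by (rule finite_subset[of _ UNIV]) (auto simp: Finite_Set.finite_set)

lemma exists_between_pred:
  assumes "subspace U" "subspace I" "U \<subset> I"
  obtains I' where "subspace I'" "U \<subseteq> I'" "I' \<subseteq> I" "dim I = dim I' + 1"
proof -
  obtain B where B: "B \<subseteq> U" "independent B" "U \<subseteq> span B" "card B = dim U" using basis_exists[of U] by metis
  obtain C where C: "B \<subseteq> C" "C \<subseteq> I" "independent C" "I \<subseteq> span C"
    using maximal_independent_subset_extend[of B I] B assms by blast
  have sB: "span B = U" using B span_subspace assms by blast
  have sC: "span C = I" using C span_subspace assms by blast
  have "B \<noteq> C" using sB sC assms(3) by auto
  then obtain v where v: "v \<in> C" "v \<notin> B" using C(1) by blast
  have iC: "independent (C - {v})" using C(3) independent_mono by blast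
  show ?thesis
  proof (rule that)
    show "subspace (span (C - {v}))" by simp
    have "B \<subseteq> C - {v}" using C(1) v by blast
    then show "U \<subseteq> span (C - {v})" using sB span_mono by blast
    show "span (C - {v}) \<subseteq> I" using sC span_mono[of "C - {v}" C] by auto
    have "dim I = card C" using sC C(3) dim_span_eq_card_independent by blast
    moreover have "dim (span (C - {v})) = card (C - {v})" using iC dim_span_eq_card_independent by blast
    ultimately show "dim I = dim (span (C - {v})) + 1"
      using v C(3) finiteI_independent by (metis Suc_eq_plus1 card.remove)
  qed
qed

lemma exists_between_dim:
  assumes "subspace U" "subspace M" "U \<subseteq> M" "dim U \<le> k" "k \<le> dim M"
  shows "\<exists>I\<in>between U M. dim I = k"
proof -
  have "\<exists>I\<in>between U M. dim I = dim M - j" if "dim U \<le> dim M - j" "j \<le> dim M" for j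
    using that
  proof (induction j)
    case 0
    show ?case using assms by (intro bexI[of _ M]) (auto simp: between_def)
  next
    case (Suc j)
    have "dim U \<le> dim M - j" "j \<le> dim M" using Suc.prems by linarith+
    then obtain I where I: "subspace I" "U \<subseteq> I" "I \<subseteq> M" "dim I = dim M - j"
      using Suc.IH unfolding between_def by auto
    then have "U \<noteq> I" using Suc.prems by auto
    then obtain I' where I': "subspace I'" "U \<subseteq> I'" "I' \<subseteq> I" "dim I = dim I' + 1"
      using exists_between_pred[OF assms(1) I(1)] I(2) by (metis psubsetI)
    then have "dim I' = dim M - Suc j" using I(4) by linarith
    then show ?case using I I' by (intro bexI[of _ I']) (auto simp: between_def)
  qed
  from this[of "dim M - k"] show ?thesis using assms(4,5) by simp
qed

text \<open>\<open>C\<close> serves as a set of representatives of \<open>M\<close> modulo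
  \<open>U\<close>.\<close>

lemma complement_exists:
  assumes "subspace U" "subspace M" "U \<subseteq> M"
  obtains C where "subspace C" "C \<subseteq> M" "card C = CARD('k) ^ (dim M - dim U)" "\<And>x. x \<in> M \<Longrightarrow> \<exists>c\<in>C. \<exists>u\<in>U. x = c + u"
proof -
  obtain B where B: "B \<subseteq> U" "independent B" "U \<subseteq> span B" "card B = dim U" using basis_exists[of U] by metis
  obtain B' where C: "B \<subseteq> B'" "B' \<subseteq> M" "independent B'" "M \<subseteq> span B'"
    using maximal_independent_subset_extend[of B M] B assms by blast
  have sB: "span B = U" using B span_subspace assms by blast
  have sC: "span B' = M" using C span_subspace assms by blast
  have ind: "independent (B' - B)" using C(3) independent_mono by blast
  have dM: "dim M = card B'" using sC C(3) dim_span_eq_card_independent by blast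
  show ?thesis
  proof (rule that)
    show "subspace (span (B' - B))" by simp
    show "span (B' - B) \<subseteq> M" using sC span_mono[of "B' - B" B'] by auto
    show "card (span (B' - B)) = CARD('k) ^ (dim M - dim U)"
      using card_span_independent[OF _ ind] dM B(4) C(1) finiteI_independent[OF C(3)]
      by (simp add: card_Diff_subset finite_subset)
    fix x assume "x \<in> M"
    moreover have "B' = (B' - B) \<union> B" using C(1) by blast
    ultimately have "x \<in> span ((B' - B) \<union> B)" using sC by simp
    then show "\<exists>c\<in>span (B' - B). \<exists>u\<in>U. x = c + u"
      unfolding span_Un sB by auto
  qed
qed

lemma between_mono_dim: "\<lbrakk>I \<in> between U M\<rbrakk> \<Longrightarrow> dim U \<le> dim I \<and> dim I \<le> dim M"
  by (simp add: between_def dim_subset)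

text \<open>\<open>I\<close> arises from \<open>U\<close> by adjoining at most \<open>r\<close>
  vectors, each of which may be taken from a complement of \<open>U\<close> in \<open>M\<close>.
  Hence only the relative dimension of \<open>M\<close> enters.\<close>

lemma card_between_le:
  assumes U: "subspace U" and M: "subspace M" and "U \<subseteq> M"
  shows "card {I \<in> between U M. dim I \<le> dim U + r} \<le> CARD('k) ^ ((dim M - dim U) * r)"
proof (induction r)
  case 0
  have "{I \<in> between U M. dim I \<le> dim U + 0} \<subseteq> {U}"
    using subspace_sub_eq[OF U] by (auto simp: between_def)
  then have "card {I \<in> between U M. dim I \<le> dim U + 0} \<le> card {U}" by (intro card_mono) auto
  then show ?case by simp
next
  case (Suc r)
  let ?A = "\<lambda>r. {I \<in> between U M. dim I \<le> dim U + r}"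
  obtain C where C: "subspace C" "card C = CARD('k) ^ (dim M - dim U)"
    "\<And>x. x \<in> M \<Longrightarrow> \<exists>c\<in>C. \<exists>u\<in>U. x = c + u" using complement_exists[OF assms] by metis
  have "?A (Suc r) \<subseteq> (\<lambda>(I, c). span (insert c I)) ` (?A r \<times> C)"
  proof
    fix I assume "I \<in> ?A (Suc r)"
    then have I: "subspace I" "U \<subseteq> I" "I \<subseteq> M" "dim I \<le> dim U + Suc r" by (auto simp: between_def)
    show "I \<in> (\<lambda>(I, c). span (insert c I)) ` (?A r \<times> C)"
    proof (cases "dim I \<le> dim U + r")
      case True
      \<comment> \<open>Adjoining the zero vector covers the spaces that already belong to the
        smaller family.\<close>
      have "I = (\<lambda>(I, c). span (insert c I)) (I, 0)"
        using span_eq_iff[THEN iffD2, OF I(1), symmetric] by (simp only: prod.case span_insert_0)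
      moreover have "(I, 0) \<in> ?A r \<times> C" using I True subspace_0[OF C(1)] by (simp add: between_def)
      ultimately show ?thesis by (rule image_eqI)
    next
      case False
      then have "U \<noteq> I" using I(4) by auto
      then obtain I' where I': "subspace I'" "U \<subseteq> I'" "I' \<subseteq> I" "dim I = dim I' + 1"
        using exists_between_pred[OF U I(1)] I(2) by (metis psubsetI)
      then have "I' \<noteq> I" by auto
      then obtain v where v: "v \<in> I" "v \<notin> I'" using I'(3) by blast
      obtain c u where c: "c \<in> C" "u \<in> U" "v = c + u" using C(3)[of v] v I(3) by blast
      have cI: "c \<in> I" using c I v subspace_diff[OF I(1), of v u] by auto
      have cI': "c \<notin> I'" using c I' v(2) subspace_add[OF I'(1), of c u] by auto
      have "span (insert c I') = I"
        using subspace_sub_eq[OF _ I(1) span_insert_le[OF I(1) I'(3) cI]] dim_span_insert[OF I'(1) cI'] I'(4)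
        by simp
      then show ?thesis using I I' c(1)
        by (intro image_eqI[of _ _ "(I', c)"]) (auto simp: between_def)
    qed
  qed
  then have "card (?A (Suc r)) \<le> card ((\<lambda>(I, c). span (insert c I)) ` (?A r \<times> C))"
    by (intro card_mono) auto
  also have "\<dots> \<le> card (?A r \<times> C)" by (intro card_image_le) auto
  also have "\<dots> \<le> CARD('k) ^ ((dim M - dim U) * r) * CARD('k) ^ (dim M - dim U)"
    using Suc.IH C(2) by (simp add: card_cartesian_product)
  finally show ?case by (simp flip: power_add add: add.commute)
qed

lemma card_between:
  assumes U: "subspace U" and M: "subspace M" and "U \<subseteq> M"
  shows "card (between U M) \<le> CARD('k) ^ ((dim M - dim U) * (dim M - dim U))"
proof -
  have "between U M = {I \<in> between U M. dim I \<le> dim U + (dim M - dim U)}"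
    using between_mono_dim[of _ U M] dim_subset[OF assms(3)] by auto
  then show ?thesis using card_between_le[OF assms, of "dim M - dim U"] by simp
qed

lemma hyperplane_functional:
  assumes Q: "subspace Q" and M: "subspace M" and I: "I \<in> between Q M" and "dim M \<le> dim I + 1"
  obtains \<phi> where "functional \<phi>"
    "\<And>u. u \<in> Q \<Longrightarrow> \<phi> u = 0" "I = {w\<in>M. \<phi> w = 0}"
proof (cases "I = M")
  case True
  have "functional (\<lambda>_. 0)"
    unfolding Vector_Spaces.linear_iff using vector_space_axioms vector_space_over_itself by simp
  then show ?thesis using that[of "\<lambda>_. 0"] True by simp
next
  case False
  have I': "subspace I" "Q \<subseteq> I" "I \<subseteq> M" using I by (auto simp: between_def)
  then obtain v where v: "v \<in> M" "v \<notin> I" using False by blast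
  obtain \<phi> where \<phi>: "functional \<phi>" "\<And>u. u \<in> I \<Longrightarrow> \<phi> u = 0" "\<phi> v = 1"
    using separating_functional[OF I'(1) v(2)] by metis
  interpret \<phi>: Vector_Spaces.linear scale "(*)" \<phi> by fact
  have sp: "span (insert v I) = M"
    using subspace_sub_eq[OF _ M span_insert_le[OF M I'(3) v(1)]] dim_span_insert[OF I'(1) v(2)] assms(4) by simp
  have "w \<in> I" if w: "w \<in> M" "\<phi> w = 0" for w
  proof -
    obtain k u where ku: "w = scale k v + u" "u \<in> I" using w(1) sp subspace_insert_span[OF I'(1)] by blast
    then have "k = 0" using w(2) \<phi>(2)[OF ku(2)] \<phi>(3) by (simp add: \<phi>.add \<phi>.scale)
    then show ?thesis using ku by simp
  qed
  then have "I = {w\<in>M. \<phi> w = 0}" using I' \<phi>(2) by blast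
  then show ?thesis using that[OF \<phi>(1)] \<phi>(2) I'(2) by blast
qed

text \<open>The functional cutting out \<open>I\<close> vanishes on \<open>Q\<close>, so on
  \<open>M\<close> it is determined by its values on the \<open>dim M - dim Q\<close> vectors
  \<open>E\<close> that complete a basis of \<open>Q\<close> to one of \<open>M\<close>.\<close>

lemma card_hyperplanes_le:
  assumes Q: "subspace Q" and M: "subspace M" and QM: "Q \<subseteq> M"
  shows "card {I \<in> between Q M. dim M \<le> dim I + 1} \<le> CARD('k) ^ (dim M - dim Q)"
proof -
  let ?H = "{I \<in> between Q M. dim M \<le> dim I + 1}"
  obtain B where B: "B \<subseteq> Q" "independent B" "Q \<subseteq> span B" "card B = dim Q" using basis_exists[of Q] by metis
  obtain B' where C: "B \<subseteq> B'" "B' \<subseteq> M" "independent B'" "M \<subseteq> span B'"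
    using maximal_independent_subset_extend[of B M] B assms by blast
  have sB: "span B = Q" using B span_subspace assms by blast
  have sC: "span B' = M" using C span_subspace assms by blast
  have dM: "dim M = card B'" using sC C(3) dim_span_eq_card_independent by blast
  define E where "E = B' - B"
  have cE: "card E = dim M - dim Q" "finite E"
  proof -
    have f: "finite B'" using finiteI_independent[OF C(3)] .
    show "finite E" using f by (simp add: E_def)
    show "card E = dim M - dim Q"
      unfolding E_def dM using card_Diff_subset[OF finite_subset[OF C(1) f] C(1)] B(4) by simp
  qed
  have spQE: "M \<subseteq> span (Q \<union> E)" 
  proof -
    have "B' \<subseteq> Q \<union> E" using B(1) unfolding E_def by blast
    then show ?thesis using span_mono[of B' "Q \<union> E"] sC by simp
  qed
  define F where "F = (\<lambda>I. SOME \<phi>. functional \<phi> \<and>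
    (\<forall>u\<in>Q. \<phi> u = 0) \<and> I = {w\<in>M. \<phi> w = 0})"
  have F: "functional (F I) \<and> (\<forall>u\<in>Q. F I u = 0) \<and> I = {w\<in>M. F I w = 0}"
    if "I \<in> ?H" for I
  proof -
    have I: "I \<in> between Q M" "dim M \<le> dim I + 1" using that by simp_all
    obtain \<phi> where \<phi>: "functional \<phi>"
      "\<And>u. u \<in> Q \<Longrightarrow> \<phi> u = 0" "I = {w\<in>M. \<phi> w = 0}"
      by (rule hyperplane_functional[OF Q M I]) (rule that)
    have "\<exists>\<phi>. functional \<phi> \<and> (\<forall>u\<in>Q. \<phi> u = 0) \<and> I = {w\<in>M. \<phi> w = 0}"
      by (rule exI[of _ \<phi>], rule conjI[OF \<phi>(1) conjI[OF _ \<phi>(3)]], rule ballI, rule \<phi>(2))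
    from someI_ex[OF this] show ?thesis unfolding F_def .
  qed
  note F_lin = conjunct1[OF F] and F_0 = bspec[OF conjunct1[OF conjunct2[OF F]]]
    and F_ker = conjunct2[OF conjunct2[OF F]]
  have "inj_on (\<lambda>I. restrict (F I) E) ?H"
  proof (rule inj_onI)
    fix I J assume IJ: "I \<in> ?H" "J \<in> ?H" and eq: "restrict (F I) E = restrict (F J) E"
    interpret vp: vector_space_pair scale "(*) :: 'k \<Rightarrow> 'k \<Rightarrow> 'k"
      by (intro vector_space_pair.intro vector_space_axioms vector_space_over_itself)
    have QE: "F I w = F J w" if w: "w \<in> Q \<union> E" for w
    proof (cases "w \<in> Q")
      case True
      then show ?thesis using F_0[OF IJ(1) True] F_0[OF IJ(2) True] by simp
    next
      case False
      then show ?thesis using w fun_cong[OF eq, of w] by simp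
    qed
    have M: "F I w = F J w" if w: "w \<in> M" for w
      by (rule vp.linear_eq_on[OF F_lin[OF IJ(1)] F_lin[OF IJ(2)] subsetD[OF spQE w] QE])
    have "{w\<in>M. F I w = 0} = {w\<in>M. F J w = 0}" using M by (intro Collect_cong) auto
    then show "I = J" by (rule trans[OF F_ker[OF IJ(1)] trans[OF _ F_ker[OF IJ(2), symmetric]]])
  qed
  then have "card ?H \<le> card (E \<rightarrow>\<^sub>E (UNIV :: 'k set))"
    by (rule card_inj_on_le) (use cE in \<open>auto intro!: finite_PiE\<close>)
  also have "\<dots> = CARD('k) ^ (dim M - dim Q)" using cE by (simp add: card_PiE)
  finally show ?thesis .
qed

text \<open>The dual of \<open>card_between_le\<close>, proved without dual spaces: \<open>I\<close>
  is reached from \<open>M\<close> in \<open>r\<close> steps, each to a hyperplane or to the space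
  itself, and \<open>card_hyperplanes_le\<close> bounds the choices of a step.\<close>

lemma card_between_codim_le:
  assumes Q: "subspace Q" and M: "subspace M" and QM: "Q \<subseteq> M"
  shows "card {I \<in> between Q M. dim M \<le> dim I + r} \<le> CARD('k) ^ ((dim M - dim Q) * r)"
proof (induction r)
  case 0
  have "{I \<in> between Q M. dim M \<le> dim I + 0} \<subseteq> {M}"
    using subspace_sub_eq[OF _ M] by (auto simp: between_def)
  then have "card {I \<in> between Q M. dim M \<le> dim I + 0} \<le> card {M}" by (intro card_mono) auto
  then show ?case by simp
next
  case (Suc r)
  let ?A = "\<lambda>r. {I \<in> between Q M. dim M \<le> dim I + r}"
  let ?H = "\<lambda>M. {I \<in> between Q M. dim M \<le> dim I + 1}"
  have "?A (Suc r) \<subseteq> (\<Union>J\<in>?A r. ?H J)"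
  proof
    fix I assume "I \<in> ?A (Suc r)"
    then have I: "subspace I" "Q \<subseteq> I" "I \<subseteq> M" "dim M \<le> dim I + Suc r" by (auto simp: between_def)
    show "I \<in> (\<Union>J\<in>?A r. ?H J)"
    proof (cases "I = M")
      case True
      then show ?thesis using I M QM by (intro UN_I[of M]) (auto simp: between_def)
    next
      case False
      then obtain v where v: "v \<in> M" "v \<notin> I" using I(3) by blast
      then show ?thesis
        using I dim_span_insert[OF I(1) v(2)] span_insert_le[OF M I(3) v(1)] span_superset[of "insert v I"]
        by (intro UN_I[of "span (insert v I)"]) (auto simp: between_def)
    qed
  qed
  then have "card (?A (Suc r)) \<le> card (\<Union>J\<in>?A r. ?H J)" by (intro card_mono) auto
  also have "\<dots> \<le> (\<Sum>J\<in>?A r. card (?H J))" by (rule card_UN_le) simp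
  also have "\<dots> \<le> (\<Sum>J\<in>?A r. CARD('k) ^ (dim M - dim Q))"
  proof (rule sum_mono)
    fix J assume J: "J \<in> ?A r"
    then have "card (?H J) \<le> CARD('k) ^ (dim J - dim Q)"
      by (intro card_hyperplanes_le Q) (auto simp: between_def)
    also have "\<dots> \<le> CARD('k) ^ (dim M - dim Q)"
      using J between_mono_dim[of J Q M] card_field_ge_2 by (intro power_increasing) auto
    finally show "card (?H J) \<le> CARD('k) ^ (dim M - dim Q)" .
  qed
  also have "\<dots> \<le> CARD('k) ^ ((dim M - dim Q) * r) * CARD('k) ^ (dim M - dim Q)"
    using Suc.IH by simp
  finally show ?case by (simp flip: power_add add: add.commute)
qed

end

section \<open>Linear maps relative to a subspace pair\<close>

locale lin_pair = V: fin_vs sV BV + W: fin_vs sW BW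
  for sV :: "'k::{field,finite} \<Rightarrow> 'v::ab_group_add \<Rightarrow> 'v" and BV :: "'v set"
    and sW :: "'k \<Rightarrow> 'w::ab_group_add \<Rightarrow> 'w" and BW :: "'w set"
begin

text \<open>\<open>(U, K)\<close> names the restriction with \<open>V' = U\<close> and
  \<open>W' = K\<close>. On the Fourier side it turns a frequency \<open>X\<close>, a map from
  \<open>W\<close> to \<open>V\<close>, into the induced map from \<open>K\<close> to
  \<open>V\<close> modulo \<open>U\<close>.\<close>

definition pairs :: "('v set \<times> 'w set) set" where
  "pairs = {(U, K). V.subspace U \<and> W.subspace K}"

text \<open>Larger means a further restriction: more of \<open>V\<close> is killed and the image is
  confined to less of \<open>W\<close>.\<close>

definition ple :: "'v set \<times> 'w set \<Rightarrow> 'v set \<times> 'w set \<Rightarrow> bool" where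
  "ple b p \<longleftrightarrow> fst b \<subseteq> fst p \<and> snd p \<subseteq> snd b"

definition ord :: "'v set \<times> 'w set \<Rightarrow> nat" where
  "ord p = V.dim (fst p) + (W.dim UNIV - W.dim (snd p))"

definition LX :: "('w \<Rightarrow> 'v) set" where "LX = lin_maps sW sV"

definition NN :: "'v set \<times> 'w set \<Rightarrow> ('w \<Rightarrow> 'v) set" where
  "NN p = {X \<in> LX. \<forall>w\<in>snd p. X w \<in> fst p}"

text \<open>\<open>im\<close>, \<open>kr\<close> and \<open>rk\<close> are image, kernel and rank of
  the induced map from \<open>snd p\<close> to \<open>V\<close> modulo \<open>fst p\<close>, with
  the image pulled back to a subspace of \<open>V\<close> that contains
  \<open>fst p\<close>.\<close>

definition im :: "'v set \<times> 'w set \<Rightarrow> ('w \<Rightarrow> 'v) \<Rightarrow> 'v set" where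
  "im p X = {X w + u | w u. w \<in> snd p \<and> u \<in> fst p}"

definition kr :: "'v set \<times> 'w set \<Rightarrow> ('w \<Rightarrow> 'v) \<Rightarrow> 'w set" where
  "kr p X = {w \<in> snd p. X w \<in> fst p}"

definition rk :: "'v set \<times> 'w set \<Rightarrow> ('w \<Rightarrow> 'v) \<Rightarrow> nat" where
  "rk p X = W.dim (snd p) - W.dim (kr p X)"

lemma pairsD: "p \<in> pairs \<Longrightarrow> V.subspace (fst p)" "p \<in> pairs \<Longrightarrow> W.subspace (snd p)"
  by (auto simp: pairs_def)

lemma LX_iff: "X \<in> LX \<longleftrightarrow> (\<forall>x y. X (x + y) = X x + X y) \<and> (\<forall>c x. X (sW c x) = sV c (X x))"
  unfolding LX_def lin_maps_def mem_Collect_eq Vector_Spaces.linear_iff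
  using V.vector_space_axioms W.vector_space_axioms by blast

lemma LX_add: "X \<in> LX \<Longrightarrow> X (x + y) = X x + X y"
  and LX_scale: "X \<in> LX \<Longrightarrow> X (sW c x) = sV c (X x)"
  by (auto simp: LX_iff)

lemma LX_zero [simp]: "X \<in> LX \<Longrightarrow> X 0 = 0"
  using LX_scale[of X 0 0] by simp

lemma LX_minus: "X \<in> LX \<Longrightarrow> X (x - y) = X x - X y"
  using LX_add[of X "x - y" y] by (simp add: algebra_simps)

lemma zero_LX: "0 \<in> LX" by (simp add: LX_iff)

lemma diff_LX: "\<lbrakk>X \<in> LX; Y \<in> LX\<rbrakk> \<Longrightarrow> X - Y \<in> LX"
  by (simp add: LX_iff V.scale_right_diff_distrib fun_diff_def)

lemma add_LX: "\<lbrakk>X \<in> LX; Y \<in> LX\<rbrakk> \<Longrightarrow> X + Y \<in> LX"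
  by (simp add: LX_iff V.scale_right_distrib ac_simps)

lemma finite_LX: "finite (A :: ('w \<Rightarrow> 'v) set)"
proof -
  have "finite (Pi\<^sub>E (UNIV :: 'w set) (\<lambda>_. UNIV :: 'v set))"
    by (intro finite_PiE W.finite_UNIV_vs V.finite_UNIV_vs)
  then have "finite (UNIV :: ('w \<Rightarrow> 'v) set)" by (simp add: PiE_UNIV_domain)
  then show ?thesis using finite_subset subset_UNIV by metis
qed

lemma subspace_kr: "\<lbrakk>p \<in> pairs; X \<in> LX\<rbrakk> \<Longrightarrow> W.subspace (kr p X)"
  using pairsD[of p] unfolding kr_def W.subspace_def V.subspace_def
  by (auto simp: LX_add LX_scale)

lemma subspace_im: "\<lbrakk>p \<in> pairs; X \<in> LX\<rbrakk> \<Longrightarrow> V.subspace (im p X)"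
proof -
  assume p: "p \<in> pairs" and X: "X \<in> LX"
  note s = pairsD[OF p]
  show ?thesis unfolding V.subspace_def
  proof (intro conjI ballI allI)
    show "0 \<in> im p X" unfolding im_def using V.subspace_0[OF s(1)] W.subspace_0[OF s(2)] X by force
  next
    fix x y assume "x \<in> im p X" "y \<in> im p X"
    then obtain w u w' u' where *: "x = X w + u" "y = X w' + u'" "w \<in> snd p" "w' \<in> snd p" "u \<in> fst p" "u' \<in> fst p"
      unfolding im_def by blast
    then have "x + y = X (w + w') + (u + u')" by (simp add: LX_add X algebra_simps)
    then show "x + y \<in> im p X" unfolding im_def
      using * V.subspace_add[OF s(1)] W.subspace_add[OF s(2)] by blast
  next
    fix c x assume "x \<in> im p X"
    then obtain w u where *: "x = X w + u" "w \<in> snd p" "u \<in> fst p"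
      unfolding im_def by blast
    then have "sV c x = X (sW c w) + sV c u" by (simp add: LX_scale X V.scale_right_distrib)
    then show "sV c x \<in> im p X" unfolding im_def
      using * V.subspace_scale[OF s(1)] W.subspace_scale[OF s(2)] by blast
  qed
qed

lemma fst_sub_im: "\<lbrakk>p \<in> pairs; X \<in> LX\<rbrakk> \<Longrightarrow> fst p \<subseteq> im p X"
proof
  fix u assume "p \<in> pairs" "X \<in> LX" "u \<in> fst p"
  then have "u = X 0 + u" "0 \<in> snd p" using W.subspace_0[OF pairsD(2)] by auto
  then show "u \<in> im p X" unfolding im_def using \<open>u \<in> fst p\<close> by blast
qed

lemma im_I: "\<lbrakk>p \<in> pairs; w \<in> snd p\<rbrakk> \<Longrightarrow> X w \<in> im p X"
proof -
  assume "p \<in> pairs" "w \<in> snd p"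
  then have "X w = X w + 0" "0 \<in> fst p" using V.subspace_0[OF pairsD(1)] by auto
  then show ?thesis unfolding im_def using \<open>w \<in> snd p\<close> by blast
qed

lemma im_minimal: "\<lbrakk>V.subspace I; fst p \<subseteq> I; \<And>w. w \<in> snd p \<Longrightarrow> X w \<in> I\<rbrakk> \<Longrightarrow> im p X \<subseteq> I"
  unfolding im_def using V.subspace_add by blast

lemma kr_sub: "kr p X \<subseteq> snd p" by (auto simp: kr_def)

lemma power_cancel: "CARD('k) ^ a = CARD('k) ^ b \<longleftrightarrow> a = b"
  using V.card_field_ge_2 by (auto simp: power_inject_exp)

lemma rk_ker: "\<lbrakk>p \<in> pairs; X \<in> LX\<rbrakk> \<Longrightarrow> W.dim (snd p) = W.dim (kr p X) + rk p X"
  using W.dim_subset[OF kr_sub[of p X]] by (simp add: rk_def)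

lemma rk_im: assumes p: "p \<in> pairs" and X: "X \<in> LX"
  shows "V.dim (im p X) = V.dim (fst p) + rk p X"
proof -
  note s = pairsD[OF p]
  have "card (snd p) * card (fst p) = card {a\<in>snd p. X a \<in> fst p} * card {X a + b | a b. a \<in> snd p \<and> b \<in> fst p}"
    by (rule card_hom_fibers)
       (use s X W.subspace_diff W.subspace_add V.subspace_diff V.subspace_add LX_add in auto)
  then have "CARD('k) ^ (W.dim (snd p) + V.dim (fst p)) = CARD('k) ^ (W.dim (kr p X) + V.dim (im p X))"
    using V.card_subspace[OF s(1)] W.card_subspace[OF s(2)] V.card_subspace[OF subspace_im[OF p X]]
      W.card_subspace[OF subspace_kr[OF p X]]
    by (simp add: kr_def im_def power_add)
  then show ?thesis using rk_ker[OF p X] by (simp add: power_cancel)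
qed

lemma rk_cong: "\<lbrakk>p \<in> pairs; X \<in> LX; Y \<in> LX; Y - X \<in> NN p\<rbrakk> \<Longrightarrow> kr p X = kr p Y \<and> im p X = im p Y \<and> rk p X = rk p Y"
proof -
  assume a: "p \<in> pairs" "X \<in> LX" "Y \<in> LX" "Y - X \<in> NN p"
  note s = pairsD[OF a(1)]
  have d: "Y w - X w \<in> fst p" if "w \<in> snd p" for w using a(4) that by (auto simp: NN_def)
  then have "X w \<in> fst p \<longleftrightarrow> Y w \<in> fst p" if "w \<in> snd p" for w
    using that V.subspace_add[OF s(1), of "Y w - X w" "X w"] V.subspace_diff[OF s(1), of "Y w" "Y w - X w"] by auto
  then have k: "kr p X = kr p Y" by (auto simp: kr_def)
  have "im p Z \<subseteq> im p Z'" if "Z' \<in> LX" "\<And>w. w \<in> snd p \<Longrightarrow> Z w - Z' w \<in> fst p" for Z Z'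
  proof (rule im_minimal[OF subspace_im[OF a(1) that(1)] fst_sub_im[OF a(1) that(1)]])
    fix w assume w: "w \<in> snd p"
    have "Z' w + (Z w - Z' w) \<in> im p Z'" unfolding im_def using w that(2)[OF w] by blast
    then show "Z w \<in> im p Z'" by simp
  qed
  from this[of X Y] this[of Y X] have "im p X = im p Y"
    using a(2,3) d V.subspace_neg[OF s(1)] by (metis minus_diff_eq subset_antisym)
  then show ?thesis using k by (simp add: rk_def)
qed

lemma ple_refl [simp]: "ple p p" by (simp add: ple_def)
lemma ple_trans: "\<lbrakk>ple a b; ple b c\<rbrakk> \<Longrightarrow> ple a c" by (auto simp: ple_def)
lemma dimW_le: "W.dim A \<le> W.dim UNIV" by (rule W.dim_subset) simp

lemma ord_mono: "ple b p \<Longrightarrow> ord b \<le> ord p"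
  unfolding ord_def ple_def using V.dim_subset W.dim_subset by (intro add_mono diff_le_mono2) auto

lemma ord_diff: "ple b p \<Longrightarrow> ord p = ord b + (V.dim (fst p) - V.dim (fst b)) + (W.dim (snd b) - W.dim (snd p))"
  unfolding ord_def ple_def using V.dim_subset[of "fst b" "fst p"] W.dim_subset[of "snd p" "snd b"]
    dimW_le[of "snd b"] by simp

lemma ple_ord_eq:
  assumes "b \<in> pairs" "p \<in> pairs" "ple b p" "ord p \<le> ord b" shows "p = b"
proof -
  have "V.dim (fst p) - V.dim (fst b) = 0" "W.dim (snd b) - W.dim (snd p) = 0"
    using ord_diff[OF assms(3)] assms(4) by linarith+
  then have "fst b = fst p" "snd p = snd b"
    using V.subspace_sub_eq[of "fst b" "fst p"] W.subspace_sub_eq[of "snd p" "snd b"]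
      pairsD[OF assms(1)] pairsD[OF assms(2)] assms(3) by (auto simp: ple_def)
  then show ?thesis by (simp add: prod_eq_iff)
qed

text \<open>The intermediate pair \<open>(fst p, snd b)\<close> separates two effects. Enlarging the
  first component enlarges the kernel, shrinking the second shrinks the image, and each lowers the
  rank by at most the dimension by which that component changes.\<close>

lemma rk_antimono:
  assumes b: "b \<in> pairs" and p: "p \<in> pairs" and le: "ple b p" and X: "X \<in> LX"
  shows "rk p X \<le> rk b X" "rk b X + ord b \<le> rk p X + ord p"
proof -
  let ?m = "(fst p, snd b)"
  have m: "?m \<in> pairs" using pairsD[OF b] pairsD[OF p] by (auto simp: pairs_def)
  have "kr b X \<subseteq> kr ?m X" using le by (auto simp: kr_def ple_def)
  then have 1: "W.dim (kr b X) \<le> W.dim (kr ?m X)" by (rule W.dim_subset)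
  have "im p X \<subseteq> im ?m X" using le by (auto simp: im_def ple_def)
  then have 2: "V.dim (im p X) \<le> V.dim (im ?m X)" by (rule V.dim_subset)
  have "im b X \<subseteq> im ?m X" using le by (auto simp: im_def ple_def)
  then have 3: "V.dim (im b X) \<le> V.dim (im ?m X)" by (rule V.dim_subset)
  have "kr p X \<subseteq> kr ?m X" using le by (auto simp: kr_def ple_def)
  then have 4: "W.dim (kr p X) \<le> W.dim (kr ?m X)" by (rule W.dim_subset)
  note r = rk_ker[OF b X] rk_ker[OF p X] rk_ker[OF m X] rk_im[OF b X] rk_im[OF p X] rk_im[OF m X]
  show "rk p X \<le> rk b X" using 1 2 r by simp
  show "rk b X + ord b \<le> rk p X + ord p"
    using 3 4 r ord_diff[OF le] V.dim_subset[of "fst b" "fst p"] W.dim_subset[of "snd p" "snd b"] le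
    by (simp add: ple_def)
qed

lemma dim_Int_ge:
  assumes "W.subspace A" "W.subspace B" "W.subspace K" "A \<subseteq> K" "B \<subseteq> K"
  shows "W.dim A + W.dim B \<le> W.dim K + W.dim (A \<inter> B)"
proof -
  have "card A * card B = card {a\<in>A. a \<in> B} * card {a + b | a b. a \<in> A \<and> b \<in> B}"
    by (rule card_hom_fibers[where \<phi>="\<lambda>x. x"])
       (use assms W.subspace_diff W.subspace_add in auto)
  also have "{a\<in>A. a \<in> B} = A \<inter> B" by auto
  also have "card {a + b | a b. a \<in> A \<and> b \<in> B} \<le> card K"
    using assms W.subspace_add[OF assms(3)] by (intro card_mono) auto
  finally have "CARD('k) ^ (W.dim A + W.dim B) \<le> CARD('k) ^ (W.dim (A \<inter> B) + W.dim K)"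
    using W.card_subspace assms W.subspace_inter[of A B] by (simp add: power_add)
  then show ?thesis using W.card_field_ge_2 by (simp add: add.commute)
qed

lemma rk_add:
  assumes p: "p \<in> pairs" and X: "X \<in> LX" and Y: "Y \<in> LX"
  shows "rk p (X + Y) \<le> rk p X + rk p Y"
proof -
  have "kr p X \<inter> kr p Y \<subseteq> kr p (X + Y)" using V.subspace_add[OF pairsD(1)[OF p]] by (auto simp: kr_def)
  then have "W.dim (kr p X \<inter> kr p Y) \<le> W.dim (kr p (X + Y))" by (rule W.dim_subset)
  then show ?thesis
    using dim_Int_ge[OF subspace_kr[OF p X] subspace_kr[OF p Y] pairsD(2)[OF p] kr_sub kr_sub]
      rk_ker[OF p X] rk_ker[OF p Y] rk_ker[OF p add_LX[OF X Y]] by simp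
qed

text \<open>Up to \<open>NN (U, K)\<close>, such a \<open>Y\<close> is a map from \<open>K\<close>
  modulo \<open>Q\<close> to \<open>I\<close> modulo \<open>U\<close>. \<open>Q\<close> is enlarged
  by one vector \<open>v\<close> at a time, and the value at \<open>v\<close> costs at most the
  index of \<open>U\<close> in \<open>I\<close>.\<close>

lemma card_maps_le:
  assumes U: "V.subspace U" and I: "V.subspace I" and UI: "U \<subseteq> I"
    and Q: "W.subspace Q" and K: "W.subspace K" and QK: "Q \<subseteq> K"
  shows "card {Y\<in>LX. (\<forall>w\<in>Q. Y w \<in> U) \<and> (\<forall>w\<in>K. Y w \<in> I)}
    \<le> card (NN (U, K)) * CARD('k) ^ ((V.dim I - V.dim U) * (W.dim K - W.dim Q))"
  using Q QK
proof (induction "W.dim K - W.dim Q" arbitrary: Q)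
  case 0
  then have "Q = K" using W.subspace_sub_eq[of Q K] K by simp
  moreover have "{Y\<in>LX. (\<forall>w\<in>K. Y w \<in> U) \<and> (\<forall>w\<in>K. Y w \<in> I)} \<subseteq> NN (U, K)" by (auto simp: NN_def)
  then have "card {Y\<in>LX. (\<forall>w\<in>K. Y w \<in> U) \<and> (\<forall>w\<in>K. Y w \<in> I)} \<le> card (NN (U, K))"
    by (intro card_mono finite_LX)
  ultimately show ?case by simp
next
  case (Suc n)
  then have "Q \<noteq> K" by auto
  then obtain v where v: "v \<in> K" "v \<notin> Q" using Suc.prems by blast
  define Q' where "Q' = W.span (insert v Q)"
  have Q': "W.subspace Q'" "Q' \<subseteq> K" "W.dim Q' = W.dim Q + 1"
    using W.span_insert_le[OF K Suc.prems(2) v(1)] W.dim_span_insert[OF Suc.prems(1) v(2)] by (auto simp: Q'_def)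
  let ?H = "\<lambda>Q. {Y\<in>LX. (\<forall>w\<in>Q. Y w \<in> U) \<and> (\<forall>w\<in>K. Y w \<in> I)}"
  have H': "{Y \<in> ?H Q. Y v \<in> U} \<subseteq> ?H Q'"
  proof
    fix Y assume Y: "Y \<in> {Y \<in> ?H Q. Y v \<in> U}"
    then have YL: "Y \<in> LX" by simp
    have "Y w \<in> U" if w: "w \<in> Q'" for w
    proof -
      obtain k u where ku: "w = sW k v + u" "u \<in> Q"
        using w W.subspace_insert_span[OF Suc.prems(1)] unfolding Q'_def by blast
      then show ?thesis using Y V.subspace_add[OF U] V.subspace_scale[OF U]
        by (simp add: LX_add[OF YL] LX_scale[OF YL])
    qed
    then show "Y \<in> ?H Q'" using Y by simp
  qed
  have "card (?H Q) * card U = card {Y\<in>?H Q. Y v \<in> U} * card {Y v + u | Y u. Y \<in> ?H Q \<and> u \<in> U}"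
    by (rule card_hom_fibers[where \<phi>="\<lambda>Y. Y v"])
       (use U I V.subspace_diff V.subspace_add diff_LX add_LX in \<open>auto simp: finite_LX\<close>)
  also have "\<dots> \<le> card (?H Q') * card I"
    using H' v(1) UI V.subspace_add[OF I] by (intro mult_mono card_mono finite_LX) auto
  also have "card (?H Q') \<le> card (NN (U, K)) * CARD('k) ^ ((V.dim I - V.dim U) * (W.dim K - W.dim Q'))"
    using Suc.hyps(2) Q' by (intro Suc.hyps(1)) auto
  finally have *: "card (?H Q) * card U \<le> card (NN (U, K)) * CARD('k) ^ ((V.dim I - V.dim U) * (W.dim K - W.dim Q')) * card I"
    by simp
  have cI: "card I = CARD('k) ^ (V.dim I - V.dim U) * card U"
    using V.card_subspace[OF I] V.card_subspace[OF U] V.dim_subset[OF UI] by (simp flip: power_add)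
  have "W.dim K - W.dim Q = Suc (W.dim K - W.dim Q')" using Suc.hyps(2) Q' by simp
  moreover have "card U > 0" using V.card_subspace[OF U] by simp
  ultimately show ?case using * unfolding cI by (simp add: power_add mult_ac)
qed

text \<open>The image is chosen first and the map into it second. The rank bound thus replaces the
  product of the two relative dimensions in the exponent by \<open>r\<close> times their
  sum.\<close>

lemma card_low_rank_le:
  assumes U: "V.subspace U" and M: "V.subspace M" and UM: "U \<subseteq> M"
    and Q: "W.subspace Q" and K: "W.subspace K" and QK: "Q \<subseteq> K"
  shows "card {Y\<in>LX. (\<forall>w\<in>Q. Y w \<in> U) \<and> (\<forall>w\<in>K. Y w \<in> M) \<and> rk (U, K) Y \<le> r}
    \<le> card (NN (U, K)) * CARD('k) ^ (r * ((V.dim M - V.dim U) + (W.dim K - W.dim Q)))"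
proof -
  let ?J = "{I \<in> V.between U M. V.dim I \<le> V.dim U + r}"
  let ?H = "\<lambda>I. {Y\<in>LX. (\<forall>w\<in>Q. Y w \<in> U) \<and> (\<forall>w\<in>K. Y w \<in> I)}"
  have p: "(U, K) \<in> pairs" using U K by (simp add: pairs_def)
  have "{Y\<in>LX. (\<forall>w\<in>Q. Y w \<in> U) \<and> (\<forall>w\<in>K. Y w \<in> M) \<and> rk (U, K) Y \<le> r} \<subseteq> (\<Union>I\<in>?J. ?H I)"
  proof
    fix Y assume Y: "Y \<in> {Y\<in>LX. (\<forall>w\<in>Q. Y w \<in> U) \<and> (\<forall>w\<in>K. Y w \<in> M) \<and> rk (U, K) Y \<le> r}"
    then have YL: "Y \<in> LX" by simp
    have "im (U, K) Y \<subseteq> M" using Y UM by (intro im_minimal M) auto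
    then have "im (U, K) Y \<in> ?J"
      using rk_im[OF p YL] fst_sub_im[OF p YL] subspace_im[OF p YL] Y by (simp add: V.between_def)
    moreover have "Y \<in> ?H (im (U, K) Y)" using Y im_I[OF p] by auto
    ultimately show "Y \<in> (\<Union>I\<in>?J. ?H I)" by blast
  qed
  then have "card {Y\<in>LX. (\<forall>w\<in>Q. Y w \<in> U) \<and> (\<forall>w\<in>K. Y w \<in> M) \<and> rk (U, K) Y \<le> r} \<le> card (\<Union>I\<in>?J. ?H I)"
    by (intro card_mono finite_LX)
  also have "\<dots> \<le> (\<Sum>I\<in>?J. card (?H I))" by (rule card_UN_le) simp
  also have "\<dots> \<le> (\<Sum>I\<in>?J. card (NN (U, K)) * CARD('k) ^ (r * (W.dim K - W.dim Q)))"
  proof (rule sum_mono)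
    fix I assume I: "I \<in> ?J"
    then have "card (?H I) \<le> card (NN (U, K)) * CARD('k) ^ ((V.dim I - V.dim U) * (W.dim K - W.dim Q))"
      by (intro card_maps_le U Q K QK) (auto simp: V.between_def)
    also have "\<dots> \<le> card (NN (U, K)) * CARD('k) ^ (r * (W.dim K - W.dim Q))"
      using I V.card_field_ge_2 by (intro mult_left_mono power_increasing mult_right_mono) auto
    finally show "card (?H I) \<le> card (NN (U, K)) * CARD('k) ^ (r * (W.dim K - W.dim Q))" .
  qed
  also have "\<dots> = card ?J * (card (NN (U, K)) * CARD('k) ^ (r * (W.dim K - W.dim Q)))" by simp
  also have "\<dots> \<le> CARD('k) ^ ((V.dim M - V.dim U) * r) * (card (NN (U, K)) * CARD('k) ^ (r * (W.dim K - W.dim Q)))"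
    by (intro mult_right_mono V.card_between_le U M UM) simp
  finally show ?thesis by (simp add: power_add distrib_left mult_ac)
qed

end

section \<open>Traces and additive characters\<close>

text \<open>Multiplication by \<open>x\<close> permutes the nonzero elements, hence preserves their
  product.\<close>

lemma field_power_card: "(x :: 'k::{field,finite}) ^ CARD('k) = x"
proof (cases "x = 0")
  case False
  define U where "U = UNIV - {0 :: 'k}"
  have fin: "finite U" by (simp add: U_def)
  have "(\<Prod>y\<in>U. x * y) = (\<Prod>y\<in>U. y)"
    by (rule prod.reindex_bij_witness[of _ "\<lambda>y. y / x" "\<lambda>y. x * y"]) (use False in \<open>auto simp: U_def\<close>)
  then have "x ^ card U * (\<Prod>y\<in>U. y) = 1 * (\<Prod>y\<in>U. y)" by (simp only: prod.distrib prod_constant mult_1_left)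
  moreover have "(\<Prod>y\<in>U. y) \<noteq> 0" using prod_zero_iff[OF fin, of "\<lambda>y. y"] by (auto simp: U_def)
  ultimately have "x ^ card U = 1" by (metis mult_right_cancel)
  moreover have "CARD('k) = Suc (card U)" unfolding U_def by (rule card.remove) auto
  ultimately show ?thesis by simp
qed simp

context
  fixes p m :: nat
  assumes p: "prime p" and card: "CARD('k::{field,finite}) = p ^ m"
begin

lemma CHAR_eq_prime: "CHAR('k) = p"
proof -
  have "prime CHAR('k)"
    using prime_CHAR_semidom[where 'a='k] finite_imp_CHAR_pos[where 'a='k] by simp
  moreover have "CHAR('k) dvd p ^ m"
  proof -
    have "(\<Sum>x\<in>(UNIV :: 'k set). x + 1) = (\<Sum>x\<in>UNIV. x)"
      by (rule sum.reindex_bij_witness[of _ "\<lambda>x. x - 1" "\<lambda>x. x + 1"]) auto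
    then have "of_nat CARD('k) = (0 :: 'k)" by (simp add: sum.distrib)
    then show ?thesis using card of_nat_eq_0_iff_char_dvd[where 'a='k] by metis
  qed
  ultimately show ?thesis using p prime_dvd_power primes_dvd_imp_eq by blast
qed

definition field_tr :: "'k \<Rightarrow> 'k" where "field_tr x = (\<Sum>i<m. x ^ p ^ i)"

lemma frobenius_add: "(x + y :: 'k) ^ p ^ i = x ^ p ^ i + y ^ p ^ i"
  by (rule freshmans_dream') (use p CHAR_eq_prime in auto)

lemma field_tr_add: "field_tr (x + y) = field_tr x + field_tr y"
  by (simp add: field_tr_def frobenius_add sum.distrib)

text \<open>Frobenius permutes the conjugates of \<open>x\<close> cyclically. With
  \<open>prime_field\<close> this places the trace in the prime field, where \<open>char_phi\<close>
  reads it as a natural number.\<close>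

lemma field_tr_power: "field_tr x ^ p = field_tr x"
proof -
  have "field_tr x ^ p = (\<Sum>i<m. (x ^ p ^ i) ^ p)"
    unfolding field_tr_def by (rule freshmans_dream_sum) (use p CHAR_eq_prime in auto)
  also have "\<dots> = (\<Sum>i<m. x ^ p ^ Suc i)" by (simp add: power_mult[symmetric] mult.commute)
  also have "\<dots> = (\<Sum>i<Suc m. x ^ p ^ i) - x" by (subst sum.lessThan_Suc_shift) simp
  also have "\<dots> = field_tr x" using field_power_card[of x] card by (simp add: field_tr_def)
  finally show ?thesis .
qed

text \<open>The images of the numbers below \<open>p\<close> are \<open>p\<close> distinct roots of
  the polynomial \<open>x ^ p - x\<close>, which leaves no further ones.\<close>

lemma prime_field: assumes "y ^ p = (y :: 'k)" shows "\<exists>n. of_nat n = y"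
proof -
  let ?P = "monom 1 p - monom 1 1 :: 'k poly"
  have p1: "p > 1" using p prime_gt_1_nat by blast
  have "coeff ?P p = 1" using p1 by simp
  then have nz: "?P \<noteq> 0" by (metis coeff_0 zero_neq_one)
  have "degree ?P \<le> p" using p1 by (intro degree_diff_le) (auto simp: degree_monom_eq)
  then have roots: "finite {x. poly ?P x = 0}" "card {x. poly ?P x = 0} \<le> p"
    using card_poly_roots_bound[OF nz] poly_roots_finite[OF nz] by auto
  have nat: "(of_nat n :: 'k) ^ p = of_nat n" for n
  proof (induction n)
    case (Suc n)
    then show ?case using frobenius_add[of 1 "of_nat n" 1] by simp
  qed (use p1 in simp)
  have "inj_on (of_nat :: nat \<Rightarrow> 'k) {..<p}"
    by (rule inj_onI) (auto simp: of_nat_eq_iff_cong_CHAR CHAR_eq_prime cong_def)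
  then have "card (of_nat ` {..<p} :: 'k set) = p" by (simp add: card_image)
  moreover have "of_nat ` {..<p} \<subseteq> {x. poly ?P x = 0}" using nat by (auto simp: poly_monom)
  ultimately have "of_nat ` {..<p} = {x. poly ?P x = 0}"
    using roots by (intro card_seteq) auto
  moreover have "y \<in> {x. poly ?P x = 0}" using assms by (simp add: poly_monom)
  ultimately have "y \<in> of_nat ` {..<p}" by metis
  then show ?thesis by blast
qed

text \<open>The trace is a nonzero polynomial of degree at most \<open>p ^ (m - 1)\<close>, too
  small for \<open>p ^ m\<close> roots.\<close>

lemma field_tr_nonzero: "\<exists>x. field_tr x \<noteq> 0"
proof (rule ccontr)
  assume "\<not> ?thesis"
  then have z: "field_tr x = 0" for x by simp
  have p1: "p > 1" using p prime_gt_1_nat by blast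
  have "CARD('k) \<ge> 2"
  proof -
    have "card {0, 1 :: 'k} \<le> CARD('k)" by (intro card_mono) auto
    then show ?thesis by simp
  qed
  then obtain n where n: "m = Suc n" using card by (cases m) auto
  let ?P = "\<Sum>i<m. monom 1 (p ^ i) :: 'k poly"
  have "coeff ?P (p ^ n) = (\<Sum>i<m. if i = n then 1 else 0)"
    unfolding coeff_sum using p1 by (intro sum.cong refl) (auto simp: power_inject_exp)
  then have "coeff ?P (p ^ n) = 1" by (simp add: n)
  then have nz: "?P \<noteq> 0" by (metis coeff_0 zero_neq_one)
  have "degree ?P \<le> p ^ n"
    by (rule degree_sum_le) (use p1 in \<open>auto simp: degree_monom_eq n intro!: power_increasing\<close>)
  moreover have "card {x. poly ?P x = 0} \<le> degree ?P" by (rule card_poly_roots_bound[OF nz])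
  moreover have "poly ?P x = 0" for x using z[of x] by (simp add: poly_sum poly_monom field_tr_def)
  ultimately have "CARD('k) \<le> p ^ n" by simp
  then show False using card p1 by (simp add: n)
qed

lemma root_of_unity_cong:
  assumes "of_nat n = (of_nat n' :: 'k)"
  shows "exp (2 * of_real pi * \<i> / of_nat p * of_nat n) = exp (2 * of_real pi * \<i> / of_nat p * of_nat n')"
proof -
  let ?w = "exp (2 * of_real pi * \<i> / of_nat p)"
  have p0: "p > 0" using p prime_gt_0_nat by blast
  have w: "?w ^ p = 1"
    using exp_of_nat_mult[of p "2 * of_real pi * \<i> / of_nat p"] exp_two_pi_i p0 by simp
  have red: "?w ^ k = ?w ^ (k mod p)" for k
    using power_add[of ?w "p * (k div p)" "k mod p"] w by (simp add: power_mult)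
  have "n mod p = n' mod p"
    using assms by (simp add: of_nat_eq_iff_cong_CHAR CHAR_eq_prime cong_def)
  then have "?w ^ n = ?w ^ n'" using red[of n] red[of n'] by simp
  then show ?thesis by (simp add: exp_of_nat_mult[symmetric] mult.commute)
qed

lemma char_phi_eq:
  assumes "of_nat n = field_tr x"
  shows "char_phi p m x = exp (2 * of_real pi * \<i> / of_nat p * of_nat n)"
proof -
  have "of_nat (LEAST n. of_nat n = (\<Sum>i<m. x ^ p ^ i)) = (\<Sum>i<m. x ^ p ^ i)"
    using assms unfolding field_tr_def by (rule LeastI)
  then show ?thesis unfolding char_phi_def
    by (intro root_of_unity_cong) (use assms in \<open>simp add: field_tr_def\<close>)
qed

lemma char_phi_add: "char_phi p m (x + y :: 'k) = char_phi p m x * char_phi p m y"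
proof -
  obtain a b where ab: "of_nat a = field_tr x" "of_nat b = field_tr y"
    using prime_field field_tr_power by metis
  then have "of_nat (a + b) = field_tr (x + y)" by (simp add: field_tr_add)
  then show ?thesis using char_phi_eq[OF ab(1)] char_phi_eq[OF ab(2)] char_phi_eq[of "a + b" "x + y"]
    by (simp add: exp_add[symmetric] add_divide_distrib algebra_simps)
qed

lemma norm_char_phi: "cmod (char_phi p m (x :: 'k)) = 1"
proof -
  have "exp (2 * of_real pi * \<i> / of_nat p * of_nat n) = exp (\<i> * of_real (2 * pi / real p * real n))" for n
    by (simp add: mult_ac)
  then show ?thesis unfolding char_phi_def by (metis norm_exp_i_times)
qed

lemma char_phi_nontrivial: "\<exists>x :: 'k. char_phi p m x \<noteq> 1"
proof -
  obtain x :: 'k where x: "field_tr x \<noteq> 0" using field_tr_nonzero by blast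
  obtain n where n: "of_nat n = field_tr x" using prime_field field_tr_power by metis
  have p0: "p > 0" using p prime_gt_0_nat by blast
  have "char_phi p m x \<noteq> 1"
  proof
    assume "char_phi p m x = 1"
    then have "exp (2 * of_real pi * \<i> / of_nat p * of_nat n) = 1" using char_phi_eq[OF n] by simp
    then obtain j :: int where "Im (2 * of_real pi * \<i> / of_nat p * of_nat n) = of_int (2 * j) * pi"
      unfolding exp_eq_1 by blast
    then have "2 * pi / real p * real n = of_int (2 * j) * pi" by simp
    then have "real n = real_of_int j * real p" using p0 by (simp add: field_simps)
    then have "int n = j * int p" by (metis of_int_eq_iff of_int_mult of_int_of_nat_eq)
    then have "p dvd n" by (metis dvd_triv_right int_dvd_int_iff)
    then have "(of_nat n :: 'k) = 0" using of_nat_eq_0_iff_char_dvd[where 'a='k] CHAR_eq_prime by simp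
    then show False using n x by simp
  qed
  then show ?thesis by blast
qed

end

section \<open>The trace of an endomorphism and the pairing of the two spaces of maps\<close>

context fin_vs
begin

text \<open>\<open>lin_trace\<close> uses an unspecified basis. Expanding in both bases gives the
  same double sum, which frees the choice; \<open>trace_annihilates\<close> relies on a basis
  adapted to a subspace.\<close>

lemma lin_trace_basis:
  assumes A: "Vector_Spaces.linear scale scale A" and C: "independent C" "span C = UNIV"
  shows "lin_trace scale A = (\<Sum>c\<in>C. representation C (A c) c)"
proof -
  interpret A: Vector_Spaces.linear scale scale A by fact
  define B where "B = (SOME B. \<not> dependent B \<and> span B = UNIV)"
  have "\<exists>B. \<not> dependent B \<and> span B = UNIV" using independent_Basis span_Basis by blast
  then have B: "independent B" "span B = UNIV" unfolding B_def by (metis (mono_tags, lifting) someI_ex)+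
  have fin: "finite B" "finite C" using finiteI_independent B C by auto
  have exp: "A b = (\<Sum>c\<in>C. scale (representation C b c) (A c))" for b
  proof -
    have "b = (\<Sum>c\<in>C. scale (representation C b c) c)"
      using sum_representation_eq[of C b C] C fin by simp
    then have "A b = A (\<Sum>c\<in>C. scale (representation C b c) c)" by simp
    then show ?thesis by (simp add: A.sum A.scale)
  qed
  have "lin_trace scale A = (\<Sum>b\<in>B. representation B (A b) b)"
    unfolding lin_trace_def B_def by (simp add: Let_def)
  also have "\<dots> = (\<Sum>b\<in>B. \<Sum>c\<in>C. representation C b c * representation B (A c) b)"
  proof (rule sum.cong[OF refl])
    fix b
    show "representation B (A b) b = (\<Sum>c\<in>C. representation C b c * representation B (A c) b)"
      by (subst exp) (simp add: representation_sum representation_scale B)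
  qed
  also have "\<dots> = (\<Sum>c\<in>C. \<Sum>b\<in>B. representation B (A c) b * representation C b c)"
    by (subst sum.swap) (simp add: mult.commute)
  also have "\<dots> = (\<Sum>c\<in>C. representation C (A c) c)"
  proof (rule sum.cong[OF refl])
    fix c
    have "A c = (\<Sum>b\<in>B. scale (representation B (A c) b) b)"
      using sum_representation_eq[of B "A c" B] B fin by simp
    then have "representation C (A c) c = representation C (\<Sum>b\<in>B. scale (representation B (A c) b) b) c" by simp
    also have "\<dots> = (\<Sum>b\<in>B. representation B (A c) b * representation C b c)"
      by (simp add: representation_sum representation_scale C)
    finally show "(\<Sum>b\<in>B. representation B (A c) b * representation C b c) = representation C (A c) c" by simp
  qed
  finally show ?thesis .
qed

lemma lin_trace_Basis:
  "Vector_Spaces.linear scale scale A \<Longrightarrow> lin_trace scale A = (\<Sum>c\<in>Basis. representation Basis (A c) c)"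
  by (rule lin_trace_basis) (auto simp: independent_Basis span_Basis)

end

locale lin_char = lin_pair sV BV sW BW
  for sV :: "'k::{field,finite} \<Rightarrow> 'v::ab_group_add \<Rightarrow> 'v" and BV :: "'v set"
    and sW :: "'k \<Rightarrow> 'w::ab_group_add \<Rightarrow> 'w" and BW :: "'w set" +
  fixes pr ex :: nat
  assumes prime_pr: "prime pr" and card_k: "CARD('k) = pr ^ ex"
begin

definition LT :: "('v \<Rightarrow> 'w) set" where "LT = lin_maps sV sW"

definition SS :: "'v set \<times> 'w set \<Rightarrow> ('v \<Rightarrow> 'w) set" where
  "SS p = sub_lin_maps sV sW (fst p) (snd p)"

abbreviation ee :: "('w \<Rightarrow> 'v) \<Rightarrow> ('v \<Rightarrow> 'w) \<Rightarrow> complex" where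
  "ee \<equiv> char_u pr ex sV"

lemma LT_iff: "T \<in> LT \<longleftrightarrow> (\<forall>x y. T (x + y) = T x + T y) \<and> (\<forall>c x. T (sV c x) = sW c (T x))"
  unfolding LT_def lin_maps_def mem_Collect_eq Vector_Spaces.linear_iff
  using V.vector_space_axioms W.vector_space_axioms by blast

lemma zero_LT: "0 \<in> LT" by (simp add: LT_iff)

lemma diff_LT: "\<lbrakk>S \<in> LT; T \<in> LT\<rbrakk> \<Longrightarrow> S - T \<in> LT"
  by (simp add: LT_iff W.scale_right_diff_distrib fun_diff_def)

lemma add_LT: "\<lbrakk>S \<in> LT; T \<in> LT\<rbrakk> \<Longrightarrow> S + T \<in> LT"
  by (simp add: LT_iff W.scale_right_distrib ac_simps)

lemma finite_LT: "finite (A :: ('v \<Rightarrow> 'w) set)"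
proof -
  have "finite (Pi\<^sub>E (UNIV :: 'v set) (\<lambda>_. UNIV :: 'w set))"
    by (intro finite_PiE W.finite_UNIV_vs V.finite_UNIV_vs)
  then have "finite (UNIV :: ('v \<Rightarrow> 'w) set)" by (simp add: PiE_UNIV_domain)
  then show ?thesis using finite_subset subset_UNIV by metis
qed

lemma SS_iff: "T \<in> SS p \<longleftrightarrow> T \<in> LT \<and> (\<forall>u\<in>fst p. T u = 0) \<and> (\<forall>v. T v \<in> snd p)"
  by (auto simp: SS_def sub_lin_maps_def LT_def)

lemma comp_linear: "\<lbrakk>X \<in> LX; T \<in> LT\<rbrakk> \<Longrightarrow> Vector_Spaces.linear sV sV (X \<circ> T)"
  unfolding Vector_Spaces.linear_iff using V.vector_space_axioms by (simp add: LX_iff LT_iff)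

lemma repr_add: "V.independent B \<Longrightarrow> V.span B = UNIV \<Longrightarrow>
    V.representation B (x + y) b = V.representation B x b + V.representation B y b"
  by (simp add: V.representation_add)

lemma trace_add_left:
  assumes "X \<in> LX" "Y \<in> LX" "T \<in> LT"
  shows "lin_trace sV ((X + Y) \<circ> T) = lin_trace sV (X \<circ> T) + lin_trace sV (Y \<circ> T)"
  using comp_linear[OF assms(1,3)] comp_linear[OF assms(2,3)] comp_linear[OF add_LX[OF assms(1,2)] assms(3)]
  by (simp add: V.lin_trace_Basis repr_add V.independent_Basis V.span_Basis sum.distrib)

lemma trace_add_right:
  assumes "X \<in> LX" "S \<in> LT" "T \<in> LT"
  shows "lin_trace sV (X \<circ> (S + T)) = lin_trace sV (X \<circ> S) + lin_trace sV (X \<circ> T)"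
  using comp_linear[OF assms(1,2)] comp_linear[OF assms(1,3)] comp_linear[OF assms(1) add_LT[OF assms(2,3)]]
  by (simp add: V.lin_trace_Basis repr_add V.independent_Basis V.span_Basis sum.distrib LX_add[OF assms(1)])

text \<open>In a basis extending one of \<open>fst p\<close> the diagonal vanishes: \<open>T\<close>
  kills the basis vectors in \<open>fst p\<close>, and \<open>X \<circ> T\<close> has values in
  \<open>fst p\<close>, hence no component along the others.\<close>

lemma trace_annihilates:
  assumes p: "p \<in> pairs" and X: "X \<in> NN p" and T: "T \<in> SS p"
  shows "lin_trace sV (X \<circ> T) = 0"
proof -
  have XL: "X \<in> LX" and TL: "T \<in> LT" using X T by (auto simp: NN_def SS_iff)
  obtain C where C: "C \<subseteq> fst p" "V.independent C" "fst p \<subseteq> V.span C" using V.basis_exists[of "fst p"] by metis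
  let ?B = "V.extend_basis C"
  have B: "V.independent ?B" "V.span ?B = UNIV" "C \<subseteq> ?B"
    using V.independent_extend_basis[OF C(2)] V.span_extend_basis[OF C(2)] V.extend_basis_superset[OF C(2)] by auto
  have "V.representation ?B ((X \<circ> T) c) c = 0" if "c \<in> ?B" for c
  proof (cases "c \<in> C")
    case True
    then have "(X \<circ> T) c = 0" using T C(1) LX_zero[OF XL] by (auto simp: SS_iff)
    then show ?thesis by (simp add: V.representation_zero)
  next
    case False
    have "(X \<circ> T) c \<in> V.span C" using X T C(3) by (auto simp: SS_iff NN_def)
    then have "V.representation ?B ((X \<circ> T) c) = V.representation C ((X \<circ> T) c)"
      by (rule V.representation_extend[OF B(1) _ B(3)])
    then show ?thesis using V.representation_ne_zero[of C "(X \<circ> T) c" c] False by auto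
  qed
  then show ?thesis unfolding V.lin_trace_basis[OF comp_linear[OF XL TL] B(1,2)] by simp
qed

lemma trace_rank_one:
  assumes \<phi>: "V.functional \<phi>"
  shows "lin_trace sV (\<lambda>x. sV (\<phi> x) y) = \<phi> y"
proof -
  interpret \<phi>: Vector_Spaces.linear sV "(*)" \<phi> by fact
  have lin: "Vector_Spaces.linear sV sV (\<lambda>x. sV (\<phi> x) y)"
    unfolding Vector_Spaces.linear_iff using V.vector_space_axioms
    by (simp add: \<phi>.add \<phi>.scale V.scale_left_distrib)
  have "\<phi> y = \<phi> (\<Sum>b\<in>BV. sV (V.representation BV y b) b)"
    using V.sum_representation_eq[of BV y BV] V.independent_Basis V.span_Basis V.finite_Basis by simp
  also have "\<dots> = (\<Sum>b\<in>BV. V.representation BV y b * \<phi> b)" by (simp add: \<phi>.sum \<phi>.scale)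
  finally show ?thesis unfolding V.lin_trace_Basis[OF lin]
    by (simp add: V.representation_scale V.independent_Basis V.span_Basis mult.commute)
qed

lemma ee_add_left: "\<lbrakk>X \<in> LX; Y \<in> LX; T \<in> LT\<rbrakk> \<Longrightarrow> ee (X + Y) T = ee X T * ee Y T"
  by (simp only: char_u_def trace_add_left char_phi_add[OF prime_pr card_k])

lemma ee_add_right: "\<lbrakk>X \<in> LX; S \<in> LT; T \<in> LT\<rbrakk> \<Longrightarrow> ee X (S + T) = ee X S * ee X T"
  by (simp only: char_u_def trace_add_right char_phi_add[OF prime_pr card_k])

lemma norm_ee: "cmod (ee X T) = 1"
  by (simp only: char_u_def norm_char_phi[OF prime_pr card_k])

lemma SS_diff: "\<lbrakk>p \<in> pairs; S \<in> SS p; T \<in> SS p\<rbrakk> \<Longrightarrow> S - T \<in> SS p"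
  using W.subspace_diff[OF pairsD(2)] by (simp add: SS_iff diff_LT)

lemma SS_add: "\<lbrakk>p \<in> pairs; S \<in> SS p; T \<in> SS p\<rbrakk> \<Longrightarrow> S + T \<in> SS p"
  using W.subspace_add[OF pairsD(2)] by (simp add: SS_iff add_LT)

lemma ee_orthogonality:
  assumes p: "p \<in> pairs" and X: "X \<in> LX"
  shows "(\<Sum>T\<in>SS p. ee X T) = of_bool (X \<in> NN p) * of_nat (card (SS p))"
proof (cases "X \<in> NN p")
  case True
  have "char_phi pr ex (0 :: 'k) * char_phi pr ex (0 :: 'k) = char_phi pr ex (0 :: 'k)"
    using char_phi_add[OF prime_pr card_k, of 0 0] by simp
  then have "char_phi pr ex (0 :: 'k) = 1"
    using norm_char_phi[OF prime_pr card_k, of 0] by (metis mult_cancel_left2 norm_zero zero_neq_one)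
  then have "ee X T = 1" if "T \<in> SS p" for T
    using trace_annihilates[OF p True that] by (simp add: char_u_def)
  then show ?thesis using True by simp
next
  case False
  then obtain w where w: "w \<in> snd p" "X w \<notin> fst p" using X by (auto simp: NN_def)
  obtain \<psi> where \<psi>: "V.functional \<psi>" "\<And>u. u \<in> fst p \<Longrightarrow> \<psi> u = 0" "\<psi> (X w) = 1"
    by (rule V.separating_functional[OF pairsD(1)[OF p] w(2)]) (rule that)
  interpret \<psi>: Vector_Spaces.linear sV "(*)" \<psi> by fact
  obtain a :: 'k where a: "char_phi pr ex a \<noteq> 1" using char_phi_nontrivial[OF prime_pr card_k] by blast
  \<comment> \<open>A rank-one map in \<open>SS p\<close>, scaled so that \<open>X \<circ> R\<close>
    has trace \<open>a\<close>, where the character is nontrivial. Translating the sum by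
    \<open>R\<close> multiplies it by \<open>ee X R \<noteq> 1\<close>.\<close>
  define R where "R = (\<lambda>v. sW (a * \<psi> v) w)"
  have RL: "R \<in> LT"
    by (simp add: LT_iff R_def \<psi>.add \<psi>.scale W.scale_left_distrib distrib_left mult_ac)
  have R: "R \<in> SS p"
    using RL \<psi>(2) W.subspace_scale[OF pairsD(2)[OF p] w(1)] by (auto simp: SS_iff R_def)
  have "X \<circ> R = (\<lambda>v. sV (\<psi> v) (sV a (X w)))"
    by (rule ext) (simp add: R_def LX_scale[OF X] mult.commute)
  then have "lin_trace sV (X \<circ> R) = \<psi> (sV a (X w))" 
    by (simp only: trace_rank_one[OF \<psi>(1)])
  then have "ee X R \<noteq> 1" using a \<psi>(3) by (simp add: char_u_def \<psi>.scale)
  moreover have "(\<Sum>T\<in>SS p. ee X (T + R)) = (\<Sum>T\<in>SS p. ee X T)"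
    by (rule sum.reindex_bij_witness[of _ "\<lambda>T. T - R" "\<lambda>T. T + R"])
       (auto intro: SS_add[OF p _ R] SS_diff[OF p _ R])
  moreover have "(\<Sum>T\<in>SS p. ee X (T + R)) = (\<Sum>T\<in>SS p. ee X T) * ee X R"
    unfolding sum_distrib_right using X RL by (intro sum.cong refl ee_add_right) (auto simp: SS_iff)
  ultimately have "(\<Sum>T\<in>SS p. ee X T) = 0" by (metis mult_cancel_left2)
  then show ?thesis using False by simp
qed

sublocale char_pairing LX LT ee NN SS pairs
proof
  show "X - Y \<in> NN p" if "p \<in> pairs" "X \<in> NN p" "Y \<in> NN p" for p X Y
    using that V.subspace_diff[OF pairsD(1)] by (simp add: NN_def diff_LX)
  show "0 \<in> NN p" if "p \<in> pairs" for p
    using V.subspace_0[OF pairsD(1)[OF that]] by (simp add: NN_def zero_LX)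
  show "0 \<in> SS p" if "p \<in> pairs" for p
    using W.subspace_0[OF pairsD(2)[OF that]] by (simp add: SS_iff zero_LT)
qed (auto simp: finite_LX finite_LT zero_LX zero_LT diff_LX diff_LT ee_add_left ee_add_right norm_ee
    ee_orthogonality NN_def SS_diff intro: SS_iff[THEN iffD1, THEN conjunct1])

end

section \<open>Moebius inversion and reduction of the order\<close>

text \<open>Moebius inversion along \<open>up\<close>. The number is fuel that makes the recursion
  primitive; once it reaches the height \<open>g x\<close>, more of it changes nothing
  (\<open>mob_stable\<close>).\<close>

primrec mob :: "('p \<Rightarrow> 'p set) \<Rightarrow> ('p \<Rightarrow> real) \<Rightarrow> nat \<Rightarrow> 'p \<Rightarrow> real" where
  "mob up \<phi> 0 x = \<phi> x"
| "mob up \<phi> (Suc n) x = \<phi> x - (\<Sum>y\<in>up x. mob up \<phi> n y)"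

lemma mob_stable:
  fixes g :: "'p \<Rightarrow> nat"
  assumes g: "\<And>x y. y \<in> up x \<Longrightarrow> g y < g x"
  shows "g x \<le> n \<Longrightarrow> g x \<le> n' \<Longrightarrow> mob up \<phi> n x = mob up \<phi> n' x"
proof (induction n arbitrary: n' x)
  case 0
  then have "up x = {}" using g by fastforce
  then show ?case by (cases n') auto
next
  case (Suc n)
  show ?case
  proof (cases n')
    case 0
    then have "up x = {}" using g Suc.prems by fastforce
    then show ?thesis using 0 by simp
  next
    case (Suc k)
    have "mob up \<phi> n y = mob up \<phi> k y" if "y \<in> up x" for y
      using Suc.IH[of y k] g[OF that] Suc.prems Suc by simp
    then show ?thesis using Suc by simp
  qed
qed

lemma mob_eq:
  fixes g :: "'p \<Rightarrow> nat"
  assumes "\<And>x y. y \<in> up x \<Longrightarrow> g y < g x" "g x \<le> n"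
  shows "mob up \<phi> n x + (\<Sum>y\<in>up x. mob up \<phi> n y) = \<phi> x"
proof -
  have "mob up \<phi> n x = mob up \<phi> (Suc n) x"
    by (rule mob_stable[where g=g]) (use assms in auto)
  then show ?thesis by simp
qed

lemma mob_cong:
  assumes "\<And>y. y \<in> A \<Longrightarrow> \<phi> y = \<psi> y" "\<And>y. y \<in> A \<Longrightarrow> up y \<subseteq> A" "x \<in> A"
  shows "mob up \<phi> n x = mob up \<psi> n x"
  using assms(3)
proof (induction n arbitrary: x)
  case (Suc n)
  then have "(\<Sum>y\<in>up x. mob up \<phi> n y) = (\<Sum>y\<in>up x. mob up \<psi> n y)"
    using assms(2) by (intro sum.cong) auto
  then show ?case using assms(1) Suc.prems by simp
qed (use assms in simp)

lemma mob_zero: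
  assumes "\<And>y. y \<in> A \<Longrightarrow> \<phi> y = 0" "\<And>y. y \<in> A \<Longrightarrow> up y \<subseteq> A" "x \<in> A"
  shows "mob up \<phi> n x = 0"
  using assms(3)
proof (induction n arbitrary: x)
  case (Suc n)
  then have "(\<Sum>y\<in>up x. mob up \<phi> n y) = 0"
    using assms(2) by (intro sum.neutral) auto
  then show ?case using assms(1) Suc.prems by simp
qed (use assms in simp)

text \<open>The recursion sums a geometric series: the terms
  \<open>Q ^ (g x - j) * (2 * Q) ^ j\<close> add up to \<open>Q ^ g x * (2 ^ g x - 1)\<close>, and
  the remaining \<open>Q ^ g x\<close> pays for the value of \<open>\<phi>\<close> at
  \<open>x\<close>.\<close>

lemma mob_bound:
  fixes g :: "'p \<Rightarrow> nat" and Q :: real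
  assumes g: "\<And>x y. y \<in> up x \<Longrightarrow> g y < g x" and A: "\<And>y. y \<in> A \<Longrightarrow> up y \<subseteq> A"
    and fin: "\<And>y. y \<in> A \<Longrightarrow> finite (up y)"
    and \<phi>: "\<And>y. y \<in> A \<Longrightarrow> \<bar>\<phi> y\<bar> \<le> 1" and Q: "Q \<ge> 1"
    and few: "\<And>y j. \<lbrakk>y \<in> A; j < g y\<rbrakk> \<Longrightarrow> real (card {z\<in>up y. g z = j}) \<le> Q ^ (g y - j)"
    and x: "x \<in> A"
  shows "\<bar>mob up \<phi> n x\<bar> \<le> (2 * Q) ^ g x"
  using x
proof (induction n arbitrary: x)
  case 0
  then show ?case using \<phi>[OF 0] one_le_power[of "2 * Q" "g x"] Q by simp
next
  case (Suc n)
  have "\<bar>\<Sum>y\<in>up x. mob up \<phi> n y\<bar> \<le> (\<Sum>y\<in>up x. \<bar>mob up \<phi> n y\<bar>)" by (rule sum_abs)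
  also have "\<dots> \<le> (\<Sum>y\<in>up x. (2 * Q) ^ g y)"
    using Suc.IH A[OF Suc.prems] by (intro sum_mono) auto
  also have "\<dots> = (\<Sum>j<g x. \<Sum>y\<in>{y\<in>up x. g y = j}. (2 * Q) ^ g y)"
    using g by (intro sum.group[symmetric] fin Suc.prems) auto
  also have "\<dots> = (\<Sum>j<g x. real (card {y\<in>up x. g y = j}) * (2 * Q) ^ j)" by simp
  also have "\<dots> \<le> (\<Sum>j<g x. Q ^ (g x - j) * (2 * Q) ^ j)"
    using few[OF Suc.prems] Q by (intro sum_mono mult_right_mono) auto
  also have "\<dots> = (\<Sum>j<g x. Q ^ g x * 2 ^ j)"
    by (intro sum.cong refl) (simp add: power_mult_distrib flip: power_add)
  also have "\<dots> = Q ^ g x * (2 ^ g x - 1)"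
    by (simp add: sum_distrib_left[symmetric] sum_gp_strict)
  finally have "\<bar>mob up \<phi> (Suc n) x\<bar> \<le> 1 + Q ^ g x * (2 ^ g x - 1)"
    using \<phi>[OF Suc.prems] by simp
  also have "\<dots> \<le> (2 * Q) ^ g x"
    using one_le_power[OF Q, of "g x"] by (simp add: power_mult_distrib algebra_simps)
  finally show ?case .
qed

section \<open>Pairs between a base pair and a finer one\<close>

context lin_pair
begin

lemma finite_pairs [simp]: "finite (A :: ('v set \<times> 'w set) set)"
proof -
  have "finite (UNIV :: 'v set set)" "finite (UNIV :: 'w set set)"
    using V.finite_UNIV_vs W.finite_UNIV_vs by (simp_all add: Finite_Set.finite_set)
  then have "finite (UNIV \<times> UNIV :: ('v set \<times> 'w set) set)" by (rule finite_cartesian_product)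
  then show ?thesis by (rule finite_subset[rotated]) auto
qed

lemma NN_mono: "ple p p' \<Longrightarrow> NN p \<subseteq> NN p'" by (auto simp: ple_def NN_def)

text \<open>The first component grows from \<open>fst p\<close> while the second shrinks from
  \<open>snd p\<close>; hence one count by dimension and one by codimension.\<close>

lemma card_pairs_between:
  assumes p: "p \<in> pairs" and n: "n \<in> pairs" and pn: "ple p n"
  shows "card {p'\<in>pairs. ple p p' \<and> ple p' n \<and> ord p' \<le> ord p + r} \<le> CARD('k) ^ ((ord n - ord p) * r)"
proof -
  let ?A = "{I \<in> V.between (fst p) (fst n). V.dim I \<le> V.dim (fst p) + r}"
  let ?B = "{I \<in> W.between (snd n) (snd p). W.dim (snd p) \<le> W.dim I + r}"
  have sub: "{p'\<in>pairs. ple p p' \<and> ple p' n \<and> ord p' \<le> ord p + r} \<subseteq> ?A \<times> ?B"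
  proof
    fix p' assume "p' \<in> {p'\<in>pairs. ple p p' \<and> ple p' n \<and> ord p' \<le> ord p + r}"
    then have p': "p' \<in> pairs" "ple p p'" "ple p' n" "ord p' \<le> ord p + r" by auto
    show "p' \<in> ?A \<times> ?B"
      using p' pairsD[OF p'(1)] ord_diff[OF p'(2)]
      by (auto simp: mem_Times_iff V.between_def W.between_def ple_def)
  qed
  have "card {p'\<in>pairs. ple p p' \<and> ple p' n \<and> ord p' \<le> ord p + r} \<le> card (?A \<times> ?B)"
    by (rule card_mono[OF finite_pairs sub])
  also have "\<dots> = card ?A * card ?B" by (rule card_cartesian_product)
  also have "\<dots> \<le> CARD('k) ^ ((V.dim (fst n) - V.dim (fst p)) * r) * CARD('k) ^ ((W.dim (snd p) - W.dim (snd n)) * r)"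
    by (intro mult_mono V.card_between_le W.card_between_codim_le pairsD p n)
       (use pn in \<open>auto simp: ple_def\<close>)
  also have "\<dots> = CARD('k) ^ ((ord n - ord p) * r)"
    using ord_diff[OF pn] by (simp flip: power_add add: distrib_right)
  finally show ?thesis .
qed

text \<open>The pairs between \<open>b\<close> and \<open>n\<close> that are good for \<open>X\<close> are those above \<open>ptype b n X\<close>. At
  \<open>ptype b n X\<close> the rank of \<open>X\<close> has dropped by the full order of the pair (\<open>full_drop\<close>), and if \<open>p\<close> is
  good, then the class of \<open>X\<close> at \<open>n\<close> leaves few choices for its class at \<open>p\<close> (\<open>cf_few\<close>).\<close>

definition good :: "'v set \<times> 'w set \<Rightarrow> 'v set \<times> 'w set \<Rightarrow> ('w \<Rightarrow> 'v) \<Rightarrow> bool" where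
  "good n p X \<longleftrightarrow> (\<forall>w\<in>snd n. X w \<in> fst n \<longrightarrow> X w \<in> fst p) \<and>
    (\<forall>w\<in>snd p. \<exists>k\<in>snd n. X (w - k) \<in> fst n)"

definition ptype :: "'v set \<times> 'w set \<Rightarrow> 'v set \<times> 'w set \<Rightarrow> ('w \<Rightarrow> 'v) \<Rightarrow> 'v set \<times> 'w set" where
  "ptype b n X = (im (fst b, kr n X) X, {k + z | k z. k \<in> snd n \<and> z \<in> kr (fst n, snd b) X})"

context
  fixes b n :: "'v set \<times> 'w set"
  assumes b: "b \<in> pairs" and n: "n \<in> pairs" and bn: "ple b n"
begin

lemma mix_pairs: "(fst b, snd n) \<in> pairs" "(fst n, snd b) \<in> pairs" "X \<in> LX \<Longrightarrow> (fst b, kr n X) \<in> pairs"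
  using pairsD[OF b] pairsD[OF n] subspace_kr[OF n] by (auto simp: pairs_def)

lemma ptype_pairs: "X \<in> LX \<Longrightarrow> ptype b n X \<in> pairs"
  using subspace_im[OF mix_pairs(3)] W.subspace_sums[OF pairsD(2)[OF n] subspace_kr[OF mix_pairs(2)]]
  by (auto simp: ptype_def pairs_def)

lemma ptype_between:
  assumes X: "X \<in> LX" shows "ple b (ptype b n X)" "ple (ptype b n X) n"
proof -
  have "fst b \<subseteq> fst (ptype b n X)" unfolding ptype_def using fst_sub_im[OF mix_pairs(3)[OF X] X] by simp
  moreover have "snd (ptype b n X) \<subseteq> snd b"
    unfolding ptype_def kr_def using bn W.subspace_add[OF pairsD(2)[OF b]] by (auto simp: ple_def)
  ultimately show "ple b (ptype b n X)" by (simp add: ple_def)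
  have "fst (ptype b n X) \<subseteq> fst n" unfolding ptype_def fst_conv
    by (rule im_minimal[OF pairsD(1)[OF n]]) (use bn in \<open>auto simp: ple_def kr_def\<close>)
  moreover have "snd n \<subseteq> snd (ptype b n X)"
  proof
    fix k assume "k \<in> snd n"
    moreover have "0 \<in> kr (fst n, snd b) X" using W.subspace_0[OF subspace_kr[OF mix_pairs(2) X]] .
    moreover have "k = k + 0" by simp
    ultimately show "k \<in> snd (ptype b n X)" unfolding ptype_def snd_conv by blast
  qed
  ultimately show "ple (ptype b n X) n" by (simp add: ple_def)
qed

lemma good_iff_ptype:
  assumes X: "X \<in> LX" and p: "p \<in> pairs" and bp: "ple b p" and pn: "ple p n"
  shows "good n p X \<longleftrightarrow> ple (ptype b n X) p"
proof
  assume g: "good n p X"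
  have "fst (ptype b n X) \<subseteq> fst p" unfolding ptype_def fst_conv
    by (rule im_minimal[OF pairsD(1)[OF p]]) (use bp g in \<open>auto simp: ple_def kr_def good_def\<close>)
  moreover have "snd p \<subseteq> snd (ptype b n X)"
  proof
    fix w assume w: "w \<in> snd p"
    then obtain k where k: "k \<in> snd n" "X (w - k) \<in> fst n" using g by (auto simp: good_def)
    have "w \<in> snd b" "k \<in> snd b" using w k bp bn by (auto simp: ple_def)
    then have "w - k \<in> kr (fst n, snd b) X" using k W.subspace_diff[OF pairsD(2)[OF b]] by (simp add: kr_def)
    moreover have "w = k + (w - k)" by simp
    ultimately show "w \<in> snd (ptype b n X)" unfolding ptype_def snd_conv using k(1) by blast
  qed
  ultimately show "ple (ptype b n X) p" by (simp add: ple_def)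
next
  assume t: "ple (ptype b n X) p"
  show "good n p X" unfolding good_def
  proof (intro conjI ballI impI)
    fix w assume "w \<in> snd n" "X w \<in> fst n"
    then have "X w \<in> im (fst b, kr n X) X" by (intro im_I mix_pairs X) (simp add: kr_def)
    then show "X w \<in> fst p" using t by (auto simp: ple_def ptype_def)
  next
    fix w assume "w \<in> snd p"
    then have "w \<in> snd (ptype b n X)" using t by (auto simp: ple_def)
    then obtain k z where "w = k + z" "k \<in> snd n" "z \<in> kr (fst n, snd b) X" unfolding ptype_def by auto
    then show "\<exists>k\<in>snd n. X (w - k) \<in> fst n" by (intro bexI[of _ k]) (auto simp: kr_def)
  qed
qed

text \<open>Both steps of \<open>rk_antimono\<close> lose all they can. \<open>snd ?t\<close> still
  contains the kernel of \<open>X\<close> at \<open>b\<close>, so confining to it costs the full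
  codimension; \<open>fst ?t\<close> lies in the image of \<open>snd ?t\<close>, so dividing by it
  costs the full dimension.\<close>

lemma full_drop:
  assumes X: "X \<in> LX"
  shows "rk (ptype b n X) X + ord (ptype b n X) = rk b X + ord b"
proof (rule antisym)
  let ?t = "ptype b n X"
  let ?m = "(fst b, snd ?t)"
  note t = ptype_pairs[OF X] and bt = ptype_between(1)[OF X] and tn = ptype_between(2)[OF X]
  show "rk b X + ord b \<le> rk ?t X + ord ?t" by (rule rk_antimono(2)[OF b t bt X])
  have m: "?m \<in> pairs" using pairsD[OF b] pairsD[OF t] by (simp add: pairs_def)
  have "kr b X \<subseteq> kr ?m X"
  proof
    fix z assume z: "z \<in> kr b X"
    then have "z \<in> kr (fst n, snd b) X" using bn by (auto simp: kr_def ple_def)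
    moreover have "z = 0 + z" "0 \<in> snd n" using W.subspace_0[OF pairsD(2)[OF n]] by auto
    ultimately have "z \<in> snd ?t" unfolding ptype_def snd_conv by blast
    then show "z \<in> kr ?m X" using z by (simp add: kr_def)
  qed
  then have 1: "W.dim (kr b X) \<le> W.dim (kr ?m X)" by (rule W.dim_subset)
  have "fst ?t \<subseteq> im ?m X"
    unfolding ptype_def fst_conv
  proof (rule im_minimal[OF subspace_im[OF m[unfolded ptype_def fst_conv] X]])
    show "fst (fst b, kr n X) \<subseteq> im (fst b, snd (im (fst b, kr n X) X, {k + z |k z. k \<in> snd n \<and> z \<in> kr (fst n, snd b) X})) X"
      using fst_sub_im[OF m X] unfolding ptype_def by simp
    fix w assume "w \<in> snd (fst b, kr n X)"
    then have "w \<in> snd n" by (simp add: kr_def)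
    then have "w \<in> snd ?t" using tn by (auto simp: ple_def)
    then have "X w \<in> im ?m X" by (intro im_I m) simp
    then show "X w \<in> im (fst b, snd (im (fst b, kr n X) X, {k + z |k z. k \<in> snd n \<and> z \<in> kr (fst n, snd b) X})) X"
      unfolding ptype_def by simp
  qed
  then have "im ?t X \<subseteq> im ?m X"
    by (intro im_minimal subspace_im[OF m X]) (auto intro: im_I[OF m])
  then have 2: "V.dim (im ?t X) \<le> V.dim (im ?m X)" by (rule V.dim_subset)
  show "rk ?t X + ord ?t \<le> rk b X + ord b"
    using 1 2 rk_ker[OF b X] rk_ker[OF m X] rk_im[OF t X] rk_im[OF m X] ord_diff[OF bt]
      V.dim_subset[of "fst b" "fst ?t"] W.dim_subset[of "snd ?t" "snd b"] bt
    by (simp add: ple_def)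
qed

definition levels :: "nat \<Rightarrow> ('v set \<times> 'w set) set" where
  "levels d = {p\<in>pairs. ple b p \<and> ple p n \<and> ord p \<le> ord b + d}"

text \<open>The conjunct \<open>p \<in> levels d\<close> makes the set empty elsewhere, so the
  height \<open>ord b + d - ord p\<close> decreases along it without side conditions
  (\<open>above_less\<close>).\<close>

definition above :: "nat \<Rightarrow> 'v set \<times> 'w set \<Rightarrow> ('v set \<times> 'w set) set" where
  "above d p = {p'\<in>levels d. p \<in> levels d \<and> ple p p' \<and> p' \<noteq> p}"

definition top_rank :: "nat \<Rightarrow> ('w \<Rightarrow> 'v) \<Rightarrow> 'v set \<times> 'w set \<Rightarrow> real" where
  "top_rank d X p = of_bool (rk p X + ord p = ord b + d)"

text \<open>The rank of \<open>X\<close> at \<open>b\<close> can be read off at its type, but the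
  class of \<open>X\<close> modulo \<open>NN p\<close> does not in general reveal whether
  \<open>p\<close> is that type. It does reveal whether \<open>p\<close> lies above it, which is
  \<open>good n p X\<close>. So the value at the type is spread over the pairs above it by Moebius
  coefficients that only look at ranks above \<open>p\<close>.\<close>

definition cf :: "nat \<Rightarrow> 'v set \<times> 'w set \<Rightarrow> ('w \<Rightarrow> 'v) \<Rightarrow> real" where
  "cf d p X = of_bool (good n p X) * mob (above d) (top_rank d X) d p"

lemma above_less: "p' \<in> above d p \<Longrightarrow> ord b + d - ord p' < ord b + d - ord p"
proof -
  assume "p' \<in> above d p"
  then have *: "p' \<in> pairs" "p \<in> pairs" "ple p p'" "p' \<noteq> p" "ord p' \<le> ord b + d"
    by (auto simp: above_def levels_def)
  then have "ord p < ord p'" using ple_ord_eq[OF *(2,1,3)] by fastforce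
  then show ?thesis using *(5) by linarith
qed

text \<open>By \<open>full_drop\<close>, rank \<open>d\<close> at \<open>b\<close> means that
  \<open>top_rank\<close> is 1 at the type, and inversion recovers this value from the good pairs.
  If the type has order beyond \<open>ord b + d\<close>, there is no good pair in
  \<open>levels d\<close>, and the rank exceeds \<open>d\<close>.\<close>

lemma cf_identity:
  assumes X: "X \<in> LX"
  shows "of_bool (rk b X = d) = (\<Sum>p\<in>levels d. cf d p X)"
proof -
  let ?t = "ptype b n X"
  let ?M = "mob (above d) (top_rank d X) d"
  have fd: "rk ?t X + ord ?t = rk b X + ord b" by (rule full_drop[OF X])
  have "(\<Sum>p\<in>levels d. cf d p X) = (\<Sum>p\<in>levels d. of_bool (ple ?t p) * ?M p)"
    unfolding cf_def using good_iff_ptype[OF X] by (intro sum.cong refl) (auto simp: levels_def)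
  also have "\<dots> = (\<Sum>p\<in>{p\<in>levels d. ple ?t p}. ?M p)"
    by (simp add: of_bool_def if_distrib if_distribR sum.inter_filter cong: if_cong)
  also have "\<dots> = of_bool (rk b X = d)"
  proof (cases "ord ?t \<le> ord b + d")
    case True
    then have t: "?t \<in> levels d" using ptype_pairs[OF X] ptype_between[OF X] by (simp add: levels_def)
    then have "{p\<in>levels d. ple ?t p} = insert ?t (above d ?t)" by (auto simp: above_def)
    then have "(\<Sum>p\<in>{p\<in>levels d. ple ?t p}. ?M p) = ?M ?t + (\<Sum>p\<in>above d ?t. ?M p)"
      by (simp add: above_def)
    also have "\<dots> = top_rank d X ?t"
      by (rule mob_eq[where g="\<lambda>p. ord b + d - ord p"])
         (use above_less ord_mono[OF ptype_between(1)[OF X]] in auto)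
    finally show ?thesis using fd by (simp add: top_rank_def)
  next
    case False
    then have e: "{p\<in>levels d. ple ?t p} = {}" using ord_mono[of ?t] by (fastforce simp: levels_def)
    have "rk b X \<noteq> d" using fd False by simp
    then show ?thesis unfolding e by simp
  qed
  finally show ?thesis by simp
qed

text \<open>Rank plus order is monotone along \<open>ple\<close>: if it exceeds
  \<open>ord b + d\<close> at \<open>p\<close>, it does so at every pair above, and the inverted
  function is zero there. This confines the reduction to levels \<open>r\<close> with
  \<open>ord p + r \<le> ord b + d\<close>.\<close>

lemma cf_support:
  assumes X: "X \<in> LX" and p: "p \<in> levels d" and nz: "cf d p X \<noteq> 0"
  shows "good n p X" "rk p X + ord p \<le> ord b + d"
proof -
  show "good n p X" using nz by (auto simp: cf_def)
  show "rk p X + ord p \<le> ord b + d"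
  proof (rule ccontr)
    assume *: "\<not> ?thesis"
    have "mob (above d) (top_rank d X) d p = 0"
    proof (rule mob_zero[where A="{p'\<in>levels d. ple p p'}"])
      fix p' assume p': "p' \<in> {p'\<in>levels d. ple p p'}"
      then have "rk p X + ord p \<le> rk p' X + ord p'"
        using p by (intro rk_antimono X) (auto simp: levels_def)
      then show "top_rank d X p' = 0" using * by (simp add: top_rank_def)
      show "above d p' \<subseteq> {p'\<in>levels d. ple p p'}" using p' by (auto simp: above_def intro: ple_trans)
    qed (use p in simp)
    then show False using nz by (simp add: cf_def)
  qed
qed

lemma cf_inv:
  assumes p: "p \<in> levels d" and X: "X \<in> LX" and Y: "Y \<in> LX" and XY: "Y - X \<in> NN p"
  shows "cf d p X = cf d p Y"
proof -
  have pn: "ple p n" and pp: "p \<in> pairs" using p by (auto simp: levels_def)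
  have g: "good n p Z'" if gZ: "good n p Z" and "Z \<in> LX" "Z' \<in> LX" and ZZ: "Z' - Z \<in> NN p" for Z Z'
    unfolding good_def
  proof (intro conjI ballI impI)
    have d: "Z' w - Z w \<in> fst p" if "w \<in> snd p" for w using ZZ that by (auto simp: NN_def)
    note Un = V.subspace_diff[OF pairsD(1)[OF n]] V.subspace_add[OF pairsD(1)[OF n]]
    note Up = V.subspace_add[OF pairsD(1)[OF pp]]
    {
      fix w assume w: "w \<in> snd n" "Z' w \<in> fst n"
      have wd: "Z' w - Z w \<in> fst p" using d w(1) pn by (auto simp: ple_def)
      then have "Z w \<in> fst n" using Un(1)[of "Z' w" "Z' w - Z w"] w(2) pn by (auto simp: ple_def)
      then have "Z w \<in> fst p" using gZ w(1) by (simp add: good_def)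
      then show "Z' w \<in> fst p" using Up[OF wd] by fastforce
    next
      fix w assume w: "w \<in> snd p"
      then obtain k where k: "k \<in> snd n" "Z (w - k) \<in> fst n" using gZ by (auto simp: good_def)
      have "w - k \<in> snd p" using w k(1) pn W.subspace_diff[OF pairsD(2)[OF pp]] by (auto simp: ple_def)
      then have "Z' (w - k) - Z (w - k) \<in> fst n" using d pn by (auto simp: ple_def)
      then have "Z' (w - k) \<in> fst n" using Un(2)[OF _ k(2)] by fastforce
      then show "\<exists>k\<in>snd n. Z' (w - k) \<in> fst n" using k(1) by blast
    }
  qed
  have YX: "X - Y \<in> NN p"
  proof -
    have "- (Y w - X w) \<in> fst p" if "w \<in> snd p" for w
      by (rule V.subspace_neg[OF pairsD(1)[OF pp]]) (use XY that in \<open>simp add: NN_def\<close>)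
    then show ?thesis using diff_LX[OF X Y] by (simp add: NN_def)
  qed
  have "mob (above d) (top_rank d X) d p = mob (above d) (top_rank d Y) d p"
  proof (rule mob_cong[where A="{p'\<in>levels d. ple p p'}"])
    fix p' assume p': "p' \<in> {p'\<in>levels d. ple p p'}"
    then have "Y - X \<in> NN p'" using XY NN_mono by blast
    then have "rk p' X = rk p' Y" using rk_cong[OF _ X Y] p' by (simp add: levels_def)
    then show "top_rank d X p' = top_rank d Y p'" by (simp add: top_rank_def)
    show "above d p' \<subseteq> {p'\<in>levels d. ple p p'}" using p' by (auto simp: above_def intro: ple_trans)
  qed (use p in simp)
  moreover have "good n p X \<longleftrightarrow> good n p Y" using g[OF _ X Y XY] g[OF _ Y X YX] by blast
  ultimately show ?thesis by (simp add: cf_def)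
qed

lemma card_levels: "real (card (levels d)) \<le> real CARD('k) ^ ((ord n - ord b) * d)"
proof -
  have "levels d \<subseteq> {p'\<in>pairs. ple b p' \<and> ple p' n \<and> ord p' \<le> ord b + d}" by (auto simp: levels_def)
  then have "card (levels d) \<le> CARD('k) ^ ((ord n - ord b) * d)"
    using card_pairs_between[OF b n bn, of d] card_mono[OF finite_pairs] by (meson order_trans)
  then show ?thesis by (simp flip: of_nat_power)
qed

lemma cf_bound:
  assumes p: "p \<in> levels d"
  shows "\<bar>cf d p X\<bar> \<le> (2 * real CARD('k) ^ (ord n - ord b)) ^ d"
proof -
  let ?Q = "real CARD('k) ^ (ord n - ord b)"
  have q1: "real CARD('k) \<ge> 1" using V.card_field_ge_2 by linarith
  then have Q1: "?Q \<ge> 1" by (rule one_le_power)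
  have "\<bar>mob (above d) (top_rank d X) d p\<bar> \<le> (2 * ?Q) ^ (ord b + d - ord p)"
  proof (rule mob_bound[where A="levels d"])
    show "above d y \<subseteq> levels d" for y by (auto simp: above_def)
    show "\<bar>top_rank d X y\<bar> \<le> 1" for y by (simp add: top_rank_def)
    fix y j assume y: "y \<in> levels d" and j: "j < ord b + d - ord y"
    then have yy: "y \<in> pairs" "ple y n" "ple b y" by (auto simp: levels_def)
    let ?r = "ord b + d - ord y - j"
    have "{z\<in>above d y. ord b + d - ord z = j} \<subseteq> {p'\<in>pairs. ple y p' \<and> ple p' n \<and> ord p' \<le> ord y + ?r}"
      using j by (auto simp: above_def levels_def)
    then have "card {z\<in>above d y. ord b + d - ord z = j} \<le> CARD('k) ^ ((ord n - ord y) * ?r)"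
      using card_pairs_between[OF yy(1) n yy(2), of ?r] card_mono[OF finite_pairs] by (meson order_trans)
    also have "\<dots> \<le> CARD('k) ^ ((ord n - ord b) * ?r)"
      using V.card_field_ge_2 ord_mono[OF yy(3)] by (intro power_increasing mult_right_mono) auto
    finally have "real (card {z\<in>above d y. ord b + d - ord z = j}) \<le> real (CARD('k) ^ ((ord n - ord b) * ?r))"
      by (rule of_nat_mono)
    then show "real (card {z\<in>above d y. ord b + d - ord z = j}) \<le> ?Q ^ ?r"
      by (simp add: power_mult)
  qed (use above_less Q1 p in auto)
  also have "\<dots> \<le> (2 * ?Q) ^ d"
  proof (rule power_increasing)
    show "1 \<le> 2 * ?Q" using Q1 by linarith
  qed (use p ord_mono[of b p] in \<open>auto simp: levels_def\<close>)
  finally show ?thesis by (auto simp: cf_def)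
qed

lemma cf_few:
  assumes p: "p \<in> levels d" and X0: "X0 \<in> LX"
  shows "real (card {X\<in>LX. X - X0 \<in> NN n \<and> cf d p X \<noteq> 0})
    \<le> real CARD('k) ^ (d * (ord n - ord b + 2 * d)) * real (card (NN p))"
proof (cases "{X\<in>LX. X - X0 \<in> NN n \<and> cf d p X \<noteq> 0} = {}")
  case True
  show ?thesis unfolding True by simp
next
  case False
  have pp: "p \<in> pairs" "ple b p" "ple p n" using p by (auto simp: levels_def)
  let ?A = "{X\<in>LX. X - X0 \<in> NN n \<and> cf d p X \<noteq> 0}"
  have r: "rk n X0 = rk n X \<and> kr n X0 = kr n X \<and> im n X0 = im n X \<and> rk p X \<le> d \<and> rk n X \<le> rk p X \<and> good n p X"
    if "X \<in> ?A" for X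
    using that rk_cong[OF n X0, of X] cf_support[OF _ p, of X] rk_antimono(1)[OF pp(1) n pp(3), of X]
      ord_mono[OF pp(2)] by auto
  then have rX0: "rk n X0 \<le> d" using False by fastforce
  have kp: "kr n X0 \<subseteq> snd p" using pp(3) by (auto simp: kr_def ple_def)
  have pi: "fst p \<subseteq> im n X0" using fst_sub_im[OF n X0] pp(3) by (auto simp: ple_def)
  \<comment> \<open>Goodness makes the induced map of \<open>X\<close> at \<open>p\<close> factor as
    a map from \<open>snd p\<close> modulo \<open>kr n X0\<close> into \<open>im n X0\<close> modulo
    \<open>fst p\<close>, two spaces known from the class of \<open>X0\<close> at
    \<open>n\<close>.\<close>
  have "?A \<subseteq> {Y\<in>LX. (\<forall>w\<in>kr n X0. Y w \<in> fst p) \<and> (\<forall>w\<in>snd p. Y w \<in> im n X0) \<and> rk (fst p, snd p) Y \<le> d}"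
  proof
    fix X assume XA: "X \<in> ?A"
    then have X: "X \<in> LX" by simp
    note rX = r[OF XA]
    have "X w \<in> fst p" if "w \<in> kr n X0" for w
      using that rX by (auto simp: kr_def good_def)
    moreover have "X w \<in> im n X0" if w: "w \<in> snd p" for w
    proof -
      obtain k where k: "k \<in> snd n" "X (w - k) \<in> fst n" using rX w by (auto simp: good_def)
      have "X w = X k + X (w - k)" by (simp add: LX_minus[OF X])
      then have "X w \<in> im n X" unfolding im_def using k by blast
      then show ?thesis using rX by simp
    qed
    ultimately show "X \<in> {Y\<in>LX. (\<forall>w\<in>kr n X0. Y w \<in> fst p) \<and> (\<forall>w\<in>snd p. Y w \<in> im n X0) \<and> rk (fst p, snd p) Y \<le> d}"
      using X rX by simp
  qed
  then have "card ?A \<le> card {Y\<in>LX. (\<forall>w\<in>kr n X0. Y w \<in> fst p) \<and> (\<forall>w\<in>snd p. Y w \<in> im n X0) \<and> rk (fst p, snd p) Y \<le> d}"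
    by (rule card_mono[OF finite_LX])
  also have "\<dots> \<le> card (NN (fst p, snd p)) *
      CARD('k) ^ (d * ((V.dim (im n X0) - V.dim (fst p)) + (W.dim (snd p) - W.dim (kr n X0))))"
    by (intro card_low_rank_le pairsD pp subspace_im subspace_kr n X0 pi kp)
  also have "\<dots> \<le> card (NN p) * CARD('k) ^ (d * (ord n - ord b + 2 * d))"
  proof (intro mult_mono power_increasing)
    have "V.dim (fst p) \<le> V.dim (fst n)" "W.dim (snd n) \<le> W.dim (snd p)"
      using pp(3) by (auto simp: ple_def intro: V.dim_subset W.dim_subset)
    then show "V.dim (im n X0) - V.dim (fst p) + (W.dim (snd p) - W.dim (kr n X0)) \<le> ord n - ord b + 2 * d"
      using rk_im[OF n X0] rk_ker[OF n X0] rX0 ord_diff[OF pp(3)] ord_mono[OF pp(2)] by linarith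
  qed (use V.card_field_ge_2 in auto)
  finally have "real (card ?A) \<le> real (card (NN p) * CARD('k) ^ (d * (ord n - ord b + 2 * d)))"
    by (rule of_nat_mono)
  then show ?thesis by (simp add: mult.commute)
qed

end

end

context lin_char
begin

definition level_part :: "(('w \<Rightarrow> 'v) \<Rightarrow> complex) \<Rightarrow> 'v set \<times> 'w set \<Rightarrow> nat \<Rightarrow> ('w \<Rightarrow> 'v) \<Rightarrow> complex" where
  "level_part a p r X = of_bool (rk p X = r) * a X"

lemma coset_sum_level_part:
  assumes p: "p \<in> pairs" and X: "X \<in> LX"
  shows "coset_sum (level_part a p r) p X T = of_bool (rk p X = r) * coset_sum a p X T"
  unfolding level_part_def
proof (rule coset_sum_restrict[OF p X])
  fix X Y assume *: "X \<in> LX" "Y \<in> LX" "Y - X \<in> NN p" "rk p X = r"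
  show "rk p Y = r" using rk_cong[OF p *(1-3)] *(4) by metis
qed

lemma NS_level_part:
  assumes "p \<in> pairs"
  shows "NS (level_part a p r) p T =
    (\<Sum>X\<in>LX. of_bool (rk p X = r) * (cmod (coset_sum a p X T))\<^sup>2) / real (card (NN p))"
  unfolding NS_def
  by (intro arg_cong2[where f="(/)"] sum.cong refl) (simp add: coset_sum_level_part[OF assms] norm_mult)

lemma two_power_le: "2 ^ j \<le> real CARD('k) ^ j"
  using V.card_field_ge_2 by (intro power_mono) auto

text \<open>\<open>NS_restriction_le\<close> with the coefficients \<open>cf\<close>. The exponent
  collects \<open>M * d\<close> for the number of pairs, \<open>d * (M + 2 * d)\<close> from
  \<open>cf_few\<close>, \<open>2 * (M + 1) * d\<close> for the squared coefficients, and
  \<open>M * d + d\<close> for the final sum over pairs and their at most \<open>d + 1\<close>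
  levels.\<close>

lemma order_reduction:
  assumes b: "b \<in> pairs" and n: "n \<in> pairs" and bn: "ple b n" and T: "T \<in> LT"
    and M: "ord n \<le> ord b + M"
    and \<Delta>: "\<And>p r. \<lbrakk>p \<in> pairs; ple b p; ple p n; ord p + r \<le> ord b + d\<rbrakk> \<Longrightarrow> NS (level_part a p r) p T \<le> \<Delta>"
    and \<Delta>0: "\<Delta> \<ge> 0"
  shows "NS (level_part a b d) n T \<le> real CARD('k) ^ (5 * d * M + 2 * d\<^sup>2 + 3 * d) * \<Delta>"
proof -
  let ?q = "real CARD('k)"
  let ?m = "ord n - ord b"
  let ?I = "levels b n d" and ?c = "cf b n d"
  have q1: "?q \<ge> 1" using V.card_field_ge_2 by linarith
  have mM: "?m \<le> M" using M by linarith
  have I: "p \<in> pairs \<and> ple b p \<and> ple p n \<and> ord p \<le> ord b + d" if "p \<in> ?I" for p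
    using that by (simp add: levels_def[OF b n bn])
  have "NS (level_part a b d) n T \<le> real (card ?I) * ?q ^ (d * (?m + 2 * d)) * ((2 * ?q ^ ?m) ^ d)\<^sup>2 *
    (\<Sum>p\<in>?I. (\<Sum>X\<in>LX. of_bool (?c p X \<noteq> 0) * (cmod (coset_sum a p X T))\<^sup>2) / real (card (NN p)))"
    unfolding level_part_def
  proof (rule NS_restriction_le[OF n T finite_pairs])
    fix p assume "p \<in> ?I"
    then show "p \<in> pairs" "NN p \<subseteq> NN n" using I NN_mono by auto
  qed (use cf_inv[OF b n bn] cf_identity[OF b n bn] cf_bound[OF b n bn] cf_few[OF b n bn] in auto)
  also have "\<dots> \<le> ?q ^ (M * d) * ?q ^ (d * (M + 2 * d)) * (?q ^ ((M + 1) * d))\<^sup>2 * (?q ^ (M * d) * (?q ^ d * \<Delta>))"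
  proof (intro mult_mono)
    show cI: "real (card ?I) \<le> ?q ^ (M * d)"
      using card_levels[OF b n bn, of d] mM q1
      by (meson mult_right_mono order_trans power_increasing zero_le)
    show "?q ^ (d * (?m + 2 * d)) \<le> ?q ^ (d * (M + 2 * d))"
      using mM q1 by (intro power_increasing mult_left_mono) auto
    have "2 * ?q ^ ?m \<le> ?q * ?q ^ M"
      using mM q1 V.card_field_ge_2 by (intro mult_mono power_increasing) auto
    then have "(2 * ?q ^ ?m) ^ d \<le> (?q ^ (M + 1)) ^ d" using q1 by (intro power_mono) auto
    then have "(2 * ?q ^ ?m) ^ d \<le> ?q ^ ((M + 1) * d)" by (simp only: power_mult)
    then show "((2 * ?q ^ ?m) ^ d)\<^sup>2 \<le> (?q ^ ((M + 1) * d))\<^sup>2"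
      using q1 by (intro power_mono) auto
    have "(\<Sum>p\<in>?I. (\<Sum>X\<in>LX. of_bool (?c p X \<noteq> 0) * (cmod (coset_sum a p X T))\<^sup>2) / real (card (NN p)))
      \<le> (\<Sum>p\<in>?I. real (d + 1) * \<Delta>)"
    proof (rule sum_mono)
      fix p assume p: "p \<in> ?I"
      let ?R = "{..ord b + d - ord p}"
      have "(\<Sum>X\<in>LX. of_bool (?c p X \<noteq> 0) * (cmod (coset_sum a p X T))\<^sup>2)
        \<le> (\<Sum>X\<in>LX. \<Sum>r\<in>?R. of_bool (rk p X = r) * (cmod (coset_sum a p X T))\<^sup>2)"
      proof (rule sum_mono)
        fix X assume X: "X \<in> LX"
        have "of_bool (?c p X \<noteq> 0) \<le> (\<Sum>r\<in>?R. of_bool (rk p X = r) :: real)"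
        proof (cases "?c p X = 0")
          case False
          then have "rk p X + ord p \<le> ord b + d" using cf_support(2)[OF b n bn X p] by blast
          then have "rk p X \<in> ?R" by simp
          then have "(\<Sum>r\<in>?R. of_bool (rk p X = r) :: real) = 1"
            by (simp add: of_bool_def)
          then show ?thesis by simp
        qed (simp add: sum_nonneg)
        then show "of_bool (?c p X \<noteq> 0) * (cmod (coset_sum a p X T))\<^sup>2 \<le>
          (\<Sum>r\<in>?R. of_bool (rk p X = r) * (cmod (coset_sum a p X T))\<^sup>2)"
          unfolding sum_distrib_right[symmetric] by (intro mult_right_mono) auto
      qed
      also have "\<dots> = (\<Sum>r\<in>?R. \<Sum>X\<in>LX. of_bool (rk p X = r) * (cmod (coset_sum a p X T))\<^sup>2)"
        by (rule sum.swap)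
      finally have "(\<Sum>X\<in>LX. of_bool (?c p X \<noteq> 0) * (cmod (coset_sum a p X T))\<^sup>2) / real (card (NN p))
        \<le> (\<Sum>r\<in>?R. NS (level_part a p r) p T)"
        using I[OF p] by (simp add: NS_level_part divide_right_mono flip: sum_divide_distrib)
      also have "\<dots> \<le> (\<Sum>r\<in>?R. \<Delta>)"
        using I[OF p] by (intro sum_mono \<Delta>) auto
      also have "\<dots> \<le> real (d + 1) * \<Delta>"
        using \<Delta>0 I[OF p] ord_mono[of b p] by (auto intro!: mult_right_mono)
      finally show "(\<Sum>X\<in>LX. of_bool (?c p X \<noteq> 0) * (cmod (coset_sum a p X T))\<^sup>2) / real (card (NN p))
        \<le> real (d + 1) * \<Delta>" .
    qed
    also have "\<dots> = real (card ?I) * (real (d + 1) * \<Delta>)" by simp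
    also have "\<dots> \<le> ?q ^ (M * d) * (?q ^ d * \<Delta>)"
    proof (intro mult_mono cI)
      have "real (d + 1) \<le> 2 ^ d" using less_exp[of d] by (metis Suc_eq_plus1 Suc_leI of_nat_le_iff of_nat_numeral of_nat_power)
      then show "real (d + 1) \<le> ?q ^ d" using two_power_le[of d] by linarith
    qed (use \<Delta>0 in auto)
    finally show "(\<Sum>p\<in>?I. (\<Sum>X\<in>LX. of_bool (?c p X \<noteq> 0) * (cmod (coset_sum a p X T))\<^sup>2) / real (card (NN p)))
       \<le> ?q ^ (M * d) * (?q ^ d * \<Delta>)" .
  qed (auto intro!: sum_nonneg divide_nonneg_nonneg mult_nonneg_nonneg \<Delta>0)
  also have "\<dots> = ?q ^ (M * d + d * (M + 2 * d) + (M + 1) * d * 2 + M * d + d) * \<Delta>"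
    by (simp only: power_add power_mult mult_ac)
  also have "M * d + d * (M + 2 * d) + (M + 1) * d * 2 + M * d + d = 5 * d * M + 2 * d\<^sup>2 + 3 * d"
    by (simp add: algebra_simps power2_eq_square)
  finally show ?thesis .
qed

end

section \<open>The fourth moment of a function of low rank\<close>

context lin_pair
begin

definition up_sub :: "'v set \<Rightarrow> 'v set \<Rightarrow> 'v set set" where
  "up_sub U I = {J \<in> V.between U I. J \<noteq> I \<and> V.subspace I \<and> V.subspace U}"

text \<open>The Moebius function of the interval from \<open>U\<close> to \<open>I\<close> in the
  lattice of subspaces, with \<open>D\<close> as fuel, which suffices while \<open>I\<close> has
  dimension at most \<open>D\<close> over \<open>U\<close>.\<close>

definition moebius :: "nat \<Rightarrow> 'v set \<Rightarrow> 'v set \<Rightarrow> real" where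
  "moebius D U I = mob (up_sub U) (\<lambda>J. of_bool (J = U)) D I"

lemma up_sub_less: "J \<in> up_sub U I \<Longrightarrow> V.dim J - V.dim U < V.dim I - V.dim U"
proof -
  assume "J \<in> up_sub U I"
  then have J: "V.subspace J" "U \<subseteq> J" "J \<subseteq> I" "J \<noteq> I" "V.subspace I" by (auto simp: up_sub_def V.between_def)
  then have "V.dim J < V.dim I" using V.subspace_sub_eq[OF J(1,5,3)] by fastforce
  moreover have "V.dim U \<le> V.dim J" using J(2) by (rule V.dim_subset)
  ultimately show ?thesis by linarith
qed

lemma moebius_sum:
  assumes "V.subspace U" "V.subspace I" "U \<subseteq> I" "V.dim I \<le> V.dim U + D"
  shows "(\<Sum>J\<in>V.between U I. moebius D U J) = of_bool (I = U)"
proof -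
  have e: "V.between U I = insert I (up_sub U I)" using assms by (auto simp: up_sub_def V.between_def)
  have "(\<Sum>J\<in>V.between U I. moebius D U J) = moebius D U I + (\<Sum>J\<in>up_sub U I. moebius D U J)"
    unfolding e by (rule sum.insert) (auto simp: up_sub_def)
  also have "\<dots> = of_bool (I = U)" unfolding moebius_def
    by (rule mob_eq[where g="\<lambda>J. V.dim J - V.dim U"]) (use up_sub_less assms in auto)
  finally show ?thesis .
qed

text \<open>With \<open>k\<close> the relative dimension, the exact modulus is
  \<open>CARD('k)\<close> to the power \<open>k * (k - 1) / 2\<close>; the general recursion bound
  is cruder but still quadratic in \<open>D\<close> in the exponent.\<close>

lemma moebius_bound:
  assumes U: "V.subspace U" and I: "V.subspace I" "U \<subseteq> I" "V.dim I \<le> V.dim U + D"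
  shows "\<bar>moebius D U I\<bar> \<le> real CARD('k) ^ ((D + 1) * D)"
proof -
  let ?Q = "real CARD('k) ^ D"
  have q2: "real CARD('k) \<ge> 2" using V.card_field_ge_2 by linarith
  then have Q1: "?Q \<ge> 1" by (intro one_le_power) linarith
  have "\<bar>moebius D U I\<bar> \<le> (2 * ?Q) ^ (V.dim I - V.dim U)" unfolding moebius_def
  proof (rule mob_bound[where A="{J. V.subspace J \<and> U \<subseteq> J \<and> V.dim J \<le> V.dim U + D}"])
    fix J assume "J \<in> {J. V.subspace J \<and> U \<subseteq> J \<and> V.dim J \<le> V.dim U + D}"
    then have J: "V.subspace J" "U \<subseteq> J" "V.dim J \<le> V.dim U + D" by auto
    show "up_sub U J \<subseteq> {J. V.subspace J \<and> U \<subseteq> J \<and> V.dim J \<le> V.dim U + D}"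
    proof
      fix L assume "L \<in> up_sub U J"
      then have L: "V.subspace L" "U \<subseteq> L" "L \<subseteq> J" by (auto simp: up_sub_def V.between_def)
      then show "L \<in> {J. V.subspace J \<and> U \<subseteq> J \<and> V.dim J \<le> V.dim U + D}"
        using J(3) V.dim_subset[OF L(3)] by simp
    qed
    show "finite (up_sub U J)" by (simp add: up_sub_def)
    fix j assume j: "j < V.dim J - V.dim U"
    let ?r = "V.dim J - V.dim U - j"
    have "{L\<in>up_sub U J. V.dim L - V.dim U = j} \<subseteq> {L\<in>V.between U J. V.dim J \<le> V.dim L + ?r}"
    proof
      fix L assume L: "L \<in> {L\<in>up_sub U J. V.dim L - V.dim U = j}"
      then have "L \<in> V.between U J" by (simp add: up_sub_def)
      moreover from this have "V.dim U \<le> V.dim L" using V.between_mono_dim by blast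
      moreover have "V.dim L - V.dim U = j" using L by blast
      ultimately have "V.dim J \<le> V.dim L + ?r" by linarith
      then show "L \<in> {L\<in>V.between U J. V.dim J \<le> V.dim L + ?r}" using \<open>L \<in> V.between U J\<close> by blast
    qed
    then have "card {L\<in>up_sub U J. V.dim L - V.dim U = j} \<le> card {L\<in>V.between U J. V.dim J \<le> V.dim L + ?r}"
      by (intro card_mono) auto
    also have "\<dots> \<le> CARD('k) ^ ((V.dim J - V.dim U) * ?r)"
      by (rule V.card_between_codim_le[OF U J(1,2)])
    also have "\<dots> \<le> CARD('k) ^ (D * ?r)"
      using V.card_field_ge_2 J(3) by (intro power_increasing mult_right_mono) auto
    finally have "real (card {L\<in>up_sub U J. V.dim L - V.dim U = j}) \<le> real (CARD('k) ^ (D * ?r))"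
      by (rule of_nat_mono)
    then show "real (card {L\<in>up_sub U J. V.dim L - V.dim U = j}) \<le> ?Q ^ ?r" by (simp add: power_mult)
  qed (use up_sub_less Q1 assms in auto)
  also have "\<dots> \<le> (2 * ?Q) ^ D"
  proof (rule power_increasing)
    show "1 \<le> 2 * ?Q" using Q1 by linarith
  qed (use I(3) in auto)
  also have "\<dots> \<le> (real CARD('k) * ?Q) ^ D" using q2 Q1 by (intro power_mono mult_right_mono) auto
  also have "\<dots> = real CARD('k) ^ ((D + 1) * D)"
    by (simp only: power_mult power_Suc Suc_eq_plus1[symmetric])
  finally show ?thesis .
qed

text \<open>A label \<open>(U, U\<^sub>2, K)\<close> records the part \<open>U\<close> of the image and the kernel \<open>K\<close> shared by two maps;
  \<open>U\<^sub>2\<close> is the summation variable of a Moebius inversion which expresses that \<open>U\<close> is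
  exactly the intersection of the two images.\<close>

context
  fixes b :: "'v set \<times> 'w set" and D :: nat
  assumes b: "b \<in> pairs"
begin

definition labels :: "('v set \<times> 'v set \<times> 'w set) set" where
  "labels = {(U, U2, K). V.subspace U \<and> V.subspace U2 \<and> W.subspace K \<and> fst b \<subseteq> U \<and> U \<subseteq> U2
     \<and> V.dim U2 \<le> V.dim U + D \<and> K \<subseteq> snd b}"

definition label_pair :: "'v set \<times> 'v set \<times> 'w set \<Rightarrow> 'v set \<times> 'w set" where
  "label_pair = (\<lambda>(U, U2, K). (U, K))"

text \<open>Conditions on one map alone, visible at \<open>b\<close>; they act as \<open>C\<close>
  in \<open>fourth_moment_le\<close>. \<open>transversal\<close> acts as \<open>D\<close> and sees
  both maps only through their classes at \<open>label_pair l\<close>.\<close>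

definition compatible :: "'v set \<times> 'v set \<times> 'w set \<Rightarrow> ('w \<Rightarrow> 'v) \<Rightarrow> bool" where
  "compatible = (\<lambda>(U, U2, K) X. U2 \<subseteq> im b X \<and> kr (U, snd b) X \<subseteq> K)"

definition transversal :: "'v set \<times> 'v set \<times> 'w set \<Rightarrow> ('w \<Rightarrow> 'v) \<Rightarrow> ('w \<Rightarrow> 'v) \<Rightarrow> bool" where
  "transversal l X Z \<longleftrightarrow>
    im (label_pair l) X \<inter> im (label_pair l) Z \<subseteq> fst (label_pair l) \<and>
    snd (label_pair l) \<subseteq> {k + z | k z. k \<in> kr (label_pair l) X \<and> z \<in> kr (label_pair l) Z}"

definition weight :: "'v set \<times> 'v set \<times> 'w set \<Rightarrow> real" where
  "weight = (\<lambda>(U, U2, K). moebius D U U2)"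

lemma label_pair_pairs: "l \<in> labels \<Longrightarrow> label_pair l \<in> pairs \<and> ple b (label_pair l)"
  by (auto simp: labels_def label_pair_def pairs_def ple_def)

lemma finite_labels: "finite (A :: ('v set \<times> 'v set \<times> 'w set) set)"
proof -
  have "finite (UNIV :: 'v set set)" "finite (UNIV :: 'w set set)"
    using V.finite_UNIV_vs W.finite_UNIV_vs by (simp_all add: Finite_Set.finite_set)
  then have "finite (UNIV \<times> UNIV \<times> UNIV :: ('v set \<times> 'v set \<times> 'w set) set)"
    by (intro finite_cartesian_product)
  then show ?thesis by (rule finite_subset[rotated]) auto
qed

lemma compatible_inv:
  assumes l: "l \<in> labels" and XY: "X \<in> LX" "Y \<in> LX" "Y - X \<in> NN b" and c: "compatible l X"
  shows "compatible l Y"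
proof -
  obtain U U2 K where lU: "l = (U, U2, K)" by (cases l) auto
  have p: "(U, snd b) \<in> pairs" "ple b (U, snd b)"
    using l pairsD[OF b] by (auto simp: labels_def lU pairs_def ple_def)
  have "Y - X \<in> NN (U, snd b)" using XY(3) NN_mono[OF p(2)] by blast
  then show ?thesis using rk_cong[OF b XY] rk_cong[OF p(1) XY(1,2)] c by (simp add: compatible_def lU)
qed

lemma transversal_inv:
  assumes l: "l \<in> labels" and XX: "X \<in> LX" "X' \<in> LX" "X' - X \<in> NN (label_pair l)"
    and ZZ: "Z \<in> LX" "Z' \<in> LX" "Z' - Z \<in> NN (label_pair l)" and t: "transversal l X Z"
  shows "transversal l X' Z'"
proof -
  have p: "label_pair l \<in> pairs" using label_pair_pairs[OF l] by blast
  show ?thesis using t rk_cong[OF p XX] rk_cong[OF p ZZ] by (simp add: transversal_def)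
qed

text \<open>Summing over \<open>U2\<close> leaves only \<open>U = I0\<close>, the intersection of
  the images, and then the kernel conditions single out \<open>K\<close> as the sum of the kernels
  modulo \<open>I0\<close>. Inversion is used for the images because their meeting in no more than
  \<open>U\<close> concerns both maps on all of \<open>snd b\<close>. For \<open>K\<close>, one
  inclusion splits into a condition on each map, and the other is visible at
  \<open>(U, K)\<close>.\<close>

lemma label_identity:
  assumes X: "X \<in> LX" and Z: "Z \<in> LX" and rX: "rk b X \<le> D"
  shows "(\<Sum>l\<in>labels. of_bool (compatible l X \<and> compatible l Z \<and> transversal l X Z) * weight l) = 1"
proof -
  define I0 where "I0 = im b X \<inter> im b Z"
  have I0: "V.subspace I0" "fst b \<subseteq> I0"
    using subspace_im[OF b] fst_sub_im[OF b] X Z by (auto simp: I0_def V.subspace_inter)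
  have dI0: "V.dim I0 \<le> V.dim (fst b) + D"
    using V.dim_subset[of I0 "im b X"] rk_im[OF b X] rX by (simp add: I0_def)
  define KK where "KK = (\<lambda>U. {K. W.subspace K \<and> K \<subseteq> snd b \<and> kr (U, snd b) X \<subseteq> K \<and> kr (U, snd b) Z \<subseteq> K \<and> transversal (U, U, K) X Z})"
  have finKK: "finite (KK U)" for U
    by (rule finite_subset[of _ UNIV]) (auto simp: Finite_Set.finite_set W.finite_UNIV_vs)
  have tr: "transversal (U, U2, K) X Z \<longleftrightarrow> transversal (U, U, K) X Z" for U U2 K
    by (simp add: transversal_def label_pair_def)
  let ?L = "{l\<in>labels. compatible l X \<and> compatible l Z \<and> transversal l X Z}"
  let ?S = "SIGMA U : V.between (fst b) I0. V.between U I0 \<times> KK U"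
  have L: "?L = ?S"
  proof (intro set_eqI iffI)
    fix l assume l: "l \<in> ?L"
    obtain U U2 K where lU: "l = (U, U2, K)" by (cases l) auto
    show "l \<in> ?S" using l tr[of U U2 K]
      by (auto simp: lU labels_def compatible_def V.between_def KK_def I0_def)
  next
    fix l assume l: "l \<in> ?S"
    obtain U U2 K where lU: "l = (U, U2, K)" by (cases l) auto
    have *: "V.subspace U" "fst b \<subseteq> U" "V.subspace U2" "U \<subseteq> U2" "U2 \<subseteq> I0" "K \<in> KK U"
      using l by (auto simp: lU V.between_def)
    have "V.dim U2 \<le> V.dim U + D"
      using dI0 V.dim_subset[OF *(5)] V.dim_subset[OF *(2)] by linarith
    then show "l \<in> ?L" using * tr[of U U2 K]
      by (auto simp: lU labels_def compatible_def KK_def I0_def)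
  qed
  have "(\<Sum>l\<in>labels. of_bool (compatible l X \<and> compatible l Z \<and> transversal l X Z) * weight l) = (\<Sum>l\<in>?L. weight l)"
    by (simp add: of_bool_def if_distrib if_distribR sum.inter_filter finite_labels cong: if_cong)
  also have "\<dots> = (\<Sum>(U, x)\<in>?S. weight (U, x))" unfolding L by simp
  also have "\<dots> = (\<Sum>U\<in>V.between (fst b) I0. \<Sum>x\<in>V.between U I0 \<times> KK U. weight (U, x))"
    by (rule sum.Sigma[symmetric]) (auto simp: finKK)
  also have "\<dots> = (\<Sum>U\<in>V.between (fst b) I0. real (card (KK U)) * (\<Sum>U2\<in>V.between U I0. moebius D U U2))"
    by (intro sum.cong refl) (simp add: weight_def sum.cartesian_product[symmetric] sum_distrib_left)
  also have "\<dots> = (\<Sum>U\<in>V.between (fst b) I0. if U = I0 then real (card (KK I0)) else 0)"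
  proof (intro sum.cong refl)
    fix U assume "U \<in> V.between (fst b) I0"
    then have U: "V.subspace U" "fst b \<subseteq> U" "U \<subseteq> I0" by (auto simp: V.between_def)
    have "V.dim I0 \<le> V.dim U + D" using dI0 V.dim_subset[OF U(2)] by linarith
    then show "real (card (KK U)) * (\<Sum>U2\<in>V.between U I0. moebius D U U2) = (if U = I0 then real (card (KK I0)) else 0)"
      using moebius_sum[OF U(1) I0(1) U(3)] by auto
  qed
  also have "\<dots> = real (card (KK I0))"
    using I0 by (simp add: V.between_def)
  also have "KK I0 = {{k + z | k z. k \<in> kr (I0, snd b) X \<and> z \<in> kr (I0, snd b) Z}}"
  proof -
    let ?K0 = "{k + z | k z. k \<in> kr (I0, snd b) X \<and> z \<in> kr (I0, snd b) Z}"
    have pI: "(I0, snd b) \<in> pairs" using I0 pairsD[OF b] by (simp add: pairs_def)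
    note sX = subspace_kr[OF pI X] and sZ = subspace_kr[OF pI Z]
    have K0: "W.subspace ?K0" by (rule W.subspace_sums[OF sX sZ])
    have K0b: "?K0 \<subseteq> snd b" using W.subspace_add[OF pairsD(2)[OF b]] by (auto simp: kr_def)
    have kX: "kr (I0, snd b) X \<subseteq> ?K0"
    proof
      fix k assume "k \<in> kr (I0, snd b) X"
      moreover have "k = k + 0" by simp
      ultimately show "k \<in> ?K0" using W.subspace_0[OF sZ] by blast
    qed
    have kZ: "kr (I0, snd b) Z \<subseteq> ?K0"
    proof
      fix k assume "k \<in> kr (I0, snd b) Z"
      moreover have "k = 0 + k" by simp
      ultimately show "k \<in> ?K0" using W.subspace_0[OF sX] by blast
    qed
    have "im (I0, ?K0) Y \<subseteq> im b Y" if Y: "Y \<in> LX" and "I0 \<subseteq> im b Y" for Y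
      by (rule im_minimal[OF subspace_im[OF b Y]]) (use K0b that im_I[OF b] in auto)
    then have "im (I0, ?K0) X \<inter> im (I0, ?K0) Z \<subseteq> I0" using X Z unfolding I0_def by blast
    moreover have "?K0 \<subseteq> {k + z | k z. k \<in> kr (I0, ?K0) X \<and> z \<in> kr (I0, ?K0) Z}"
    proof
      fix w assume "w \<in> ?K0"
      then obtain k z where kz: "w = k + z" "k \<in> kr (I0, snd b) X" "z \<in> kr (I0, snd b) Z" by blast
      have kr_I: "w \<in> kr (I0, ?K0) Y" if "w \<in> ?K0" "w \<in> kr (I0, snd b) Y" for w Y
        using that unfolding kr_def fst_conv snd_conv by (intro CollectI conjI) auto
      have "k \<in> kr (I0, ?K0) X" "z \<in> kr (I0, ?K0) Z"
        using kr_I[OF subsetD[OF kX kz(2)] kz(2)] kr_I[OF subsetD[OF kZ kz(3)] kz(3)] .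
      then show "w \<in> {k + z | k z. k \<in> kr (I0, ?K0) X \<and> z \<in> kr (I0, ?K0) Z}" using kz(1) by blast
    qed
    ultimately have "?K0 \<in> KK I0" using K0 K0b kX kZ by (simp add: KK_def transversal_def label_pair_def)
    moreover have "K = ?K0" if "K \<in> KK I0" for K
    proof
      have K: "W.subspace K" "K \<subseteq> snd b" "kr (I0, snd b) X \<subseteq> K" "kr (I0, snd b) Z \<subseteq> K"
        "K \<subseteq> {k + z | k z. k \<in> kr (I0, K) X \<and> z \<in> kr (I0, K) Z}"
        using that by (auto simp: KK_def transversal_def label_pair_def)
      show "?K0 \<subseteq> K" using K(3,4) W.subspace_add[OF K(1)] by blast
      have "kr (I0, K) Y \<subseteq> kr (I0, snd b) Y" for Y using K(2) by (auto simp: kr_def)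
      then show "K \<subseteq> ?K0" using K(5) by blast
    qed
    ultimately show ?thesis by blast
  qed
  finally show ?thesis by simp
qed

text \<open>\<open>U\<close> and \<open>U2\<close> lie between \<open>fst b\<close> and
  \<open>im b Z\<close>, and \<open>K\<close> between \<open>kr b Z\<close> and
  \<open>snd b\<close>: three intervals of relative dimension at most \<open>r\<close>.\<close>

lemma card_compatible:
  assumes Z: "Z \<in> LX" and r: "rk b Z \<le> r"
  shows "real (card {l\<in>labels. compatible l Z}) \<le> real CARD('k) ^ (3 * r\<^sup>2)"
proof -
  let ?A = "V.between (fst b) (im b Z)" and ?B = "W.between (kr b Z) (snd b)"
  have sub: "{l\<in>labels. compatible l Z} \<subseteq> ?A \<times> ?A \<times> ?B"
  proof
    fix l assume l: "l \<in> {l\<in>labels. compatible l Z}"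
    obtain U U2 K where lU: "l = (U, U2, K)" by (cases l) auto
    have "kr b Z \<subseteq> kr (U, snd b) Z" using l by (auto simp: lU labels_def kr_def)
    then show "l \<in> ?A \<times> ?A \<times> ?B"
      using l by (auto simp: lU labels_def compatible_def V.between_def W.between_def)
  qed
  have "card {l\<in>labels. compatible l Z} \<le> card (?A \<times> ?A \<times> ?B)"
    by (rule card_mono[OF _ sub]) simp
  also have "\<dots> = card ?A * (card ?A * card ?B)" by (simp add: card_cartesian_product)
  also have "\<dots> \<le> CARD('k) ^ r\<^sup>2 * (CARD('k) ^ r\<^sup>2 * CARD('k) ^ r\<^sup>2)"
  proof (intro mult_mono)
    have rr: "rk b Z * rk b Z \<le> r\<^sup>2" unfolding power2_eq_square using r by (intro mult_mono) auto
    have "card ?A \<le> CARD('k) ^ (rk b Z * rk b Z)"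
      using V.card_between[OF pairsD(1)[OF b] subspace_im[OF b Z] fst_sub_im[OF b Z]] rk_im[OF b Z] by simp
    also have "\<dots> \<le> CARD('k) ^ r\<^sup>2" using rr V.card_field_ge_2 by (intro power_increasing) auto
    finally show "card ?A \<le> CARD('k) ^ r\<^sup>2" .
    then show "card ?A \<le> CARD('k) ^ r\<^sup>2" .
    have "card ?B \<le> CARD('k) ^ (rk b Z * rk b Z)"
      using W.card_between[OF subspace_kr[OF b Z] pairsD(2)[OF b] kr_sub] rk_ker[OF b Z] by simp
    also have "\<dots> \<le> CARD('k) ^ r\<^sup>2" using rr V.card_field_ge_2 by (intro power_increasing) auto
    finally show "card ?B \<le> CARD('k) ^ r\<^sup>2" .
  qed auto
  also have "\<dots> = CARD('k) ^ (r\<^sup>2 + (r\<^sup>2 + r\<^sup>2))" by (simp only: power_add)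
  also have "r\<^sup>2 + (r\<^sup>2 + r\<^sup>2) = 3 * r\<^sup>2" by simp
  finally have "real (card {l\<in>labels. compatible l Z}) \<le> real (CARD('k) ^ (3 * r\<^sup>2))" by (rule of_nat_mono)
  then show ?thesis by simp
qed

text \<open>On the kernel of \<open>Y\<close>, \<open>Z\<close> and \<open>Z - Y\<close> agree
  modulo the first component, so the value lies in both images and hence in that component. Any
  other vector splits along the two kernels, where \<open>Z\<close> agrees with \<open>Y\<close> or
  vanishes. So \<open>Z\<close> induces a map from the domain modulo the kernel of \<open>Y\<close>
  to the image of \<open>Y\<close>, both of relative dimension the rank of \<open>Y\<close>.\<close>

lemma card_transversal:
  assumes l: "l \<in> labels" and Y: "Y \<in> LX" and r: "rk (label_pair l) Y \<le> D"
  shows "real (card {Z\<in>LX. transversal l (Z - Y) Z}) \<le> real CARD('k) ^ D\<^sup>2 * real (card (NN (label_pair l)))"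
proof -
  let ?p = "label_pair l"
  have p: "?p \<in> pairs" using label_pair_pairs[OF l] by blast
  note s = pairsD[OF p]
  have "{Z\<in>LX. transversal l (Z - Y) Z} \<subseteq> {Z\<in>LX. (\<forall>w\<in>kr ?p Y. Z w \<in> fst ?p) \<and> (\<forall>w\<in>snd ?p. Z w \<in> im ?p Y)}"
  proof
    fix Z assume "Z \<in> {Z\<in>LX. transversal l (Z - Y) Z}"
    then have Z: "Z \<in> LX" and t1: "im ?p (Z - Y) \<inter> im ?p Z \<subseteq> fst ?p"
      and t2: "snd ?p \<subseteq> {k + z | k z. k \<in> kr ?p (Z - Y) \<and> z \<in> kr ?p Z}" by (auto simp: transversal_def)
    have "Z w \<in> fst ?p" if w: "w \<in> kr ?p Y" for w
    proof -
      have wp: "w \<in> snd ?p" "Y w \<in> fst ?p" using w by (auto simp: kr_def)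
      have "(Z - Y) w + Y w \<in> im ?p (Z - Y)" unfolding im_def using wp by blast
      then have "Z w \<in> im ?p (Z - Y)" by simp
      then show ?thesis using t1 im_I[OF p wp(1), of Z] by blast
    qed
    moreover have "Z w \<in> im ?p Y" if w: "w \<in> snd ?p" for w
    proof -
      obtain k z where kz: "w = k + z" "k \<in> kr ?p (Z - Y)" "z \<in> kr ?p Z" using t2 w by blast
      then have k: "k \<in> snd ?p" "Z k - Y k \<in> fst ?p" "Z z \<in> fst ?p" by (auto simp: kr_def)
      have "Z w = Y k + ((Z k - Y k) + Z z)" using kz(1) LX_add[OF Z] by simp
      moreover have "(Z k - Y k) + Z z \<in> fst ?p" using V.subspace_add[OF s(1) k(2,3)] .
      ultimately show ?thesis unfolding im_def using k(1) by blast
    qed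
    ultimately show "Z \<in> {Z\<in>LX. (\<forall>w\<in>kr ?p Y. Z w \<in> fst ?p) \<and> (\<forall>w\<in>snd ?p. Z w \<in> im ?p Y)}" using Z by blast
  qed
  then have "card {Z\<in>LX. transversal l (Z - Y) Z} \<le> card {Z\<in>LX. (\<forall>w\<in>kr ?p Y. Z w \<in> fst ?p) \<and> (\<forall>w\<in>snd ?p. Z w \<in> im ?p Y)}"
    by (rule card_mono[OF finite_LX])
  also have "\<dots> \<le> card (NN (fst ?p, snd ?p)) * CARD('k) ^ ((V.dim (im ?p Y) - V.dim (fst ?p)) * (W.dim (snd ?p) - W.dim (kr ?p Y)))"
    by (intro card_maps_le s subspace_im[OF p Y] subspace_kr[OF p Y] fst_sub_im[OF p Y] kr_sub)
  also have "\<dots> = card (NN ?p) * CARD('k) ^ (rk ?p Y * rk ?p Y)"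
    using rk_im[OF p Y] rk_ker[OF p Y] by simp
  also have "\<dots> \<le> card (NN ?p) * CARD('k) ^ D\<^sup>2"
    unfolding power2_eq_square using r V.card_field_ge_2 by (intro mult_left_mono power_increasing mult_mono) auto
  finally have "real (card {Z\<in>LX. transversal l (Z - Y) Z}) \<le> real (card (NN ?p) * CARD('k) ^ D\<^sup>2)"
    by (rule of_nat_mono)
  then show ?thesis by (simp add: mult.commute)
qed

lemma label_pair_ord:
  assumes l: "l \<in> labels" and X: "X \<in> LX" and r: "rk b X \<le> D" and c: "compatible l X"
  shows "ord (label_pair l) \<le> ord b + 2 * D"
proof -
  obtain U U2 K where lU: "l = (U, U2, K)" by (cases l) auto
  have s: "U \<subseteq> im b X" "kr b X \<subseteq> K" "K \<subseteq> snd b" "fst b \<subseteq> U"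
    using l c by (auto simp: lU labels_def compatible_def kr_def)
  then show ?thesis
    using V.dim_subset[OF s(1)] W.dim_subset[OF s(2)] rk_im[OF b X] rk_ker[OF b X] r
      ord_diff[of b "(U, K)"] by (simp add: lU label_pair_def ple_def)
qed

end

end

context lin_char
begin

text \<open>The exponent collects \<open>12 * D\<^sup>2\<close> for labels compatible with a sum,
  whose rank may be \<open>2 * D\<close>, then \<open>2 * (D + 1) * D\<close> for the squared
  weights, \<open>D\<^sup>2\<close> for transversality and \<open>3 * D\<^sup>2\<close> for labels
  compatible with one map; \<open>18 * D\<^sup>2 + 2 * D\<close> is rounded up.\<close>

lemma fourth_moment_low_rank:
  assumes b: "b \<in> pairs" and T0: "T0 \<in> LT" and supp: "\<And>X. \<lbrakk>X \<in> LX; a X \<noteq> 0\<rbrakk> \<Longrightarrow> rk b X \<le> D"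
    and A: "\<And>p T. \<lbrakk>p \<in> pairs; ple b p; ord p \<le> ord b + 2 * D; T \<in> SS b\<rbrakk> \<Longrightarrow> NS a p (T0 + T) \<le> A"
  shows "mean b (\<lambda>T. (cmod (ev a (T0 + T)))^4) \<le> real CARD('k) ^ (20 * D\<^sup>2) * A * NS a b T0"
proof -
  let ?q = "real CARD('k)"
  have q1: "?q \<ge> 1" using V.card_field_ge_2 by linarith
  have A0: "A \<ge> 0" using A[OF b _ _ S_0[OF b]] NS_nonneg[of a b "T0 + 0"] by simp
  have "mean b (\<lambda>T. (cmod (ev a (T0 + T)))^4) \<le>
    ?q ^ (3 * (2 * D)\<^sup>2) * (?q ^ ((D + 1) * D))\<^sup>2 * ?q ^ D\<^sup>2 * A * ?q ^ (3 * D\<^sup>2) * NS a b T0"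
  proof (rule fourth_moment_le[where \<Lambda>="labels b D" and C="compatible b" and D=transversal and P=label_pair
        and R="{X\<in>LX. rk b X \<le> D}" and \<mu>="weight D", OF b T0 finite_labels[OF b]])
    note lp = label_pair_pairs[OF b]
    fix l assume l: "l \<in> labels b D"
    show "label_pair l \<in> pairs" using lp[OF l] by blast
    show "SS (label_pair l) \<subseteq> SS b" using lp[OF l] unfolding subset_iff SS_iff ple_def by blast
    show "compatible b l Y" if "X \<in> LX" "Y \<in> LX" "Y - X \<in> NN b" "compatible b l X" for X Y
      by (rule compatible_inv[OF b l that])
    show "transversal l X' Z'" if "X \<in> LX" "X' \<in> LX" "Z \<in> LX" "Z' \<in> LX" "X' - X \<in> NN (label_pair l)"
      "Z' - Z \<in> NN (label_pair l)" "transversal l X Z" for X X' Z Z'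
      by (rule transversal_inv[OF b l that(1,2,5) that(3,4,6,7)])
    obtain U U2 K where lU: "l = (U, U2, K)" by (cases l) auto
    show "\<bar>weight D l\<bar> \<le> ?q ^ ((D + 1) * D)"
      using l moebius_bound[of U U2 D] by (simp add: lU weight_def[OF b] labels_def[OF b])
    show "real (card {Z\<in>LX. transversal l (Z - Y) Z}) \<le> ?q ^ D\<^sup>2 * real (card (NN (label_pair l)))"
      if Y: "Y \<in> LX" "Y' \<in> {X\<in>LX. rk b X \<le> D}" "Y' - Y \<in> NN (label_pair l)" for Y Y'
    proof (rule card_transversal[OF b l Y(1)])
      have "rk (label_pair l) Y = rk (label_pair l) Y'" using rk_cong[OF conjunct1[OF lp[OF l]] Y(1) _ Y(3)] Y(2) by simp
      also have "\<dots> \<le> rk b Y'" using lp[OF l] Y(2) by (intro rk_antimono b) auto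
      finally show "rk (label_pair l) Y \<le> D" using Y(2) by simp
    qed
    show "NS a (label_pair l) (T0 + Q) \<le> A"
      if "X \<in> {X\<in>LX. rk b X \<le> D}" "compatible b l X" "Q \<in> SS b" for X Q
      using lp[OF l] label_pair_ord[OF b l _ _ that(2)] that by (intro A) auto
  next
    show "X \<in> {X\<in>LX. rk b X \<le> D}" if "X \<in> LX" "a X \<noteq> 0" for X using supp that by simp
    show "(\<Sum>l\<in>labels b D. of_bool (compatible b l X \<and> compatible b l (X + Y) \<and> transversal l X (X + Y)) * weight D l) = 1"
      if "X \<in> {X\<in>LX. rk b X \<le> D}" "Y \<in> {X\<in>LX. rk b X \<le> D}" for X Y
      using that by (intro label_identity[OF b]) (auto intro: add_LX)
    show "real (card {l\<in>labels b D. compatible b l (X + Y)}) \<le> ?q ^ (3 * (2 * D)\<^sup>2)"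
      if "X \<in> {X\<in>LX. rk b X \<le> D}" "Y \<in> {X\<in>LX. rk b X \<le> D}" for X Y
      using that rk_add[OF b, of X Y] by (intro card_compatible[OF b] add_LX) auto
    show "real (card {l\<in>labels b D. compatible b l X}) \<le> ?q ^ (3 * D\<^sup>2)"
      if "X \<in> {X\<in>LX. rk b X \<le> D}" for X
      using that by (intro card_compatible[OF b]) auto
  qed (use A0 in auto)
  also have "\<dots> = ?q ^ (3 * (2 * D)\<^sup>2 + (D + 1) * D * 2 + D\<^sup>2 + 3 * D\<^sup>2) * (A * NS a b T0)"
    by (simp only: power_add power_mult mult_ac)
  also have "\<dots> \<le> ?q ^ (20 * D\<^sup>2) * (A * NS a b T0)"
  proof (intro mult_right_mono power_increasing q1)
    have "D \<le> D\<^sup>2" by (simp add: power2_eq_square)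
    then show "3 * (2 * D)\<^sup>2 + (D + 1) * D * 2 + D\<^sup>2 + 3 * D\<^sup>2 \<le> 20 * D\<^sup>2"
      by (simp add: power_mult_distrib algebra_simps power2_eq_square)
  qed (use A0 NS_nonneg in auto)
  finally show ?thesis by (simp add: mult.assoc)
qed

end

section \<open>High moments and the level inequality\<close>

context lin_char
begin

text \<open>Fourier inversion sums over frequencies instead of points. The witness is again a
  rank-one map, with \<open>V\<close> and \<open>W\<close> exchanged.\<close>

lemma dual_orthogonality:
  assumes R: "R \<in> LT"
  shows "(\<Sum>X\<in>LX. ee X R) = of_bool (R = 0) * of_nat (card LX)"
proof (cases "R = 0")
  case True
  have "ee X 0 = 1" if "X \<in> LX" for X
    using ee_add_right[OF that zero_LT zero_LT] norm_ee[of X 0] by (metis add_0 mult_cancel_left2 norm_zero zero_neq_one)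
  then show ?thesis using True by simp
next
  case False
  then obtain v where v: "R v \<noteq> 0" by (metis ext zero_fun_apply)
  obtain \<psi> where \<psi>: "W.functional \<psi>" "\<And>u. u \<in> {0} \<Longrightarrow> \<psi> u = 0" "\<psi> (R v) = 1"
    by (rule W.separating_functional[OF W.subspace_single_0, of "R v"]) (use v in simp, rule that)
  interpret \<psi>: Vector_Spaces.linear sW "(*)" \<psi> by fact
  obtain a :: 'k where a: "char_phi pr ex a \<noteq> 1" using char_phi_nontrivial[OF prime_pr card_k] by blast
  define Y where "Y = (\<lambda>w. sV (\<psi> w) (sV a v))"
  have YL: "Y \<in> LX"
    by (simp add: LX_iff Y_def \<psi>.add \<psi>.scale V.scale_left_distrib distrib_left distrib_right mult_ac)
  have lin: "V.functional (\<lambda>x. \<psi> (R x))"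
    unfolding Vector_Spaces.linear_iff using V.vector_space_axioms V.vector_space_over_itself R
    by (simp add: LT_iff \<psi>.add \<psi>.scale)
  have "Y \<circ> R = (\<lambda>x. sV (\<psi> (R x)) (sV a v))" by (rule ext) (simp add: Y_def)
  then have "lin_trace sV (Y \<circ> R) = \<psi> (R (sV a v))" by (simp only: trace_rank_one[OF lin])
  also have "\<dots> = a" using R \<psi>(3) by (simp add: LT_iff \<psi>.scale)
  finally have "ee Y R \<noteq> 1" using a by (simp add: char_u_def)
  moreover have "(\<Sum>X\<in>LX. ee (X + Y) R) = (\<Sum>X\<in>LX. ee X R)"
    by (rule sum_translate[OF YL])
  moreover have "(\<Sum>X\<in>LX. ee (X + Y) R) = (\<Sum>X\<in>LX. ee X R) * ee Y R"
    unfolding sum_distrib_right using YL R by (intro sum.cong refl ee_add_left) auto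
  ultimately have "(\<Sum>X\<in>LX. ee X R) = 0" by (metis mult_cancel_left2)
  then show ?thesis using False by simp
qed

abbreviation bot_pair :: "'v set \<times> 'w set" where "bot_pair \<equiv> ({0}, UNIV)"

lemma bot_pair: "bot_pair \<in> pairs" "SS bot_pair = LT" "NN bot_pair = {0}" "ord bot_pair = 0"
proof -
  show "bot_pair \<in> pairs" by (simp add: pairs_def V.subspace_single_0)
  have "T 0 = 0" if "T \<in> LT" for T
  proof -
    have "T (sV 0 0) = sW 0 (T 0)" using that unfolding LT_iff by blast
    then show ?thesis by simp
  qed
  then show "SS bot_pair = LT" by (auto simp: SS_iff)
  show "NN bot_pair = {0}" by (auto simp: NN_def zero_LX fun_eq_iff)
  show "ord bot_pair = 0" by (simp add: ord_def)
qed

text \<open>The total character sum is counted twice: in one order only \<open>X = 0\<close>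
  contributes, in the other only \<open>T = 0\<close>.\<close>

lemma card_LX_LT: "card LX = card LT"
proof -
  have "(\<Sum>X\<in>LX. \<Sum>T\<in>LT. ee X T) = (\<Sum>X\<in>LX. of_bool (X \<in> NN bot_pair) * of_nat (card LT))"
    using ee_orthogonality[OF bot_pair(1)] bot_pair(2) by simp
  also have "\<dots> = of_nat (card LT)"
    using zero_LX by (simp add: bot_pair(3) of_bool_def sum.delta finite_LX if_distrib if_distribR cong: if_cong)
  finally have 1: "(\<Sum>X\<in>LX. \<Sum>T\<in>LT. ee X T) = of_nat (card LT)" .
  have "(\<Sum>T\<in>LT. \<Sum>X\<in>LX. ee X T) = (\<Sum>T\<in>LT. of_bool (T = 0) * of_nat (card LX))"
    using dual_orthogonality by simp
  also have "\<dots> = of_nat (card LX)"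
    using zero_LT by (simp add: of_bool_def sum.delta finite_LT if_distrib if_distribR cong: if_cong)
  finally have "(\<Sum>T\<in>LT. \<Sum>X\<in>LX. ee X T) = of_nat (card LX)" .
  then have "complex_of_nat (card LX) = of_nat (card LT)" using 1 sum.swap[of ee LT LX] by simp
  then show ?thesis by simp
qed

abbreviation fhat :: "(('v \<Rightarrow> 'w) \<Rightarrow> complex) \<Rightarrow> ('w \<Rightarrow> 'v) \<Rightarrow> complex" where
  "fhat f \<equiv> fourier_coeff pr ex sV sW f"

lemma fourier_inversion:
  assumes T: "T \<in> LT"
  shows "ev (fhat f) T = f T"
proof -
  let ?n = "of_nat (card LT) :: complex"
  have n0: "?n \<noteq> 0" using card_S_pos[OF bot_pair(1)] by (simp add: bot_pair(2))
  have "ev (fhat f) T * ?n = (\<Sum>X\<in>LX. \<Sum>T'\<in>LT. f T' * (cnj (ee X T') * ee X T))"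
    unfolding ev_def fourier_coeff_def L2_inner_def avg_def LT_def[symmetric] sum_distrib_right sum_divide_distrib
    using n0 by (intro sum.cong refl) simp
  also have "\<dots> = (\<Sum>X\<in>LX. \<Sum>T'\<in>LT. f T' * ee X (T - T'))"
  proof (intro sum.cong refl)
    fix X T' assume X: "X \<in> LX" and T': "T' \<in> LT"
    have "ee X T = ee X (T - T') * ee X T'" using ee_add_right[OF X diff_LT[OF T T'] T'] by simp
    moreover have "ee X T' * cnj (ee X T') = 1"
      using norm_ee[of X T'] by (metis complex_norm_square of_real_1 one_power2)
    ultimately show "f T' * (cnj (ee X T') * ee X T) = f T' * ee X (T - T')"
      by (simp add: mult_ac)
  qed
  also have "\<dots> = (\<Sum>T'\<in>LT. f T' * (\<Sum>X\<in>LX. ee X (T - T')))"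
    unfolding sum_distrib_left by (rule sum.swap)
  also have "\<dots> = (\<Sum>T'\<in>LT. if T' = T then f T * ?n else 0)"
    using dual_orthogonality[OF diff_LT[OF T]] card_LX_LT by (intro sum.cong refl) auto
  also have "\<dots> = f T * ?n" using T by (simp add: finite_LT)
  finally show ?thesis using n0 by simp
qed

primrec power_coeff :: "(('w \<Rightarrow> 'v) \<Rightarrow> complex) \<Rightarrow> nat \<Rightarrow> ('w \<Rightarrow> 'v) \<Rightarrow> complex" where
  "power_coeff a 0 = a"
| "power_coeff a (Suc s) = convol (power_coeff a s) (power_coeff a s)"

lemma ev_power_coeff: "T \<in> LT \<Longrightarrow> ev (power_coeff a s) T = ev a T ^ 2 ^ s"
  by (induction s) (simp_all add: ev_convol power_add mult_2)

lemma rk_power_coeff: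
  assumes p: "p \<in> pairs" and a: "\<And>X. \<lbrakk>X \<in> LX; a X \<noteq> 0\<rbrakk> \<Longrightarrow> rk p X \<le> d"
  shows "X \<in> LX \<Longrightarrow> power_coeff a s X \<noteq> 0 \<Longrightarrow> rk p X \<le> 2 ^ s * d"
proof (induction s arbitrary: X)
  case (Suc s)
  then obtain Y where Y: "Y \<in> LX" "power_coeff a s Y \<noteq> 0" "power_coeff a s (X - Y) \<noteq> 0"
    by (auto simp: convol_def elim: sum.not_neutral_contains_not_neutral)
  note YX = diff_LX[OF Suc.prems(1) Y(1)]
  have "rk p X \<le> rk p (X - Y) + rk p Y"
    using rk_add[OF p YX Y(1)] by (simp only: diff_add_cancel)
  also have "\<dots> \<le> 2 ^ s * d + 2 ^ s * d"
    by (intro add_mono Suc.IH[OF YX Y(3)] Suc.IH[OF Y(1,2)])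
  finally show ?case by simp
qed (use a in simp)

lemma SS_LT: "R \<in> SS p \<Longrightarrow> R \<in> LT"
  by (simp add: SS_iff)

text \<open>The fourth moment bound is applied to the power \<open>2 ^ s\<close> of the function, of
  rank at most \<open>2 ^ s * d\<close>. Its right-hand side consists of moments of order
  \<open>2 ^ Suc s\<close>, at \<open>p\<close> and at further restrictions, so the claim is made
  for all \<open>p\<close> above \<open>b\<close> at once. The constant solves
  \<open>4 * 10 = 20 + 2 * 10\<close>, and \<open>2 ^ Suc s * d\<close> leaves room for the orders
  added by the remaining squarings.\<close>

lemma moment_bound:
  assumes b: "b \<in> pairs" and T0: "T0 \<in> LT" and supp: "\<And>X. \<lbrakk>X \<in> LX; a X \<noteq> 0\<rbrakk> \<Longrightarrow> rk b X \<le> d"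
    and \<delta>: "\<And>p T. \<lbrakk>p \<in> pairs; ple b p; ord p \<le> ord b + m; T \<in> SS b\<rbrakk> \<Longrightarrow> NS a p (T0 + T) \<le> \<delta>"
    and p: "p \<in> pairs" "ple b p" "ord p + 2 ^ Suc s * d \<le> ord b + m" and T: "T \<in> SS b"
  shows "mean p (\<lambda>R. cmod (ev a (T0 + T + R)) ^ 2 ^ Suc s)
    \<le> real CARD('k) ^ (10 * 4 ^ s * d\<^sup>2) * \<delta> ^ (2 ^ s - 1) * NS a p (T0 + T)"
  using p T
proof (induction s arbitrary: p T)
  case 0
  have TT: "T0 + T \<in> LT" by (rule add_LT[OF T0 SS_LT[OF 0(4)]])
  have e: "mean p (\<lambda>R. cmod (ev a (T0 + T + R)) ^ 2 ^ Suc 0) = NS a p (T0 + T)"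
    unfolding NS_eq_mean[OF 0(1) TT] power_Suc0_right ..
  have "1 \<le> real CARD('k) ^ (10 * 4 ^ 0 * d\<^sup>2)" using V.card_field_ge_2 by (intro one_le_power) linarith
  then have "1 * NS a p (T0 + T) \<le> real CARD('k) ^ (10 * 4 ^ 0 * d\<^sup>2) * NS a p (T0 + T)"
    by (intro mult_right_mono NS_nonneg)
  moreover have "\<delta> ^ (2 ^ 0 - 1) = 1" by simp
  ultimately show ?case unfolding e by (simp only: mult_1_left mult_1_right)
next
  case (Suc s)
  let ?q = "real CARD('k)" and ?a = "power_coeff a s"
  have TT: "T0 + T \<in> LT" by (rule add_LT[OF T0 SS_LT[OF Suc.prems(4)]])
  have Sp: "SS p \<subseteq> SS b" using Suc.prems(2) unfolding subset_iff SS_iff ple_def by blast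
  have NSs: "NS ?a p' T' = mean p' (\<lambda>R. cmod (ev a (T' + R)) ^ 2 ^ Suc s)" if p': "p' \<in> pairs" and T': "T' \<in> LT" for p' T'
    unfolding NS_eq_mean[OF p' T']
  proof (rule mean_cong)
    fix R assume "R \<in> SS p'"
    then have "T' + R \<in> LT" by (intro add_LT[OF T'] SS_LT)
    then show "(cmod (ev ?a (T' + R)))\<^sup>2 = cmod (ev a (T' + R)) ^ 2 ^ Suc s"
      by (simp only: ev_power_coeff norm_power power_mult[symmetric] power_Suc mult.commute)
  qed
  have \<delta>0: "\<delta> \<ge> 0"
  proof -
    have "NS a p (T0 + T) \<le> \<delta>" using Suc.prems by (intro \<delta>) auto
    then show ?thesis using NS_nonneg[of a p "T0 + T"] by linarith
  qed
  let ?K = "?q ^ (10 * 4 ^ s * d\<^sup>2) * \<delta> ^ (2 ^ s - 1)"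
  have K0: "?K \<ge> 0" using \<delta>0 by simp
  have "mean p (\<lambda>R. cmod (ev a (T0 + T + R)) ^ 2 ^ Suc (Suc s)) = mean p (\<lambda>R. (cmod (ev ?a (T0 + T + R)))^4)"
  proof (rule mean_cong)
    fix R assume "R \<in> SS p"
    then have R: "T0 + T + R \<in> LT" by (intro add_LT[OF TT] SS_LT)
    have "2 ^ Suc (Suc s) = 2 ^ s * (4 :: nat)" by simp
    then show "cmod (ev a (T0 + T + R)) ^ 2 ^ Suc (Suc s) = (cmod (ev ?a (T0 + T + R)))^4"
      by (simp only: ev_power_coeff[OF R] norm_power power_mult)
  qed
  also have "\<dots> \<le> ?q ^ (20 * (2 ^ s * d)\<^sup>2) * (?K * \<delta>) * NS ?a p (T0 + T)"
  proof (rule fourth_moment_low_rank[OF Suc.prems(1) TT])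
    show "rk p X \<le> 2 ^ s * d" if "X \<in> LX" "?a X \<noteq> 0" for X
    proof (rule rk_power_coeff[OF Suc.prems(1) _ that])
      fix X assume "X \<in> LX" "a X \<noteq> 0"
      then show "rk p X \<le> d" using supp rk_antimono(1)[OF b Suc.prems(1,2)] by (meson order_trans)
    qed
    fix p' T' assume p': "p' \<in> pairs" "ple p p'" "ord p' \<le> ord p + 2 * (2 ^ s * d)" and T': "T' \<in> SS p"
    have T'b: "T + T' \<in> SS b" using SS_add[OF b Suc.prems(4)] T' Sp by blast
    have TT': "T0 + (T + T') \<in> LT" by (rule add_LT[OF T0 SS_LT[OF T'b]])
    have bp': "ple b p'" by (rule ple_trans[OF Suc.prems(2) p'(2)])
    have "ord p' + 2 ^ Suc s * d \<le> ord b + m" "ord p' \<le> ord b + m"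
      using p'(3) Suc.prems(3) by simp_all
    note o = this
    have "NS ?a p' (T0 + T + T') = mean p' (\<lambda>R. cmod (ev a (T0 + (T + T') + R)) ^ 2 ^ Suc s)"
      unfolding add.assoc[of T0 T T'] by (rule NSs[OF p'(1) TT'])
    also have "\<dots> \<le> ?K * NS a p' (T0 + (T + T'))"
      by (rule Suc.IH[OF p'(1) bp' o(1) T'b])
    also have "\<dots> \<le> ?K * \<delta>"
      by (intro mult_left_mono \<delta> K0 p'(1) bp' o(2) T'b)
    finally show "NS ?a p' (T0 + T + T') \<le> ?K * \<delta>" .
  qed
  also have "\<dots> \<le> ?q ^ (20 * (2 ^ s * d)\<^sup>2) * (?K * \<delta>) * (?K * NS a p (T0 + T))"
    unfolding NSs[OF Suc.prems(1) TT] using Suc.prems(3) K0 \<delta>0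
    by (intro mult_left_mono Suc.IH[OF Suc.prems(1,2) _ Suc.prems(4)] mult_nonneg_nonneg) simp_all
  also have "\<dots> = (?q ^ (20 * (2 ^ s * d)\<^sup>2) * ?q ^ (10 * 4 ^ s * d\<^sup>2) * ?q ^ (10 * 4 ^ s * d\<^sup>2)) *
      (\<delta> ^ (2 ^ s - 1) * \<delta> * \<delta> ^ (2 ^ s - 1)) * NS a p (T0 + T)"
    by (simp only: mult_ac)
  also have "?q ^ (20 * (2 ^ s * d)\<^sup>2) * ?q ^ (10 * 4 ^ s * d\<^sup>2) * ?q ^ (10 * 4 ^ s * d\<^sup>2) = ?q ^ (10 * 4 ^ Suc s * d\<^sup>2)"
  proof -
    have "(4 :: nat) ^ s = (2 ^ s)\<^sup>2" by (simp add: power2_eq_square flip: power_mult_distrib)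
    then have "20 * (2 ^ s * d)\<^sup>2 + 10 * 4 ^ s * d\<^sup>2 + 10 * 4 ^ s * d\<^sup>2 = 10 * 4 ^ Suc s * d\<^sup>2"
      by (simp add: power_mult_distrib)
    then show ?thesis by (simp only: power_add[symmetric])
  qed
  also have "\<delta> ^ (2 ^ s - 1) * \<delta> * \<delta> ^ (2 ^ s - 1) = \<delta> ^ (2 ^ Suc s - 1)"
  proof -
    have "(2 ^ s - 1) + 1 + (2 ^ s - 1) = (2 :: nat) ^ Suc s - 1"
      using one_le_power[of "2 :: nat" s] by simp
    then show ?thesis by (metis power_add power_one_right)
  qed
  finally show ?case .
qed

lemma mean_cauchy_schwarz:
  assumes p: "p \<in> pairs"
  shows "(mean p (\<lambda>R. F R * G R))\<^sup>2 \<le> mean p (\<lambda>R. (F R)\<^sup>2) * mean p (\<lambda>R. (G R)\<^sup>2)"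
proof -
  have "(\<Sum>R\<in>SS p. F R * G R)\<^sup>2 \<le> (\<Sum>R\<in>SS p. (F R)\<^sup>2) * (\<Sum>R\<in>SS p. (G R)\<^sup>2)"
    by (rule Cauchy_Schwarz_ineq_sum)
  then show ?thesis unfolding mean_def
    by (simp add: power_divide power2_eq_square divide_right_mono)
qed

text \<open>As \<open>F = F * F\<close>, one copy of \<open>F\<close> stays with \<open>G\<close> at
  every Cauchy-Schwarz, and each squaring pays with the mean of the other copy.\<close>

lemma mean_power_le:
  assumes p: "p \<in> pairs" and F: "\<And>R. R \<in> SS p \<Longrightarrow> F R \<in> {0, 1}"
  shows "(\<And>R. R \<in> SS p \<Longrightarrow> G R \<ge> 0) \<Longrightarrow>
    (mean p (\<lambda>R. F R * G R)) ^ 2 ^ s \<le> mean p F ^ (2 ^ s - 1) * mean p (\<lambda>R. F R * G R ^ 2 ^ s)"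
proof (induction s arbitrary: G)
  case (Suc s)
  have FF: "F R * F R = F R" and F0: "F R \<ge> 0" if "R \<in> SS p" for R using F[OF that] by auto
  have mF: "mean p F \<ge> 0" using F0 by (rule mean_nonneg)
  have "(mean p (\<lambda>R. F R * G R))\<^sup>2 = (mean p (\<lambda>R. F R * (F R * G R)))\<^sup>2"
    by (intro arg_cong[where f="\<lambda>x. x\<^sup>2"] mean_cong) (simp only: mult.assoc[symmetric] FF)
  also have "\<dots> \<le> mean p (\<lambda>R. (F R)\<^sup>2) * mean p (\<lambda>R. (F R * G R)\<^sup>2)"
    by (rule mean_cauchy_schwarz[OF p])
  also have "mean p (\<lambda>R. (F R)\<^sup>2) = mean p F" by (rule mean_cong) (simp only: power2_eq_square FF)
  also have "mean p (\<lambda>R. (F R * G R)\<^sup>2) = mean p (\<lambda>R. F R * (G R)\<^sup>2)"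
    by (rule mean_cong) (simp only: power_mult_distrib power2_eq_square[of "F _"] FF)
  finally have "((mean p (\<lambda>R. F R * G R))\<^sup>2) ^ 2 ^ s \<le> (mean p F * mean p (\<lambda>R. F R * (G R)\<^sup>2)) ^ 2 ^ s"
    by (rule power_mono) simp
  also have "\<dots> \<le> mean p F ^ 2 ^ s * (mean p F ^ (2 ^ s - 1) * mean p (\<lambda>R. F R * ((G R)\<^sup>2) ^ 2 ^ s))"
    unfolding power_mult_distrib by (rule mult_left_mono[OF Suc.IH zero_le_power[OF mF]]) simp
  also have "\<dots> = mean p F ^ (2 ^ s + (2 ^ s - 1)) * mean p (\<lambda>R. F R * G R ^ 2 ^ Suc s)"
    by (simp only: power_add power_mult[symmetric] power_Suc mult.assoc)
  also have "2 ^ s + (2 ^ s - 1) = (2 :: nat) ^ Suc s - 1"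
    using one_le_power[of "2 :: nat" s] by simp
  finally show ?case by (simp only: power_mult[symmetric] power_Suc)
qed simp

text \<open>Here \<open>x\<close> is the weight, \<open>\<mu>\<close> the mean of \<open>f\<close>,
  and \<open>e\<close> is \<open>\<epsilon>\<close> to the power \<open>1 - 1 / t\<close>, encoded
  by \<open>e ^ t = \<epsilon> ^ (t - 1)\<close> so that only integral powers occur. One factor
  \<open>x\<close> is cancelled, then the two entries of \<open>\<Delta>\<close> are treated
  separately.\<close>

lemma real_level_arith:
  fixes x y \<mu> e \<epsilon> q \<Delta> :: real and t d :: nat
  assumes q: "q \<ge> 1" and x: "x \<ge> 0" and \<mu>: "\<mu> \<ge> 0" "\<mu> \<le> \<epsilon>" and e: "e \<ge> 0" "e ^ t = \<epsilon> ^ (t - 1)"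
    and t: "t \<ge> 1"
    and \<Delta>: "\<Delta> = max x (q ^ (920 * (d - 1)\<^sup>2 * t) * (\<epsilon> * e))"
    and main: "x ^ (2 * t) \<le> \<mu> ^ (2 * t - 1) * (q ^ (10 * t\<^sup>2 * d\<^sup>2) * (q ^ (16 * t * d\<^sup>2) * \<Delta>) ^ (t - 1) * x)"
  shows "x \<le> q ^ (920 * d\<^sup>2 * t) * \<mu> * e"
proof (cases "x = 0")
  case True
  then show ?thesis using q \<mu> e by simp
next
  case False
  then have x0: "x > 0" using x by simp
  have "x ^ (2 * t - 1) * x \<le> (\<mu> ^ (2 * t - 1) * (q ^ (10 * t\<^sup>2 * d\<^sup>2) * (q ^ (16 * t * d\<^sup>2) * \<Delta>) ^ (t - 1))) * x"
  proof -
    have "x ^ (2 * t) = x ^ (2 * t - 1) * x" using t power_minus_mult[of "2 * t" x] by simp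
    then show ?thesis using main by (simp only: mult.assoc)
  qed
  then have "x ^ (2 * t - 1) \<le> \<mu> ^ (2 * t - 1) * (q ^ (10 * t\<^sup>2 * d\<^sup>2) * (q ^ (16 * t * d\<^sup>2) * \<Delta>) ^ (t - 1))"
    using x0 by (simp only: mult_le_cancel_right_pos)
  also have "\<dots> = \<mu> ^ (2 * t - 1) * (q ^ (10 * t\<^sup>2 * d\<^sup>2 + 16 * t * d\<^sup>2 * (t - 1)) * \<Delta> ^ (t - 1))"
    by (simp only: power_mult_distrib power_mult[symmetric] power_add mult.assoc)
  also have "\<dots> \<le> \<mu> ^ (2 * t - 1) * (q ^ (26 * t\<^sup>2 * d\<^sup>2) * \<Delta> ^ (t - 1))"
  proof (intro mult_left_mono mult_right_mono power_increasing q)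
    have "16 * t * d\<^sup>2 * (t - 1) \<le> 16 * t * d\<^sup>2 * t" by (intro mult_left_mono) auto
    then show "10 * t\<^sup>2 * d\<^sup>2 + 16 * t * d\<^sup>2 * (t - 1) \<le> 26 * t\<^sup>2 * d\<^sup>2" by (simp add: power2_eq_square)
  qed (use \<mu> x \<Delta> in auto)
  finally have key: "x ^ (2 * t - 1) \<le> \<mu> ^ (2 * t - 1) * (q ^ (26 * t\<^sup>2 * d\<^sup>2) * \<Delta> ^ (t - 1))" .
  let ?y = "q ^ (920 * d\<^sup>2 * t) * \<mu> * e"
  have y0: "?y \<ge> 0" using q \<mu> e by simp
  have \<epsilon>0: "\<epsilon> \<ge> 0" using \<mu> by linarith
  have exp26: "26 * t\<^sup>2 * d\<^sup>2 \<le> 920 * d\<^sup>2 * t * t"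
  proof -
    have "26 * t\<^sup>2 * d\<^sup>2 \<le> 920 * (t\<^sup>2 * d\<^sup>2)" by simp
    also have "\<dots> = 920 * d\<^sup>2 * t * t" by (simp add: power2_eq_square)
    finally show ?thesis .
  qed
  show ?thesis
  proof (cases "q ^ (920 * (d - 1)\<^sup>2 * t) * (\<epsilon> * e) \<le> x")
    \<comment> \<open>The weight itself is the maximum: \<open>x ^ (t - 1)\<close> is cancelled,
      \<open>\<mu> ^ (t - 1)\<close> is bounded by \<open>\<epsilon> ^ (t - 1) = e ^ t\<close>, and
      a \<open>t\<close>-th root is taken.\<close>
    case True
    then have D: "\<Delta> = x" using \<Delta> by simp
    have t21: "2 * t - 1 = t + (t - 1)" using t by simp
    have "x ^ t * x ^ (t - 1) \<le> (\<mu> ^ (2 * t - 1) * q ^ (26 * t\<^sup>2 * d\<^sup>2)) * x ^ (t - 1)"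
      using key unfolding D t21 by (simp only: power_add mult.assoc)
    then have "x ^ t \<le> \<mu> ^ (2 * t - 1) * q ^ (26 * t\<^sup>2 * d\<^sup>2)"
      using x0 by (simp only: mult_le_cancel_right_pos zero_less_power)
    also have "\<dots> = \<mu> ^ t * \<mu> ^ (t - 1) * q ^ (26 * t\<^sup>2 * d\<^sup>2)" unfolding t21 power_add ..
    also have "\<dots> \<le> \<mu> ^ t * \<epsilon> ^ (t - 1) * q ^ (920 * d\<^sup>2 * t * t)"
    proof (rule mult_mono)
      show "\<mu> ^ t * \<mu> ^ (t - 1) \<le> \<mu> ^ t * \<epsilon> ^ (t - 1)"
        by (rule mult_left_mono[OF power_mono[OF \<mu>(2,1)] zero_le_power[OF \<mu>(1)]])
      show "q ^ (26 * t\<^sup>2 * d\<^sup>2) \<le> q ^ (920 * d\<^sup>2 * t * t)"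
        by (rule power_increasing[OF exp26 q])
    qed (use q \<mu> \<epsilon>0 in auto)
    also have "\<dots> = ?y ^ t"
      unfolding e(2)[symmetric] power_mult_distrib power_mult[symmetric] by (simp only: mult_ac)
    finally show ?thesis using x y0 t by (simp add: power_mono_iff)
  next
    case False
    then have D: "\<Delta> = q ^ (920 * (d - 1)\<^sup>2 * t) * (\<epsilon> * e)" using \<Delta> by simp
    \<comment> \<open>The bound for lower levels turns into exactly the power of \<open>e\<close>
      that the \<open>(2 * t - 1)\<close>-th root requires.\<close>
    have ee: "(\<epsilon> * e) ^ (t - 1) = e ^ (2 * t - 1)"
    proof -
      have "2 * t - 1 = t + (t - 1)" using t by simp
      then show ?thesis by (simp only: power_mult_distrib power_add e(2))
    qed
    have "\<Delta> ^ (t - 1) = (q ^ (920 * (d - 1)\<^sup>2 * t)) ^ (t - 1) * (\<epsilon> * e) ^ (t - 1)"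
      unfolding D by (rule power_mult_distrib)
    also have "\<dots> = q ^ (920 * (d - 1)\<^sup>2 * t * (t - 1)) * e ^ (2 * t - 1)"
      unfolding ee power_mult[symmetric] ..
    finally have \<Delta>_pow: "\<Delta> ^ (t - 1) = q ^ (920 * (d - 1)\<^sup>2 * t * (t - 1)) * e ^ (2 * t - 1)" .
    have "x ^ (2 * t - 1) \<le> \<mu> ^ (2 * t - 1) * (q ^ (26 * t\<^sup>2 * d\<^sup>2 + 920 * (d - 1)\<^sup>2 * t * (t - 1)) * e ^ (2 * t - 1))"
      using key unfolding \<Delta>_pow by (simp only: power_add mult.assoc)
    also have "\<dots> \<le> \<mu> ^ (2 * t - 1) * (q ^ (920 * d\<^sup>2 * t * (2 * t - 1)) * e ^ (2 * t - 1))"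
    proof (intro mult_left_mono mult_right_mono power_increasing q)
      have "(d - 1)\<^sup>2 \<le> d\<^sup>2" by (intro power_mono) auto
      then have "920 * (d - 1)\<^sup>2 * t * (t - 1) \<le> 920 * d\<^sup>2 * t * (t - 1)" by (intro mult_right_mono mult_left_mono) auto
      moreover note exp26
      moreover have "2 * t - 1 = t + (t - 1)" using t by simp
      ultimately show "26 * t\<^sup>2 * d\<^sup>2 + 920 * (d - 1)\<^sup>2 * t * (t - 1) \<le> 920 * d\<^sup>2 * t * (2 * t - 1)"
        by (simp only: distrib_left)
    qed (use \<mu> e in auto)
    also have "\<dots> = ?y ^ (2 * t - 1)"
      unfolding power_mult_distrib power_mult[symmetric] by (simp only: mult_ac)
    finally show ?thesis using x y0 t by (simp add: power_mono_iff)
  qed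
qed

text \<open>Strong induction on the level, for all base pairs \<open>b\<close> at once, since a
  lower level is needed at pairs finer than \<open>b\<close>. Order plus level never grows in the
  reduction, so every mean of \<open>f\<close> that arises stays within the range of
  globalness.\<close>

lemma level_inequality:
  fixes f :: "('v \<Rightarrow> 'w) \<Rightarrow> complex" and \<epsilon> :: real
  assumes bool: "\<And>T. T \<in> LT \<Longrightarrow> f T \<in> {0, 1}"
    and glob: "\<And>p T. \<lbrakk>p \<in> pairs; T \<in> LT; ord p \<le> d0\<rbrakk> \<Longrightarrow> mean p (\<lambda>R. Re (f (T + R))) \<le> \<epsilon>"
    and e: "e \<ge> 0" "e ^ 2 ^ s = \<epsilon> ^ (2 ^ s - 1)" and \<epsilon>: "\<epsilon> > 0"
  shows "\<lbrakk>b \<in> pairs; T0 \<in> LT; ord b + d \<le> d0\<rbrakk> \<Longrightarrow>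
    NS (level_part (fhat f) b d) b T0 \<le> real CARD('k) ^ (920 * d\<^sup>2 * 2 ^ s) * mean b (\<lambda>R. Re (f (T0 + R))) * e"
proof (induction d arbitrary: b T0 rule: less_induct)
  case (less d)
  let ?q = "real CARD('k)" and ?a = "level_part (fhat f) b d"
  define t :: nat where "t = 2 ^ s"
  have t1: "t \<ge> 1" by (simp add: t_def)
  note b = less.prems(1) and T0 = less.prems(2)
  have q1: "?q \<ge> 1" using V.card_field_ge_2 by linarith
  define F where "F = (\<lambda>R. Re (f (T0 + R)))"
  define G where "G = (\<lambda>R. cmod (ev ?a (T0 + R)))"
  define x where "x = NS ?a b T0"
  define \<mu> where "\<mu> = mean b F"
  \<comment> \<open>The second entry covers all levels below \<open>d\<close>. For
    \<open>d = 0\<close> the truncated \<open>d - 1\<close> does no harm, as there are no such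
    levels.\<close>
  define \<Delta> where "\<Delta> = max x (?q ^ (920 * (d - 1)\<^sup>2 * t) * (\<epsilon> * e))"
  have TR: "T0 + R \<in> LT" if "R \<in> SS b" for R by (rule add_LT[OF T0 SS_LT[OF that]])
  have F01: "F R \<in> {0, 1}" and fF: "f (T0 + R) = of_real (F R)" if "R \<in> SS b" for R
    using bool[OF TR[OF that]] by (auto simp: F_def)
  have \<mu>0: "\<mu> \<ge> 0" unfolding \<mu>_def using F01 by (intro mean_nonneg) fastforce
  have \<mu>\<epsilon>: "\<mu> \<le> \<epsilon>" unfolding \<mu>_def F_def using less.prems(3) by (intro glob b T0) simp
  have x0: "x \<ge> 0" unfolding x_def by (rule NS_nonneg)
  \<comment> \<open>The weight of \<open>g\<close> is the inner product of \<open>f\<close> and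
    \<open>g\<close>: in Parseval the classes of rank other than \<open>d\<close> drop out.\<close>
  have xFG: "x \<le> mean b (\<lambda>R. F R * G R)"
  proof -
    have eq: "(\<Sum>X\<in>LX. coset_sum (fhat f) b X T0 * cnj (coset_sum ?a b X T0)) =
      (\<Sum>X\<in>LX. coset_sum ?a b X T0 * cnj (coset_sum ?a b X T0))"
    proof (rule sum.cong[OF refl])
      fix X assume X: "X \<in> LX"
      show "coset_sum (fhat f) b X T0 * cnj (coset_sum ?a b X T0) = coset_sum ?a b X T0 * cnj (coset_sum ?a b X T0)"
        unfolding coset_sum_level_part[OF b X]
        by (simp only: of_bool_def if_distrib[of cnj] complex_cnj_mult complex_cnj_one complex_cnj_zero
            mult_1_left mult_zero_left mult_zero_right simp_thms split: if_split)
    qed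
    have "complex_of_real x = (\<Sum>X\<in>LX. coset_sum ?a b X T0 * cnj (coset_sum ?a b X T0)) / of_nat (card (NN b))"
      by (simp only: x_def NS_def of_real_divide of_real_sum of_real_of_nat_eq complex_norm_square)
    also have "\<dots> = (\<Sum>R\<in>SS b. ev (fhat f) (T0 + R) * cnj (ev ?a (T0 + R))) / of_nat (card (SS b))"
      unfolding parseval_inner[OF b T0] eq ..
    also have "(\<Sum>R\<in>SS b. ev (fhat f) (T0 + R) * cnj (ev ?a (T0 + R))) = (\<Sum>R\<in>SS b. of_real (F R) * cnj (ev ?a (T0 + R)))"
      by (intro sum.cong refl) (simp only: fourier_inversion[OF TR] fF)
    finally have xE: "complex_of_real x = (\<Sum>R\<in>SS b. of_real (F R) * cnj (ev ?a (T0 + R))) / of_nat (card (SS b))" .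
    have "x = cmod (complex_of_real x)" using x0 by simp
    also have "\<dots> = cmod (\<Sum>R\<in>SS b. of_real (F R) * cnj (ev ?a (T0 + R))) / real (card (SS b))"
      unfolding xE by (simp only: norm_divide norm_of_nat)
    also have "\<dots> \<le> (\<Sum>R\<in>SS b. F R * G R) / real (card (SS b))"
    proof (intro divide_right_mono order_trans[OF norm_sum] sum_mono)
      fix R assume "R \<in> SS b"
      then have "\<bar>F R\<bar> = F R" using F01 by fastforce
      then show "cmod (of_real (F R) * cnj (ev ?a (T0 + R))) \<le> F R * G R"
        unfolding G_def by (simp only: norm_mult norm_of_real complex_mod_cnj)
    qed simp
    finally show ?thesis unfolding mean_def .
  qed
  have supp: "rk b X \<le> d" if "?a X \<noteq> 0" for X using that by (auto simp: level_part_def)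
  \<comment> \<open>\<open>16 * t * d\<^sup>2\<close> absorbs the exponent
    \<open>5 * d * M + 2 * d\<^sup>2 + 3 * d\<close> of \<open>order_reduction\<close> for
    \<open>M = 2 * t * d\<close>, the order up to which the moment bound asks for
    restrictions.\<close>
  let ?\<delta> = "?q ^ (16 * t * d\<^sup>2) * \<Delta>"
  have \<delta>: "NS ?a p (T0 + T) \<le> ?\<delta>"
    if p: "p \<in> pairs" "ple b p" "ord p \<le> ord b + 2 * t * d" and T: "T \<in> SS b" for p T
  proof -
    have TT: "T0 + T \<in> LT" by (rule TR[OF T])
    have "NS ?a p (T0 + T) \<le> ?q ^ (5 * d * (2 * t * d) + 2 * d\<^sup>2 + 3 * d) * \<Delta>"
    proof (rule order_reduction[OF b p(1,2) TT p(3)])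
      fix p' r assume p': "p' \<in> pairs" "ple b p'" "ple p' p" "ord p' + r \<le> ord b + d"
      show "NS (level_part (fhat f) p' r) p' (T0 + T) \<le> \<Delta>"
      proof (cases "r < d")
        case True
        have o: "ord p' + r \<le> d0" using p'(4) less.prems(3) by linarith
        have m: "mean p' (\<lambda>R. Re (f (T0 + T + R))) \<le> \<epsilon>" using o by (intro glob p'(1) TT) simp
        have "NS (level_part (fhat f) p' r) p' (T0 + T) \<le> ?q ^ (920 * r\<^sup>2 * 2 ^ s) * mean p' (\<lambda>R. Re (f (T0 + T + R))) * e"
          by (rule less.IH[OF True p'(1) TT o])
        also have "\<dots> \<le> ?q ^ (920 * r\<^sup>2 * 2 ^ s) * \<epsilon> * e"
          using m e by (intro mult_right_mono mult_left_mono) auto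
        also have "\<dots> \<le> ?q ^ (920 * (d - 1)\<^sup>2 * t) * \<epsilon> * e"
        proof (intro mult_right_mono power_increasing q1)
          have "r\<^sup>2 \<le> (d - 1)\<^sup>2" using True by (intro power_mono) auto
          then show "920 * r\<^sup>2 * 2 ^ s \<le> 920 * (d - 1)\<^sup>2 * t" by (simp add: t_def)
        qed (use e \<epsilon> in auto)
        finally show ?thesis by (simp add: \<Delta>_def mult.assoc)
      next
        \<comment> \<open>Level \<open>d\<close> uses up the whole budget, so \<open>p'\<close> has
          the order of \<open>b\<close> and equals \<open>b\<close>. Translation by \<open>T\<close>
          in \<open>SS b\<close> does not change the norm, which is \<open>x\<close>.\<close>
        case False
        then have "r = d" "ord p' \<le> ord b" using p'(4) ord_mono[OF p'(2)] by linarith+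
        then have "p' = b" using ple_ord_eq[OF b p'(1,2)] by simp
        then show ?thesis using NS_translate[OF b T0 T, of ?a] \<open>r = d\<close> by (simp only: \<Delta>_def x_def max.cobounded1)
      qed
    qed (use x0 in \<open>simp add: \<Delta>_def\<close>)
    also have "\<dots> \<le> ?\<delta>"
    proof (intro mult_right_mono power_increasing q1)
      have d: "d \<le> d\<^sup>2" by (simp add: power2_eq_square)
      have "d\<^sup>2 \<le> t * d\<^sup>2" using t1 by simp
      then have e2: "2 * d\<^sup>2 + 3 * d \<le> 6 * (t * d\<^sup>2)" using d by linarith
      have e1: "5 * d * (2 * t * d) = 10 * (t * d\<^sup>2)" by (simp add: power2_eq_square)
      show "5 * d * (2 * t * d) + 2 * d\<^sup>2 + 3 * d \<le> 16 * t * d\<^sup>2"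
        unfolding e1 mult.assoc[of 16] using e2 by linarith
    qed (use x0 in \<open>simp add: \<Delta>_def\<close>)
    finally show ?thesis .
  qed
  have G0: "G R \<ge> 0" for R by (simp add: G_def)
  have mom: "mean b (\<lambda>R. G R ^ 2 ^ Suc s) \<le> ?q ^ (10 * t\<^sup>2 * d\<^sup>2) * ?\<delta> ^ (t - 1) * x"
  proof -
    have "mean b (\<lambda>R. cmod (ev ?a (T0 + 0 + R)) ^ 2 ^ Suc s)
      \<le> ?q ^ (10 * 4 ^ s * d\<^sup>2) * ?\<delta> ^ (2 ^ s - 1) * NS ?a b (T0 + 0)"
    proof (rule moment_bound[where m="2 * t * d", OF b T0 _ _ b ple_refl _ S_0[OF b]])
      show "ord b + 2 ^ Suc s * d \<le> ord b + 2 * t * d" by (simp add: t_def)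
    qed (use supp \<delta> in auto)
    moreover have "(4 :: nat) ^ s = t\<^sup>2" by (simp add: t_def power2_eq_square flip: power_mult_distrib)
    ultimately show ?thesis unfolding G_def x_def by (simp only: t_def[symmetric] add_0_right)
  qed
  have "x ^ (2 * t) \<le> (mean b (\<lambda>R. F R * G R)) ^ (2 * t)" by (rule power_mono[OF xFG x0])
  also have "2 * t = 2 ^ Suc s" by (simp add: t_def)
  also have "(mean b (\<lambda>R. F R * G R)) ^ 2 ^ Suc s \<le> \<mu> ^ (2 ^ Suc s - 1) * mean b (\<lambda>R. F R * G R ^ 2 ^ Suc s)"
    unfolding \<mu>_def by (rule mean_power_le[OF b F01 G0])
  also have "\<dots> \<le> \<mu> ^ (2 ^ Suc s - 1) * mean b (\<lambda>R. G R ^ 2 ^ Suc s)"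
  proof (intro mult_left_mono mean_mono zero_le_power \<mu>0)
    fix R assume "R \<in> SS b"
    then have "F R \<le> 1" using F01 by fastforce
    then show "F R * G R ^ 2 ^ Suc s \<le> G R ^ 2 ^ Suc s"
      using mult_right_mono[of "F R" 1 "G R ^ 2 ^ Suc s"] zero_le_power[OF G0] by (simp only: mult_1_left)
  qed
  also have "\<dots> \<le> \<mu> ^ (2 ^ Suc s - 1) * (?q ^ (10 * t\<^sup>2 * d\<^sup>2) * ?\<delta> ^ (t - 1) * x)"
    by (intro mult_left_mono mom zero_le_power \<mu>0)
  finally have main: "x ^ (2 * t) \<le> \<mu> ^ (2 * t - 1) * (?q ^ (10 * t\<^sup>2 * d\<^sup>2) * ?\<delta> ^ (t - 1) * x)"
    by (simp only: t_def power_Suc)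
  have "x \<le> ?q ^ (920 * d\<^sup>2 * t) * \<mu> * e"
    by (rule real_level_arith[OF q1 x0 \<mu>0 \<mu>\<epsilon> e(1) _ t1 \<Delta>_def main]) (use e(2) t_def in simp)
  then show ?case unfolding x_def \<mu>_def F_def t_def .
qed

end

section \<open>From norms at pairs to the stated inequality\<close>

lemma L2_norm_power2: "(L2_norm A g)\<^sup>2 = (\<Sum>x\<in>A. (cmod (g x))\<^sup>2) / real (card A)"
proof -
  have "L2_inner A g g = complex_of_real ((\<Sum>x\<in>A. (cmod (g x))\<^sup>2) / real (card A))"
    unfolding L2_inner_def avg_def
    by (simp only: of_real_divide of_real_sum of_real_of_nat_eq complex_norm_square)
  then have "Re (L2_inner A g g) = (\<Sum>x\<in>A. (cmod (g x))\<^sup>2) / real (card A)"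
    by (simp only: Re_complex_of_real)
  moreover have "(\<Sum>x\<in>A. (cmod (g x))\<^sup>2) / real (card A) \<ge> 0"
    by (intro divide_nonneg_nonneg sum_nonneg) auto
  ultimately show ?thesis unfolding L2_norm_def by simp
qed

context lin_char
begin

lemma rk_bot: assumes X: "X \<in> LX" shows "rk bot_pair X = lin_rank sV X"
proof -
  have "im bot_pair X = range X" by (auto simp: im_def)
  then show ?thesis using rk_im[OF bot_pair(1) X] by (simp add: lin_rank_def)
qed

lemma degree_part_eq_ev: "degree_part pr ex sV sW d f A = ev (level_part (fhat f) bot_pair d) A"
proof -
  have "ev (level_part (fhat f) bot_pair d) A = (\<Sum>X\<in>LX. if lin_rank sV X = d then fhat f X * ee X A else 0)"
    unfolding ev_def level_part_def by (intro sum.cong refl) (simp add: rk_bot)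
  also have "\<dots> = degree_part pr ex sV sW d f A"
    unfolding degree_part_def LX_def[symmetric] by (rule sum.inter_filter[symmetric]) (rule finite_LX)
  finally show ?thesis by simp
qed

text \<open>Globalness speaks of order exactly \<open>d\<close>. A mean at smaller order is an
  average of means at order \<open>d\<close>, obtained by enlarging \<open>fst p\<close> alone;
  \<open>d \<le> V.dim UNIV\<close> provides the room for this in \<open>V\<close>.\<close>

lemma global_imp_mean_le:
  assumes glob: "is_global sV sW d \<epsilon> f" and bool: "\<And>T. T \<in> LT \<Longrightarrow> f T \<in> {0, 1}"
    and d: "d \<le> V.dim UNIV" and p: "p \<in> pairs" "ord p \<le> d" and T: "T \<in> LT"
  shows "mean p (\<lambda>R. Re (f (T + R))) \<le> \<epsilon>"
proof -
  let ?c = "W.dim UNIV - W.dim (snd p)"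
  have "V.dim (fst p) \<le> d - ?c" "d - ?c \<le> V.dim UNIV" using p(2) d by (auto simp: ord_def)
  then obtain I where I: "I \<in> V.between (fst p) UNIV" "V.dim I = d - ?c"
    using V.exists_between_dim[OF pairsD(1)[OF p(1)] V.subspace_UNIV] by auto
  define n where "n = (I, snd p)"
  have n: "n \<in> pairs" "ple p n"
    using I(1) pairsD[OF p(1)] by (auto simp: n_def pairs_def ple_def V.between_def)
  have dn: "d = V.dim (fst n) + (W.dim UNIV - W.dim (snd n))" using I(2) p(2) by (simp add: n_def ord_def)
  have Sn: "SS n \<subseteq> SS p" using n(2) unfolding subset_iff SS_iff ple_def by blast
  have "mean p (\<lambda>R. Re (f (T + R))) = mean p (\<lambda>R. mean n (\<lambda>R'. Re (f (T + (R + R')))))"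
    by (rule mean_tower[OF p(1) n(1) Sn, symmetric])
  also have "\<dots> \<le> \<epsilon>"
  proof (rule mean_le[OF p(1)])
    fix R assume "R \<in> SS p"
    then have TR: "T + R \<in> LT" by (intro add_LT[OF T] SS_LT)
    have "mean n (\<lambda>R'. Re (f (T + (R + R')))) = (\<Sum>R'\<in>SS n. (cmod (restr f (T + R) R'))\<^sup>2) / real (card (SS n))"
      unfolding mean_def
    proof (intro arg_cong2[where f="(/)"] refl sum.cong)
      fix R' assume R': "R' \<in> SS n"
      have e: "(\<lambda>v. R' v + (T + R) v) = T + (R + R')" by (rule ext) (simp add: ac_simps)
      have "T + (R + R') \<in> LT" using add_LT[OF TR SS_LT[OF R']] by (simp only: add.assoc)
      then have "f (T + (R + R')) \<in> {0, 1}" by (rule bool)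
      then show "Re (f (T + (R + R'))) = (cmod (restr f (T + R) R'))\<^sup>2"
        unfolding restr_def e by auto
    qed
    also have "\<dots> = (L2_norm (sub_lin_maps sV sW (fst n) (snd n)) (restr f (T + R)))\<^sup>2"
      unfolding L2_norm_power2 SS_def ..
    also have "\<dots> \<le> \<epsilon>"
      using glob[unfolded is_global_def] pairsD[OF n(1)] TR dn unfolding LT_def by blast
    finally show "mean n (\<lambda>R'. Re (f (T + (R + R')))) \<le> \<epsilon>" .
  qed
  finally show ?thesis .
qed

lemma level_inequality_global:
  assumes \<epsilon>: "\<epsilon> > 0" and bool: "\<And>T. T \<in> LT \<Longrightarrow> f T \<in> {0, 1}"
    and glob: "is_global sV sW d \<epsilon> f"
  shows "(L2_norm LT (degree_part pr ex sV sW d f))\<^sup>2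
    \<le> real CARD('k) ^ (920 * d\<^sup>2 * 2 ^ s) * Re (avg LT f) * \<epsilon> powr (1 - 1 / 2 ^ s)"
proof -
  let ?a = "level_part (fhat f) bot_pair d" and ?e = "\<epsilon> powr (1 - 1 / 2 ^ s)"
  have "NS ?a bot_pair 0 = mean bot_pair (\<lambda>R. (cmod (ev ?a (0 + R)))\<^sup>2)"
    by (rule NS_eq_mean[OF bot_pair(1) zero_LT])
  also have "\<dots> = (L2_norm LT (degree_part pr ex sV sW d f))\<^sup>2"
    unfolding L2_norm_power2 mean_def bot_pair(2) degree_part_eq_ev add_0_left ..
  finally have lhs: "(L2_norm LT (degree_part pr ex sV sW d f))\<^sup>2 = NS ?a bot_pair 0" by (rule sym)
  have "Re (avg LT f) = (\<Sum>R\<in>LT. Re (f R)) / real (card LT)"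
    unfolding avg_def by (simp only: Re_divide_of_nat Re_sum)
  then have rhs: "mean bot_pair (\<lambda>R. Re (f (0 + R))) = Re (avg LT f)"
    unfolding mean_def bot_pair(2) add_0_left by (rule sym)
  show ?thesis
  proof (cases "d \<le> V.dim UNIV")
    case True
    have epow: "?e ^ 2 ^ s = \<epsilon> ^ (2 ^ s - 1)"
    proof -
      have "?e ^ 2 ^ s = ?e powr real (2 ^ s)" using \<epsilon> by (intro powr_realpow[symmetric]) simp
      also have "\<dots> = \<epsilon> powr ((1 - 1 / 2 ^ s) * real (2 ^ s))" by (rule powr_powr)
      also have "(1 - 1 / 2 ^ s) * real (2 ^ s) = real (2 ^ s - 1)"
        by (simp add: of_nat_diff field_simps)
      also have "\<epsilon> powr real (2 ^ s - 1) = \<epsilon> ^ (2 ^ s - 1)" by (rule powr_realpow[OF \<epsilon>])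
      finally show ?thesis .
    qed
    have g: "mean p (\<lambda>R. Re (f (T + R))) \<le> \<epsilon>" if "p \<in> pairs" "T \<in> LT" "ord p \<le> d" for p T
      by (rule global_imp_mean_le[OF glob bool True that(1,3,2)])
    have "ord bot_pair + d \<le> d" using bot_pair(4) by simp
    then have "NS ?a bot_pair 0 \<le> real CARD('k) ^ (920 * d\<^sup>2 * 2 ^ s) * mean bot_pair (\<lambda>R. Re (f (0 + R))) * ?e"
      by (intro level_inequality[OF bool g _ epow \<epsilon> bot_pair(1) zero_LT]) auto
    then show ?thesis unfolding lhs rhs .
  next
    \<comment> \<open>No map has rank beyond the dimension of \<open>V\<close>, so the level part is
      zero and only the sign of the right-hand side matters.\<close>
    case False
    have "?a X = 0" if X: "X \<in> LX" for X
      using rk_im[OF bot_pair(1) X] V.dim_subset[of "im bot_pair X" UNIV] False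
      by (auto simp: level_part_def)
    then have "NS ?a bot_pair 0 = 0" by (rule NS_eq_0)
    moreover have "mean bot_pair (\<lambda>R. Re (f (0 + R))) \<ge> 0"
    proof (rule mean_nonneg)
      fix R assume "R \<in> SS bot_pair"
      then have "f (0 + R) \<in> {0, 1}" unfolding add_0_left bot_pair(2) by (rule bool)
      then show "Re (f (0 + R)) \<ge> 0" by auto
    qed
    ultimately show ?thesis unfolding lhs rhs by simp
  qed
qed

end

theorem theorem1p14:
  fixes sV :: "'k::{field,finite} \<Rightarrow> 'v::ab_group_add \<Rightarrow> 'v"
    and sW :: "'k \<Rightarrow> 'w::ab_group_add \<Rightarrow> 'w"
    and BV :: "'v set" and BW :: "'w set"
    and p m q d l :: nat and \<epsilon> :: real
    and f :: "('v \<Rightarrow> 'w) \<Rightarrow> complex"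
  assumes "prime p" and "q = p ^ m" and "CARD('k) = q"
    and "finite_dimensional_vector_space sV BV"
    and "finite_dimensional_vector_space sW BW"
    and "\<epsilon> > 0"
    and "\<And>A. A \<in> lin_maps sV sW \<Longrightarrow> f A \<in> {0, 1}"
    and "is_global sV sW d \<epsilon> f"
    and "l \<ge> 2" and "\<exists>k. l = 2 ^ k"
  shows "(L2_norm (lin_maps sV sW) (degree_part p m sV sW d f))\<^sup>2
    \<le> real q ^ (460 * d\<^sup>2 * l) * Re (avg (lin_maps sV sW) f) * \<epsilon> powr (1 - 2 / real l)"
proof -
  \<comment> \<open>\<open>l \<ge> 2\<close> makes the exponent of 2 a successor, so
    \<open>l / 2\<close> is again a power \<open>2 ^ s\<close>, the number \<open>t\<close> of the
    induction.\<close>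
  obtain k where k: "l = 2 ^ k" using assms(10) by blast
  with assms(9) obtain s where "k = Suc s" by (cases k) auto
  with k have l: "l = 2 * 2 ^ s" by simp
  have exps: "920 * d\<^sup>2 * 2 ^ s = 460 * d\<^sup>2 * l" "1 - 1 / 2 ^ s = 1 - 2 / real l"
    by (simp_all add: l)
  interpret lin_char sV BV sW BW p m
    by (intro lin_char.intro lin_pair.intro fin_vs.intro lin_char_axioms.intro)
       (use assms(1-5) in simp_all)
  have "(L2_norm LT (degree_part p m sV sW d f))\<^sup>2
    \<le> real CARD('k) ^ (920 * d\<^sup>2 * 2 ^ s) * Re (avg LT f) * \<epsilon> powr (1 - 1 / 2 ^ s)"
    by (rule level_inequality_global[OF assms(6) _ assms(8)]) (rule assms(7)[folded LT_def])
  then show ?thesis unfolding exps assms(3) LT_def .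
qed

end
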